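(* Assume $I\times J\subset\,]0,T]\times]0,1[$. There exists a positive constant $c=c(I,J)$ such that for any $(s_0,y_0)\in I\times J$, for all $\delta_1\in\,]0,1[$ satisfying $$s_0+\delta_1\in I\quad\text{and}\quad\delta_1^{1/2}<\min\{\underline J-c_2,\ (C_2-\bar J)/2\},$$ and for all $z_2\ge\delta_1^{1/4}$ and $z_1\in\mathbb{R}$, $$p(z_1,z_2)\le\frac{c}{\delta_1^{1/4}}\exp\left(-\frac{z_2^2}{c\,\delta_1^{1/2}}\right)(|z_1|^{-1/4}\wedge1)\exp(-z_1^2/c)\le\frac{c}{\delta_1^{1/4}}\exp\left(-\frac{z_2^2}{c\,\delta_1^{1/2}}\right).$$
   Context: Notation: $]a,b[$ is the open interval; $|z_1|^{-1/4}\wedge1=1$ at $z_1=0$. $W$ is a Brownian sheet on $[0,\infty[\times[0,1]$ on a probability space $(\Omega,\mathscr F,\mathrm P)$ and $\dot W$ the associated space-time white noise. Fix either Neumann or Dirichlet boundary conditions at $x=0,1$, and let $G(t,x,y)$ be the corresponding Green kernel of $\partial_t-\partial_x^2$ on $[0,1]$ (Neumann: $1+2\sum_{k\ge1}e^{-\pi^2k^2t}\cos(k\pi x)\cos(k\pi y)$; Dirichlet: $2\sum_{k\ge1}e^{-\pi^2k^2t}\sin(k\pi x)\sin(k\pi y)$). The mild solution of $\partial_tu=\partial_x^2u+\dot W$ with $u(0,\cdot)=0$ and these boundary conditions is $u(t,x)=\int_0^t\int_0^1G(t-r,x,v)\,W(dr,dv)$; $u$ denotes its jointly continuous version. Fix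 $T>0$. $I\subset[0,T]$ and $J\subset[0,1]$ are non-trivial compact intervals; $\underline I=\inf I$, $\bar I=\sup I$, $\underline J=\inf J$, $\bar J=\sup J$. Constants $c_1,C_1,c_2,C_2$ with $0<c_1<\underline I$, $\bar I<C_1<T+1$, $0<c_2<\underline J$, $\bar J<C_2<1$ are fixed once and for all (depending on $I,J$). For $(s_0,y_0)\in I\times J$ and $\delta_1>0$ put $F_1=u(s_0,y_0)$, $F_2=\sup_{t\in[s_0,s_0+\delta_1]}(u(t,y_0)-u(s_0,y_0))$, $F=(F_1,F_2)$. The law of $F$ has an infinitely differentiable density on $\mathbb{R}\times]0,\infty[$, denoted $(z_1,z_2)\mapsto p(z_1,z_2)$ (it depends on $s_0,y_0,\delta_1$). *)

theory Defs
  imports "HOL-Probability.Probability"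
begin

text \<open>Gaussian random variables and processes; constants count as (degenerate) Gaussian variables.\<close>

definition gaussian_rv :: "'w measure \<Rightarrow> ('w \<Rightarrow> real) \<Rightarrow> bool" where
  "gaussian_rv M X \<longleftrightarrow> X \<in> borel_measurable M \<and>
     ((\<exists>\<mu>. AE \<omega> in M. X \<omega> = \<mu>) \<or> (\<exists>\<mu> \<sigma>. 0 < \<sigma> \<and> distributed M lborel X (normal_density \<mu> \<sigma>)))"

definition gaussian_process :: "'w measure \<Rightarrow> 'i set \<Rightarrow> ('i \<Rightarrow> 'w \<Rightarrow> real) \<Rightarrow> bool" where
  "gaussian_process M K X \<longleftrightarrow>
     (\<forall>S a. finite S \<longrightarrow> S \<subseteq> K \<longrightarrow> gaussian_rv M (\<lambda>\<omega>. \<Sum>i\<in>S. a i * X i \<omega>))"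

definition brownian_sheet :: "'w measure \<Rightarrow> (real \<Rightarrow> real \<Rightarrow> 'w \<Rightarrow> real) \<Rightarrow> bool" where
  "brownian_sheet M W \<longleftrightarrow>
     gaussian_process M ({0..} \<times> {0..1}) (\<lambda>(t, x). W t x) \<and>
     (\<forall>t\<ge>0. \<forall>x\<in>{0..1}. (\<integral>\<omega>. W t x \<omega> \<partial>M) = 0) \<and>
     (\<forall>t\<ge>0. \<forall>x\<in>{0..1}. \<forall>s\<ge>0. \<forall>y\<in>{0..1}. (\<integral>\<omega>. W t x \<omega> * W s y \<omega> \<partial>M) = min t s * min x y) \<and>
     (AE \<omega> in M. continuous_on ({0..} \<times> {0..1}) (\<lambda>(t, x). W t x \<omega>))"

text \<open>
  The Wiener integral with respect to the white noise of \<open>W\<close>. A step function is a list of tuples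
  \<open>(q, a, b, x, y)\<close>, each standing for \<open>q\<close> times the indicator of \<open>]a,b] \<times> ]x,y]\<close>; the white noise
  of such a rectangle is the corresponding increment of the sheet. The integral of a square
  integrable function is the \<open>L\<^sup>2\<close>-limit of the integrals of approximating step functions; it is
  only determined almost surely, hence the relational definition.
\<close>

type_synonym step = "(real \<times> real \<times> real \<times> real \<times> real) list"

definition valid_step :: "step \<Rightarrow> bool" where
  "valid_step L \<longleftrightarrow> (\<forall>(q, a, b, x, y)\<in>set L. 0 \<le> a \<and> a \<le> b \<and> 0 \<le> x \<and> x \<le> y \<and> y \<le> 1)"

definition step_fun :: "step \<Rightarrow> real \<times> real \<Rightarrow> real" where
  "step_fun L z = (\<Sum>(q, a, b, x, y)\<leftarrow>L. q * indicator ({a<..b} \<times> {x<..y}) z)"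

definition step_integral :: "(real \<Rightarrow> real \<Rightarrow> 'w \<Rightarrow> real) \<Rightarrow> step \<Rightarrow> 'w \<Rightarrow> real" where
  "step_integral W L \<omega> = (\<Sum>(q, a, b, x, y)\<leftarrow>L. q * (W b y \<omega> - W a y \<omega> - W b x \<omega> + W a x \<omega>))"

definition has_wiener_integral ::
  "'w measure \<Rightarrow> (real \<Rightarrow> real \<Rightarrow> 'w \<Rightarrow> real) \<Rightarrow> (real \<times> real \<Rightarrow> real) \<Rightarrow> ('w \<Rightarrow> real) \<Rightarrow> bool" where
  "has_wiener_integral M W h X \<longleftrightarrow>
     X \<in> borel_measurable M \<and> set_borel_measurable lborel ({0..} \<times> {0..1}) h \<and>
     (\<exists>L. (\<forall>n. valid_step (L n)) \<and>
        (\<lambda>n. \<integral>\<^sup>+z\<in>{0..} \<times> {0..1}. ennreal ((step_fun (L n) z - h z)\<^sup>2) \<partial>lborel) \<longlonglongrightarrow> 0 \<and>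
        (\<lambda>n. \<integral>\<^sup>+\<omega>. ennreal ((step_integral W (L n) \<omega> - X \<omega>)\<^sup>2) \<partial>M) \<longlonglongrightarrow> 0)"

datatype boundary_condition = Neumann | Dirichlet

text \<open>The series converges for \<open>t > 0\<close> only; no other value of \<open>t\<close> is used below.\<close>

primrec green :: "boundary_condition \<Rightarrow> real \<Rightarrow> real \<Rightarrow> real \<Rightarrow> real" where
  "green Neumann t x y =
     1 + 2 * (\<Sum>k. exp (- (pi\<^sup>2 * (real (Suc k))\<^sup>2 * t)) * cos (real (Suc k) * pi * x) * cos (real (Suc k) * pi * y))"
| "green Dirichlet t x y =
     2 * (\<Sum>k. exp (- (pi\<^sup>2 * (real (Suc k))\<^sup>2 * t)) * sin (real (Suc k) * pi * x) * sin (real (Suc k) * pi * y))"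

text \<open>
  \<open>u\<close> is a jointly continuous version of the mild solution of the stochastic heat equation driven
  by the white noise of \<open>W\<close>, with vanishing initial condition.
\<close>

definition continuous_mild_solution ::
  "'w measure \<Rightarrow> (real \<Rightarrow> real \<Rightarrow> 'w \<Rightarrow> real) \<Rightarrow> boundary_condition \<Rightarrow> (real \<Rightarrow> real \<Rightarrow> 'w \<Rightarrow> real) \<Rightarrow> bool" where
  "continuous_mild_solution M W bc u \<longleftrightarrow>
     (\<forall>t\<ge>0. \<forall>x\<in>{0..1}.
        has_wiener_integral M W (\<lambda>(r, v). if r < t then green bc (t - r) x v else 0) (u t x)) \<and>
     (\<forall>\<omega>\<in>space M. continuous_on ({0..} \<times> {0..1}) (\<lambda>(t, x). u t x \<omega>))"

definition F1 :: "(real \<Rightarrow> real \<Rightarrow> 'w \<Rightarrow> real) \<Rightarrow> real \<Rightarrow> real \<Rightarrow> 'w \<Rightarrow> real" where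
  "F1 u s0 y0 \<omega> = u s0 y0 \<omega>"

definition F2 :: "(real \<Rightarrow> real \<Rightarrow> 'w \<Rightarrow> real) \<Rightarrow> real \<Rightarrow> real \<Rightarrow> real \<Rightarrow> 'w \<Rightarrow> real" where
  "F2 u s0 y0 \<delta>1 \<omega> = (SUP t\<in>{s0..s0 + \<delta>1}. u t y0 \<omega> - u s0 y0 \<omega>)"

primrec C_k_on :: "nat \<Rightarrow> 'a::real_normed_vector set \<Rightarrow> ('a \<Rightarrow> real) \<Rightarrow> bool" where
  "C_k_on 0 S f \<longleftrightarrow> continuous_on S f"
| "C_k_on (Suc k) S f \<longleftrightarrow>
     (\<forall>z\<in>S. f differentiable (at z)) \<and> (\<forall>v. C_k_on k S (\<lambda>z. frechet_derivative f (at z) v))"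

text \<open>
  \<open>p\<close> is an infinitely differentiable density on the open set \<open>D\<close> of the law of \<open>X\<close>. Continuity
  determines the values of \<open>p\<close> on \<open>D\<close>; nothing is said outside of \<open>D\<close>.
\<close>

definition smooth_density_on ::
  "'w measure \<Rightarrow> ('w \<Rightarrow> real \<times> real) \<Rightarrow> (real \<times> real) set \<Rightarrow> (real \<times> real \<Rightarrow> real) \<Rightarrow> bool" where
  "smooth_density_on M X D p \<longleftrightarrow>
     X \<in> borel_measurable M \<and> (\<forall>k. C_k_on k D p) \<and> (\<forall>z\<in>D. 0 \<le> p z) \<and>
     (\<forall>A\<in>sets borel. A \<subseteq> D \<longrightarrow> emeasure (distr M borel X) A = (\<integral>\<^sup>+z\<in>A. ennreal (p z) \<partial>lborel))"

definition nontrivial_compact_interval :: "real set \<Rightarrow> bool" where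
  "nontrivial_compact_interval K \<longleftrightarrow> (\<exists>a b. a < b \<and> K = {a..b})"

text \<open>
  The minimum of \<open>\<bar>z\<bar>\<close> to the power \<open>-1/4\<close> and \<open>1\<close>, equal to \<open>1\<close> at the origin. The case
  distinction is needed because \<open>0 powr a = 0\<close>.
\<close>

definition decay_factor :: "real \<Rightarrow> real" where
  "decay_factor z = (if z = 0 then 1 else min (\<bar>z\<bar> powr (-1/4)) 1)"

end

theory Submission
  imports Defs
begin

text \<open>
  Write \<open>X\<^sub>t = u(t, y\<^sub>0) - u(s\<^sub>0, y\<^sub>0)\<close>. Gaussian measures are log-concave (Prekopa--Leindler), so for an
  interval \<open>A\<close> the function \<open>L(z) = P(F\<^sub>1 \<in> A, F\<^sub>2 \<le> z)\<close> is log-concave in \<open>z\<close>. Comparing its slope at \<open>z\<^sub>2\<close>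
  with the chord over \<open>[z\<^sub>2/2, z\<^sub>2]\<close> bounds the probability of a small box by
  \<open>P(F\<^sub>1 \<in> A) \<cdot> (2k/z\<^sub>2) \<cdot> ln (P(F\<^sub>1 \<in> A) / L(z\<^sub>2/2))\<close>, and the density, being continuous, by the limit of such
  quotients.

  It remains to bound \<open>P(F\<^sub>2 \<le> z\<^sub>2/2 | F\<^sub>1 \<in> A)\<close> from below. If \<open>|F\<^sub>1|\<close> is small compared with
  \<open>z\<^sub>2 / \<delta>\<^sub>1\<^bsup>1/4\<^esup>\<close>, chaining for the part of \<open>X\<close> independent of \<open>F\<^sub>1\<close> gives a Gaussian tail. In general one
  uses the part \<open>D\<close> of \<open>u(s\<^sub>0 + \<delta>\<^sub>1, y\<^sub>0)\<close> independent of \<open>F\<^sub>1\<close>: the covariance of \<open>X\<^sub>t\<close> with \<open>F\<^sub>1\<close> is negative and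
  that with \<open>D\<close> dominates a multiple of its modulus, so a large negative value of \<open>D\<close> offsets any contribution of \<open>F\<^sub>1\<close> and pushes
  \<open>X\<^sub>t\<close> below the level except for \<open>t\<close> so close to \<open>s\<^sub>0\<close> that chaining suffices; the price is
  \<open>exp (- C (1 + F\<^sub>1\<^sup>2))\<close>. The required covariance estimates follow from the eigenfunction expansion of \<open>G\<close>.
\<close>

section \<open>Joint laws and characteristic functions\<close>

text \<open>The obstacle is that a supremum is not Gaussian and has no explicit density;
  log-concavity turns bounds on probabilities into bounds on densities. The logarithm decides how
  good the lower bound for P(F2 \<le> z2/2 | F1 in A) must be. If this probability is 1 - q with q
  \<le> 1/2, the logarithm is at most 2 q, which is the source of the Gaussian factor in z2. A bound
  as poor as exp (- C (1 + F1^2)) costs only the factor C (1 + F1^2). It is used when q > 1/2, where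
  nothing better is required, and when |F1| is at least of order z2 / \<delta>1^(1/4). In the latter
  case exp (\<epsilon> F1^2) outweighs the missing Gaussian factor in z2, and for small \<epsilon>
  this is paid for by the normal density of F1, half of whose exponent survives. The offset by D
  works for all t because the covariance of X_t with D controls the modulus of that with F1 at every
  t. That this modulus is at least of order sqrt (t - s0) gives the room for chaining away from s0.
  All constants on dyadic grids are independent of the mesh.\<close>

lemma integrable_mult_of_squares:
  fixes X Y :: "'a \<Rightarrow> real"
  assumes [measurable]: "X \<in> borel_measurable M" "Y \<in> borel_measurable M"
    and "integrable M (\<lambda>\<omega>. (X \<omega>)\<^sup>2)" "integrable M (\<lambda>\<omega>. (Y \<omega>)\<^sup>2)"
  shows "integrable M (\<lambda>\<omega>. X \<omega> * Y \<omega>)"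
proof (rule Bochner_Integration.integrable_bound)
  show "integrable M (\<lambda>\<omega>. (X \<omega>)\<^sup>2 + (Y \<omega>)\<^sup>2)" using assms by simp
  have "\<bar>x * y\<bar> \<le> x\<^sup>2 + y\<^sup>2" for x y :: real
  proof -
    have "2 * (\<bar>x\<bar> * \<bar>y\<bar>) \<le> x\<^sup>2 + y\<^sup>2" using sum_squares_bound[of "\<bar>x\<bar>" "\<bar>y\<bar>"] by simp
    moreover have "0 \<le> \<bar>x\<bar> * \<bar>y\<bar>" by simp
    ultimately show ?thesis unfolding abs_mult by linarith
  qed
  thus "AE \<omega> in M. norm (X \<omega> * Y \<omega>) \<le> norm ((X \<omega>)\<^sup>2 + (Y \<omega>)\<^sup>2)" by simp
qed simp

lemma integrable_mult_bounded:
  fixes g :: "'a \<Rightarrow> real" and f :: "'a \<Rightarrow> 'b :: {real_normed_algebra_1, banach, second_countable_topology}"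
  assumes g: "integrable M g" and [measurable]: "f \<in> borel_measurable M" and f: "\<And>\<omega>. norm (f \<omega>) \<le> B"
  shows "integrable M (\<lambda>\<omega>. g \<omega> *\<^sub>R f \<omega>)"
proof (rule Bochner_Integration.integrable_bound[OF integrable_mult_right[OF g, of B]])
  have "norm (g \<omega> *\<^sub>R f \<omega>) \<le> norm (B * g \<omega>)" for \<omega>
    using mult_left_mono[OF f[of \<omega>], of "\<bar>g \<omega>\<bar>"] order_trans[OF norm_ge_zero f[of \<omega>]]
    by (simp add: abs_mult mult.commute)
  thus "AE \<omega> in M. norm (g \<omega> *\<^sub>R f \<omega>) \<le> norm (B * g \<omega>)" by simp
qed (use g in measurable)

text \<open>Dividing the weight by its total mass gives a probability measure, so that Levy's
  uniqueness theorem, which concerns probability laws, applies to weighted integrals.\<close>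

lemma weighted_distr:
  fixes k :: "'z \<Rightarrow> real" and Z :: "'z \<Rightarrow> real"
  assumes k: "integrable K k" "\<And>\<omega>. 0 \<le> k \<omega>" "(\<integral>\<omega>. k \<omega> \<partial>K) = c" and Z[measurable]: "Z \<in> borel_measurable K"
    and [measurable]: "A \<in> sets borel" and "c > 0"
  shows "real_distribution (distr (density K (\<lambda>\<omega>. ennreal (k \<omega> / c))) borel Z) \<and>
       (\<forall>t. char (distr (density K (\<lambda>\<omega>. ennreal (k \<omega> / c))) borel Z) t = (CLINT \<omega>|K. k \<omega> * iexp (t * Z \<omega>)) / c) \<and>
       (\<integral>\<omega>. k \<omega> * indicator A (Z \<omega>) \<partial>K) = c * measure (distr (density K (\<lambda>\<omega>. ennreal (k \<omega> / c))) borel Z) A"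
proof -
  note [measurable] = borel_measurable_integrable[OF k(1)]
  let ?D = "density K (\<lambda>\<omega>. ennreal (k \<omega> / c))"
  have "emeasure ?D (space ?D) = (\<integral>\<^sup>+\<omega>. ennreal (k \<omega> / c) \<partial>K)"
    by (subst emeasure_density) (auto intro!: nn_integral_cong)
  also have "\<dots> = ennreal (\<integral>\<omega>. k \<omega> / c \<partial>K)"
    using k \<open>c > 0\<close> by (intro nn_integral_eq_integral) auto
  also have "\<dots> = 1" using k(3) \<open>c > 0\<close> by simp
  finally interpret D: prob_space ?D by (rule prob_spaceI)
  have 1: "real_distribution (distr ?D borel Z)"
    by (intro D.real_distribution_distr) simp
  have 2: "char (distr ?D borel Z) t = (CLINT \<omega>|K. k \<omega> * iexp (t * Z \<omega>)) / c" for t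
  proof -
    have "char (distr ?D borel Z) t = (CLINT \<omega>|?D. iexp (t * Z \<omega>))"
      unfolding char_def by (subst integral_distr) auto
    also have "\<dots> = (CLINT \<omega>|K. (k \<omega> / c) *\<^sub>R iexp (t * Z \<omega>))"
      using k(2) \<open>c > 0\<close> by (subst integral_density) auto
    also have "\<dots> = (CLINT \<omega>|K. (k \<omega> * iexp (t * Z \<omega>)) / c)"
      by (intro Bochner_Integration.integral_cong) (auto simp: scaleR_conv_of_real)
    finally show ?thesis by simp
  qed
  have "measure (distr ?D borel Z) A = measure ?D (Z -` A \<inter> space ?D)"
    by (subst measure_distr) auto
  also have "\<dots> = (\<integral>\<omega>. indicator (Z -` A \<inter> space ?D) \<omega> \<partial>?D)"
    by simp
  also have "\<dots> = (\<integral>\<omega>. indicator A (Z \<omega>) \<partial>?D)"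
    by (intro Bochner_Integration.integral_cong) (auto simp: indicator_def)
  also have "\<dots> = (\<integral>\<omega>. (k \<omega> / c) *\<^sub>R indicator A (Z \<omega>) \<partial>K)"
    using k(2) \<open>c > 0\<close> by (subst integral_density) auto
  also have "\<dots> = (\<integral>\<omega>. (k \<omega> * indicator A (Z \<omega>)) / c \<partial>K)"
    by (intro Bochner_Integration.integral_cong) auto
  finally have 3: "(\<integral>\<omega>. k \<omega> * indicator A (Z \<omega>) \<partial>K) = c * measure (distr ?D borel Z) A"
    using \<open>c > 0\<close> by simp
  show ?thesis using 1 2 3 by blast
qed

lemma weighted_char_unique:
  fixes X g :: "'a \<Rightarrow> real" and Y h :: "'b \<Rightarrow> real"
  assumes [measurable]: "X \<in> borel_measurable M" "Y \<in> borel_measurable N"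
    and g: "integrable M g" "\<And>\<omega>. 0 \<le> g \<omega>" and h: "integrable N h" "\<And>\<omega>. 0 \<le> h \<omega>"
    and eq: "\<And>t. (CLINT \<omega>|M. g \<omega> * iexp (t * X \<omega>)) = (CLINT \<omega>|N. h \<omega> * iexp (t * Y \<omega>))"
    and A: "A \<in> sets borel"
  shows "(\<integral>\<omega>. g \<omega> * indicator A (X \<omega>) \<partial>M) = (\<integral>\<omega>. h \<omega> * indicator A (Y \<omega>) \<partial>N)"
proof -
  note [measurable] = borel_measurable_integrable[OF g(1)] borel_measurable_integrable[OF h(1)] A
  define c where "c = (\<integral>\<omega>. g \<omega> \<partial>M)"
  \<comment> \<open>At \<open>t = 0\<close> the transforms are the total masses, so both weights are
    normalised by the same \<open>c\<close>; the case \<open>c = 0\<close> needs separate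
    treatment.\<close>
  have "complex_of_real (\<integral>\<omega>. g \<omega> \<partial>M) = complex_of_real (\<integral>\<omega>. h \<omega> \<partial>N)"
    using eq[of 0] by simp
  hence c: "c = (\<integral>\<omega>. h \<omega> \<partial>N)" by (simp add: c_def)
  have "c \<ge> 0" unfolding c_def using g(2) by simp
  show ?thesis
  proof (cases "c = 0")
    case True
    have "AE \<omega> in M. g \<omega> = 0"
      using integral_nonneg_eq_0_iff_AE[OF g(1)] g(2) True c_def by simp
    moreover have "AE \<omega> in N. h \<omega> = 0"
      using integral_nonneg_eq_0_iff_AE[OF h(1)] h(2) True c by simp
    ultimately have "AE \<omega> in M. g \<omega> * indicator A (X \<omega>) = 0" "AE \<omega> in N. h \<omega> * indicator A (Y \<omega>) = 0"
      by auto
    thus ?thesis by (simp add: integral_eq_zero_AE)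
  next
    case False
    with \<open>c \<ge> 0\<close> have "c > 0" by simp
    note gM = weighted_distr[OF g c_def[symmetric] assms(1) A \<open>c > 0\<close>] and gN = weighted_distr[OF h c[symmetric] assms(2) A \<open>c > 0\<close>]
    have "distr (density M (\<lambda>\<omega>. ennreal (g \<omega> / c))) borel X = distr (density N (\<lambda>\<omega>. ennreal (h \<omega> / c))) borel Y"
      using gM gN eq by (intro Levy_uniqueness) (auto simp: fun_eq_iff)
    thus ?thesis using gM gN by simp
  qed
qed

text \<open>
  The weights \<open>1 + cos (V + \<theta>)\<close> are nonnegative, so Levy's uniqueness theorem applies to the coordinate \<open>j\<close>
  under the weighted measures; varying \<open>\<theta>\<close> recovers the mixed transform, and the indicator of \<open>A j\<close> can be
  absorbed into the weight for the remaining coordinates.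
\<close>

lemma weighted_cramer_wold:
  fixes X :: "'i \<Rightarrow> 'a \<Rightarrow> real" and Y :: "'i \<Rightarrow> 'b \<Rightarrow> real" and g :: "'a \<Rightarrow> real" and h :: "'b \<Rightarrow> real"
  assumes "finite I"
    and "\<And>i. i \<in> I \<Longrightarrow> X i \<in> borel_measurable M" "\<And>i. i \<in> I \<Longrightarrow> Y i \<in> borel_measurable N"
    and "integrable M g" "\<And>\<omega>. 0 \<le> g \<omega>" and "integrable N h" "\<And>\<omega>. 0 \<le> h \<omega>"
    and "\<And>a. (CLINT \<omega>|M. g \<omega> * iexp (\<Sum>i\<in>I. a i * X i \<omega>)) = (CLINT \<omega>|N. h \<omega> * iexp (\<Sum>i\<in>I. a i * Y i \<omega>))"
    and "\<And>i. i \<in> I \<Longrightarrow> A i \<in> sets borel"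
  shows "(\<integral>\<omega>. g \<omega> * (\<Prod>i\<in>I. indicator (A i) (X i \<omega>)) \<partial>M) = (\<integral>\<omega>. h \<omega> * (\<Prod>i\<in>I. indicator (A i) (Y i \<omega>)) \<partial>N)"
  using assms
proof (induction I arbitrary: g h rule: finite_induct)
  case empty
  have "complex_of_real (\<integral>\<omega>. g \<omega> \<partial>M) = complex_of_real (\<integral>\<omega>. h \<omega> \<partial>N)"
    using empty(7)[of "\<lambda>_. 0"] by simp
  then show ?case by simp
next
  case (insert j I)
  note j = insert(1,2)
  have X[measurable]: "\<And>i. i \<in> insert j I \<Longrightarrow> X i \<in> borel_measurable M" and Y[measurable]: "\<And>i. i \<in> insert j I \<Longrightarrow> Y i \<in> borel_measurable N" 
     using insert by auto
  have A[measurable]: "\<And>i. i \<in> insert j I \<Longrightarrow> A i \<in> sets borel" using insert by auto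
  have [measurable]: "X j \<in> borel_measurable M" "Y j \<in> borel_measurable N" "A j \<in> sets borel" by simp_all
  have g[measurable]: "g \<in> borel_measurable M" and h[measurable]: "h \<in> borel_measurable N"
    using insert by auto
  define V where "V a \<omega> = (\<Sum>i\<in>I. a i * X i \<omega>)" for a \<omega>
  define U where "U a \<omega> = (\<Sum>i\<in>I. a i * Y i \<omega>)" for a \<omega>
  have [measurable]: "V a \<in> borel_measurable M" "U a \<in> borel_measurable N" for a
    unfolding V_def U_def using X Y by (auto intro!: borel_measurable_sum borel_measurable_times)
  have intM: "integrable M (\<lambda>\<omega>. complex_of_real (g \<omega>) * f \<omega>)" if "f \<in> borel_measurable M" and "\<And>\<omega>. cmod (f \<omega>) \<le> B" for f B
    using integrable_mult_bounded[OF insert(6) that] by (simp add: scaleR_conv_of_real)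
  have intN: "integrable N (\<lambda>\<omega>. complex_of_real (h \<omega>) * f \<omega>)" if "f \<in> borel_measurable N" and "\<And>\<omega>. cmod (f \<omega>) \<le> B" for f B
    using integrable_mult_bounded[OF insert(8) that] by (simp add: scaleR_conv_of_real)
  have intMr: "integrable M (\<lambda>\<omega>. g \<omega> * f \<omega>)" if "f \<in> borel_measurable M" and "\<And>\<omega>. \<bar>f \<omega>\<bar> \<le> B" for f :: "_ \<Rightarrow> real" and B
    using integrable_mult_bounded[OF insert(6), of f B] that by simp
  have intNr: "integrable N (\<lambda>\<omega>. h \<omega> * f \<omega>)" if "f \<in> borel_measurable N" and "\<And>\<omega>. \<bar>f \<omega>\<bar> \<le> B" for f :: "_ \<Rightarrow> real" and B
    using integrable_mult_bounded[OF insert(8), of f B] that by simp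
  have key: "(CLINT \<omega>|M. g \<omega> * iexp (t * X j \<omega> + V a \<omega>)) = (CLINT \<omega>|N. h \<omega> * iexp (t * Y j \<omega> + U a \<omega>))" for t a
  proof -
    have "V a \<omega> = (\<Sum>i\<in>I. (a(j:=t)) i * X i \<omega>)" "U a \<omega>' = (\<Sum>i\<in>I. (a(j:=t)) i * Y i \<omega>')" for \<omega> \<omega>'
      unfolding V_def U_def using j by (auto intro!: sum.cong)
    thus ?thesis using insert(10)[of "a(j:=t)"] j by simp
  qed
  \<comment> \<open>By Euler's formula the weighted transform is a combination of three unweighted
    ones, with exponents \<open>s\<close>, \<open>s + v\<close> and \<open>s - v\<close>, all of
    which the hypothesis determines.\<close>
  have expand: "complex_of_real (r * (1 + cos (v + \<theta>))) * iexp s = r * iexp s + 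
    (iexp \<theta> / 2) * (r * iexp (s + v)) + (iexp (- \<theta>) / 2) * (r * iexp (s - v))" for r v \<theta> s :: real
  proof -
    have "complex_of_real (cos (v + \<theta>)) = (iexp (v + \<theta>) + iexp (-(v + \<theta>))) / 2"
      by (simp add: cos_of_real[symmetric] cos_exp_eq algebra_simps)
    hence "complex_of_real (r * (1 + cos (v + \<theta>))) * iexp s = r * iexp s + r * (iexp (v + \<theta>) * iexp s) / 2 + r * (iexp (-(v + \<theta>)) * iexp s) / 2"
      by (simp add: algebra_simps add_divide_distrib)
    also have "iexp (v + \<theta>) * iexp s = iexp \<theta> * iexp (s + v)"
      by (simp add: exp_add[symmetric] algebra_simps)
    also have "iexp (-(v + \<theta>)) * iexp s = iexp (-\<theta>) * iexp (s - v)"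
      by (simp add: exp_add[symmetric] algebra_simps)
    finally show ?thesis by (simp add: algebra_simps)
  qed
  have cb: "\<bar>1 + cos x\<bar> \<le> 2" for x :: real
    using cos_ge_minus_one[of x] cos_le_one[of x] by linarith
  have wt: "(\<integral>\<omega>. g \<omega> * (1 + cos (V a \<omega> + \<theta>)) * indicator (A j) (X j \<omega>) \<partial>M) = (\<integral>\<omega>. h \<omega> * (1 + cos (U a \<omega> + \<theta>)) * indicator (A j) (Y j \<omega>) \<partial>N)" for a \<theta>
  proof (rule weighted_char_unique)
    show "integrable M (\<lambda>\<omega>. g \<omega> * (1 + cos (V a \<omega> + \<theta>)))" "integrable N (\<lambda>\<omega>. h \<omega> * (1 + cos (U a \<omega> + \<theta>)))"
      using intMr[of "\<lambda>\<omega>. 1 + cos (V a \<omega> + \<theta>)" 2] intNr[of "\<lambda>\<omega>. 1 + cos (U a \<omega> + \<theta>)" 2] cb by auto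
    show "0 \<le> g \<omega> * (1 + cos (V a \<omega> + \<theta>))" for \<omega> using insert(7) cos_ge_minus_one by (smt (verit) mult_nonneg_nonneg)
    show "0 \<le> h \<omega> * (1 + cos (U a \<omega> + \<theta>))" for \<omega> using insert(9) cos_ge_minus_one by (smt (verit) mult_nonneg_nonneg)
    fix t
    have i1: "integrable M (\<lambda>\<omega>. g \<omega> * iexp (t * X j \<omega>))" "integrable M (\<lambda>\<omega>. g \<omega> * iexp (t * X j \<omega> + V a \<omega>))" "integrable M (\<lambda>\<omega>. g \<omega> * iexp (t * X j \<omega> - V a \<omega>))"
      by (rule intM[where B=1]; simp)+
    have i2: "integrable N (\<lambda>\<omega>. h \<omega> * iexp (t * Y j \<omega>))" "integrable N (\<lambda>\<omega>. h \<omega> * iexp (t * Y j \<omega> + U a \<omega>))" "integrable N (\<lambda>\<omega>. h \<omega> * iexp (t * Y j \<omega> - U a \<omega>))"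
      by (rule intN[where B=1]; simp)+
    have e0: "(CLINT \<omega>|M. g \<omega> * iexp (t * X j \<omega>)) = (CLINT \<omega>|N. h \<omega> * iexp (t * Y j \<omega>))"
      using key[of t "\<lambda>_. 0"] by (simp add: V_def U_def)
    have e1: "(CLINT \<omega>|M. g \<omega> * iexp (t * X j \<omega> - V a \<omega>)) = (CLINT \<omega>|N. h \<omega> * iexp (t * Y j \<omega> - U a \<omega>))"
      using key[of t "\<lambda>i. - a i"] by (simp add: V_def U_def sum_negf)
    have "(CLINT \<omega>|M. complex_of_real (g \<omega> * (1 + cos (V a \<omega> + \<theta>))) * iexp (t * X j \<omega>)) = 
       (CLINT \<omega>|M. g \<omega> * iexp (t * X j \<omega>)) + (iexp \<theta> / 2) * (CLINT \<omega>|M. g \<omega> * iexp (t * X j \<omega> + V a \<omega>)) + (iexp (- \<theta>) / 2) * (CLINT \<omega>|M. g \<omega> * iexp (t * X j \<omega> - V a \<omega>))"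
      unfolding expand using i1 by (simp only: Bochner_Integration.integral_add integrable_mult_right Bochner_Integration.integrable_add integral_mult_right_zero)
    moreover have "(CLINT \<omega>|N. complex_of_real (h \<omega> * (1 + cos (U a \<omega> + \<theta>))) * iexp (t * Y j \<omega>)) = 
       (CLINT \<omega>|N. h \<omega> * iexp (t * Y j \<omega>)) + (iexp \<theta> / 2) * (CLINT \<omega>|N. h \<omega> * iexp (t * Y j \<omega> + U a \<omega>)) + (iexp (- \<theta>) / 2) * (CLINT \<omega>|N. h \<omega> * iexp (t * Y j \<omega> - U a \<omega>))"
      unfolding expand using i2 by (simp only: Bochner_Integration.integral_add integrable_mult_right Bochner_Integration.integrable_add integral_mult_right_zero)
    ultimately show "(CLINT \<omega>|M. complex_of_real (g \<omega> * (1 + cos (V a \<omega> + \<theta>))) * iexp (t * X j \<omega>)) = 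
      (CLINT \<omega>|N. complex_of_real (h \<omega> * (1 + cos (U a \<omega> + \<theta>))) * iexp (t * Y j \<omega>))"
      using e0 e1 key by simp
  qed simp_all
  have w0: "(\<integral>\<omega>. g \<omega> * indicator (A j) (X j \<omega>) \<partial>M) = (\<integral>\<omega>. h \<omega> * indicator (A j) (Y j \<omega>) \<partial>N)"
    using key[of _ "\<lambda>_. 0"] insert by (intro weighted_char_unique) (simp_all add: V_def U_def)
  have iM: "integrable M (\<lambda>\<omega>. g \<omega> * indicator (A j) (X j \<omega>))" "integrable M (\<lambda>\<omega>. g \<omega> * (cos (V a \<omega> + \<theta>) * indicator (A j) (X j \<omega>)))" for a \<theta>
    by (rule intMr[where B=1]; force simp: indicator_def)+
  have iN: "integrable N (\<lambda>\<omega>. h \<omega> * indicator (A j) (Y j \<omega>))" "integrable N (\<lambda>\<omega>. h \<omega> * (cos (U a \<omega> + \<theta>) * indicator (A j) (Y j \<omega>)))" for a \<theta>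
    by (rule intNr[where B=1]; force simp: indicator_def)+
  have wc: "(\<integral>\<omega>. g \<omega> * (cos (V a \<omega> + \<theta>) * indicator (A j) (X j \<omega>)) \<partial>M) = (\<integral>\<omega>. h \<omega> * (cos (U a \<omega> + \<theta>) * indicator (A j) (Y j \<omega>)) \<partial>N)" for a \<theta>
  proof -
    have "(\<integral>\<omega>. g \<omega> * (1 + cos (V a \<omega> + \<theta>)) * indicator (A j) (X j \<omega>) \<partial>M) = (\<integral>\<omega>. g \<omega> * indicator (A j) (X j \<omega>) \<partial>M) + (\<integral>\<omega>. g \<omega> * (cos (V a \<omega> + \<theta>) * indicator (A j) (X j \<omega>)) \<partial>M)"
      by (subst Bochner_Integration.integral_add[OF iM, symmetric]) (auto intro!: Bochner_Integration.integral_cong simp: algebra_simps)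
    moreover have "(\<integral>\<omega>. h \<omega> * (1 + cos (U a \<omega> + \<theta>)) * indicator (A j) (Y j \<omega>) \<partial>N) = (\<integral>\<omega>. h \<omega> * indicator (A j) (Y j \<omega>) \<partial>N) + (\<integral>\<omega>. h \<omega> * (cos (U a \<omega> + \<theta>) * indicator (A j) (Y j \<omega>)) \<partial>N)"
      by (subst Bochner_Integration.integral_add[OF iN, symmetric]) (auto intro!: Bochner_Integration.integral_cong simp: algebra_simps)
    ultimately show ?thesis using w0 wt[of a \<theta>] by simp
  qed
  \<comment> \<open>The phases \<open>0\<close> and \<open>- (pi / 2)\<close> give cosine and sine,
    that is, the real and the imaginary part of the mixed transform.\<close>
  have sp: "complex_of_real (r * i) * iexp v = complex_of_real (r * (cos (v + 0) * i)) + \<i> * complex_of_real (r * (cos (v + - (pi / 2)) * i))" for r i v :: real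
    by (simp add: cos_diff exp_Euler cos_of_real sin_of_real algebra_simps)
  have "(\<integral>\<omega>. (g \<omega> * indicator (A j) (X j \<omega>)) * (\<Prod>i\<in>I. indicator (A i) (X i \<omega>)) \<partial>M) = (\<integral>\<omega>. (h \<omega> * indicator (A j) (Y j \<omega>)) * (\<Prod>i\<in>I. indicator (A i) (Y i \<omega>)) \<partial>N)"
  proof (rule insert.IH)
    fix a
    show "(CLINT \<omega>|M. complex_of_real (g \<omega> * indicator (A j) (X j \<omega>)) * iexp (\<Sum>i\<in>I. a i * X i \<omega>)) = (CLINT \<omega>|N. complex_of_real (h \<omega> * indicator (A j) (Y j \<omega>)) * iexp (\<Sum>i\<in>I. a i * Y i \<omega>))"
      unfolding V_def[symmetric] U_def[symmetric] sp
      using iM(2)[of a 0] iM(2)[of a "-(pi/2)"] iN(2)[of a 0] iN(2)[of a "-(pi/2)"]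
      by (simp only: Bochner_Integration.integral_add integrable_of_real integral_complex_of_real integrable_mult_right integral_mult_right_zero wc)
  qed (use insert iM(1) iN(1) in \<open>auto\<close>)
  thus ?case using j by (simp add: mult.assoc)
qed

text \<open>The factor \<open>1\<close> stands for the constant weight with which
  \<open>weighted_cramer_wold\<close> is applied.\<close>

lemma emeasure_joint_law_rect:
  fixes Z :: "'i \<Rightarrow> 'z \<Rightarrow> real"
  assumes K: "prob_space K" and I: "finite I" and Z: "\<And>i. i \<in> I \<Longrightarrow> Z i \<in> borel_measurable K" and A: "\<And>i. i \<in> I \<Longrightarrow> A i \<in> sets borel"
  shows "emeasure (distr K (Pi\<^sub>M I (\<lambda>_. borel)) (\<lambda>\<omega>. \<lambda>i\<in>I. Z i \<omega>)) (Pi\<^sub>E I A)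
    = ennreal (\<integral>\<omega>. 1 * (\<Prod>i\<in>I. indicator (A i) (Z i \<omega>)) \<partial>K)"
proof -
  interpret prob_space K by fact
  have m: "(\<lambda>\<omega>. \<lambda>i\<in>I. Z i \<omega>) \<in> measurable K (Pi\<^sub>M I (\<lambda>_. borel))"
    using Z by (auto intro!: measurable_restrict)
  have P: "Pi\<^sub>E I A \<in> sets (Pi\<^sub>M I (\<lambda>_. borel :: real measure))"
    using I A by (auto intro!: sets_PiM_I_finite)
  have ms: "(\<lambda>\<omega>. \<lambda>i\<in>I. Z i \<omega>) -` Pi\<^sub>E I A \<inter> space K \<in> sets K"
    using measurable_sets[OF m P] .
  have "emeasure (distr K (Pi\<^sub>M I (\<lambda>_. borel)) (\<lambda>\<omega>. \<lambda>i\<in>I. Z i \<omega>)) (Pi\<^sub>E I A)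
    = emeasure K ((\<lambda>\<omega>. \<lambda>i\<in>I. Z i \<omega>) -` Pi\<^sub>E I A \<inter> space K)"
    using m P by (rule emeasure_distr)
  also have "\<dots> = ennreal (\<integral>\<omega>. indicator ((\<lambda>\<omega>. \<lambda>i\<in>I. Z i \<omega>) -` Pi\<^sub>E I A \<inter> space K) \<omega> \<partial>K)"
    using ms by (simp add: emeasure_eq_measure)
  also have "(\<integral>\<omega>. indicator ((\<lambda>\<omega>. \<lambda>i\<in>I. Z i \<omega>) -` Pi\<^sub>E I A \<inter> space K) \<omega> \<partial>K)
    = (\<integral>\<omega>. 1 * (\<Prod>i\<in>I. indicator (A i) (Z i \<omega>)) \<partial>K :: real)"
  proof (intro Bochner_Integration.integral_cong refl)
    fix \<omega> assume "\<omega> \<in> space K"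
    then show "indicator ((\<lambda>\<omega>. \<lambda>i\<in>I. Z i \<omega>) -` Pi\<^sub>E I A \<inter> space K) \<omega> = (1 * (\<Prod>i\<in>I. indicator (A i) (Z i \<omega>)) :: real)"
      using I by (cases "\<forall>i\<in>I. Z i \<omega> \<in> A i") (auto simp: PiE_def Pi_def indicator_def intro!: prod.neutral prod_zero)
  qed
  finally show ?thesis .
qed

lemma cramer_wold:
  fixes X :: "'i \<Rightarrow> 'a \<Rightarrow> real" and Y :: "'i \<Rightarrow> 'b \<Rightarrow> real"
  assumes "prob_space M" "prob_space N" "finite I"
    and X: "\<And>i. i \<in> I \<Longrightarrow> X i \<in> borel_measurable M" and Y: "\<And>i. i \<in> I \<Longrightarrow> Y i \<in> borel_measurable N"
    and eq: "\<And>a. (CLINT \<omega>|M. iexp (\<Sum>i\<in>I. a i * X i \<omega>)) = (CLINT \<omega>|N. iexp (\<Sum>i\<in>I. a i * Y i \<omega>))"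
  shows "distr M (Pi\<^sub>M I (\<lambda>_. borel)) (\<lambda>\<omega>. \<lambda>i\<in>I. X i \<omega>) = distr N (Pi\<^sub>M I (\<lambda>_. borel)) (\<lambda>\<omega>. \<lambda>i\<in>I. Y i \<omega>)"
    (is "?P = ?Q")
proof -
  interpret M: prob_space M by fact
  interpret N: prob_space N by fact
  have rect: "emeasure ?P (Pi\<^sub>E I A) = emeasure ?Q (Pi\<^sub>E I A)" if A: "\<And>i. i \<in> I \<Longrightarrow> A i \<in> sets borel" for A
  proof -
    have "(\<integral>\<omega>. 1 * (\<Prod>i\<in>I. indicator (A i) (X i \<omega>)) \<partial>M) = (\<integral>\<omega>. 1 * (\<Prod>i\<in>I. indicator (A i) (Y i \<omega>)) \<partial>N :: real)"
      by (rule weighted_cramer_wold) (use assms A in auto)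
    thus ?thesis
      using assms A by (simp only: emeasure_joint_law_rect)
  qed
  have mX: "(\<lambda>\<omega>. \<lambda>i\<in>I. X i \<omega>) \<in> measurable M (Pi\<^sub>M I (\<lambda>_. borel))"
    using X by (auto intro!: measurable_restrict)
  show ?thesis
  proof (rule measure_eqI_PiM_finite[OF \<open>finite I\<close>])
    show "range (\<lambda>_::nat. Pi\<^sub>E I (\<lambda>_. UNIV)) \<subseteq> prod_algebra I (\<lambda>_. borel :: real measure)"
      using \<open>finite I\<close> by (auto intro!: prod_algebraI_finite)
    show "(\<Union>i::nat. Pi\<^sub>E I (\<lambda>_. UNIV)) = space (Pi\<^sub>M I (\<lambda>_. borel :: real measure))"
      by (simp add: space_PiM)
    show "emeasure ?P (Pi\<^sub>E I (\<lambda>_. UNIV)) \<noteq> \<infinity>"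
      using prob_space.prob_space_distr[OF \<open>prob_space M\<close> mX] finite_measure.emeasure_finite[OF prob_space.finite_measure] by (simp add: less_top)
  qed (use rect in auto)
qed

text \<open>The joint law lives on functions that are \<open>undefined\<close> outside
  \<open>I\<close>; \<open>cong\<close> allows \<open>K\<close> to be stated for the unrestricted
  families.\<close>

lemma cramer_wold_prob:
  fixes X :: "'i \<Rightarrow> 'a \<Rightarrow> real" and Y :: "'i \<Rightarrow> 'b \<Rightarrow> real"
  assumes "prob_space M" "prob_space N" "finite I"
    and X: "\<And>i. i \<in> I \<Longrightarrow> X i \<in> borel_measurable M" and Y: "\<And>i. i \<in> I \<Longrightarrow> Y i \<in> borel_measurable N"
    and eq: "\<And>a. (CLINT \<omega>|M. iexp (\<Sum>i\<in>I. a i * X i \<omega>)) = (CLINT \<omega>|N. iexp (\<Sum>i\<in>I. a i * Y i \<omega>))"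
    and K: "{x \<in> space (Pi\<^sub>M I (\<lambda>_. borel)). K x} \<in> sets (Pi\<^sub>M I (\<lambda>_. borel :: real measure))"
    and cong: "\<And>x y. (\<And>i. i \<in> I \<Longrightarrow> x i = y i) \<Longrightarrow> K x = K y"
  shows "measure M {\<omega> \<in> space M. K (\<lambda>i. X i \<omega>)} = measure N {\<omega> \<in> space N. K (\<lambda>i. Y i \<omega>)}"
proof -
  have mX: "(\<lambda>\<omega>. \<lambda>i\<in>I. X i \<omega>) \<in> measurable M (Pi\<^sub>M I (\<lambda>_. borel))"
    and mY: "(\<lambda>\<omega>. \<lambda>i\<in>I. Y i \<omega>) \<in> measurable N (Pi\<^sub>M I (\<lambda>_. borel))"
    using X Y by (auto intro!: measurable_restrict)
  let ?K = "{x \<in> space (Pi\<^sub>M I (\<lambda>_. borel)). K x}"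
  have K1: "K (\<lambda>i. X i \<omega>) = K (\<lambda>i\<in>I. X i \<omega>)" for \<omega> by (rule cong) simp
  have K2: "K (\<lambda>i. Y i \<omega>) = K (\<lambda>i\<in>I. Y i \<omega>)" for \<omega> by (rule cong) simp
  have "measure M {\<omega> \<in> space M. K (\<lambda>i. X i \<omega>)} = measure M ((\<lambda>\<omega>. \<lambda>i\<in>I. X i \<omega>) -` ?K \<inter> space M)"
    by (intro arg_cong[where f="measure M"]) (auto simp: space_PiM K1)
  also have "\<dots> = measure (distr M (Pi\<^sub>M I (\<lambda>_. borel)) (\<lambda>\<omega>. \<lambda>i\<in>I. X i \<omega>)) ?K"
    using mX K by (rule measure_distr[symmetric])
  also have "\<dots> = measure (distr N (Pi\<^sub>M I (\<lambda>_. borel)) (\<lambda>\<omega>. \<lambda>i\<in>I. Y i \<omega>)) ?K"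
    using cramer_wold[OF assms(1-3) X Y eq] by simp
  also have "\<dots> = measure N ((\<lambda>\<omega>. \<lambda>i\<in>I. Y i \<omega>) -` ?K \<inter> space N)"
    using mY K by (rule measure_distr)
  also have "\<dots> = measure N {\<omega> \<in> space N. K (\<lambda>i. Y i \<omega>)}"
    by (intro arg_cong[where f="measure N"]) (auto simp: space_PiM K2)
  finally show ?thesis .
qed

section \<open>The Prekopa--Leindler inequality and Gaussian measure\<close>

text \<open>A bounded set lies in the interval from its infimum to its supremum, whose length is the
  supremum of the distances of its points; an unbounded set makes the right side infinite. Lengths
  are thus reached through pairs of points, whether or not the end points belong to the set.\<close>

lemma emeasure_le_SUP_lengths:
  fixes A :: "real set"
  assumes "A \<noteq> {}"
  shows "emeasure lborel A \<le> (SUP (x, y)\<in>A \<times> A. ennreal (y - x))" (is "_ \<le> ?S")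
proof (cases "?S = \<infinity>")
  case False
  then obtain r where r: "?S = ennreal r" "r \<ge> 0" by (cases ?S) (auto simp: top_unique)
  have d: "y - x \<le> r" if "x \<in> A" "y \<in> A" for x y
  proof -
    have "ennreal (y - x) \<le> ?S" using that by (intro SUP_upper2[of "(x, y)"]) auto
    thus ?thesis using r by (simp add: ennreal_le_iff)
  qed
  obtain x0 where x0: "x0 \<in> A" using assms by blast
  have "bdd_below A" using d x0 by (intro bdd_belowI[of _ "x0 - r"]) (smt (verit))
  moreover have "bdd_above A" using d x0 by (intro bdd_aboveI[of _ "x0 + r"]) (smt (verit))
  ultimately have sub: "A \<subseteq> {Inf A..Sup A}" by (auto intro: cInf_lower cSup_upper)
  have "Sup A \<le> y + r" if "y \<in> A" for y
    using assms d that by (intro cSup_least) (auto, smt (verit))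
  hence "Sup A - r \<le> Inf A" using assms by (intro cInf_greatest) (auto, smt (verit))
  moreover have "Inf A \<le> Sup A" using sub x0 by fastforce
  ultimately have "emeasure lborel {Inf A..Sup A} \<le> ennreal r"
    by (simp add: ennreal_leI)
  moreover have "emeasure lborel A \<le> emeasure lborel {Inf A..Sup A}"
    using sub by (intro emeasure_mono) auto
  ultimately show ?thesis using r by simp
next
  case True
  show ?thesis unfolding True by simp
qed

text \<open>Moving along \<open>[a1, a]\<close> in \<open>A\<close> and \<open>[b1, b]\<close> in
  \<open>B\<close> with a common parameter sweeps a whole interval inside \<open>C\<close>, whose
  length is the weighted mean of the two lengths; suprema over the end points give the claim.
  \<open>C\<close> takes the place of the Minkowski combination of \<open>A\<close> and
  \<open>B\<close>.\<close>

lemma brunn_minkowski_interval: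
  fixes A B C :: "real set"
  assumes "A \<noteq> {}" "B \<noteq> {}" and conv: "convex A" "convex B" and C: "C \<in> sets lborel" and l: "0 < l" "l < 1"
    and sub: "\<And>x y. x \<in> A \<Longrightarrow> y \<in> B \<Longrightarrow> (1 - l) * x + l * y \<in> C"
  shows "ennreal (1 - l) * emeasure lborel A + ennreal l * emeasure lborel B \<le> emeasure lborel C"
proof -
  have bnd: "ennreal (1 - l) * ennreal (a2 - a1) + ennreal l * ennreal (b2 - b1) \<le> emeasure lborel C"
    if ab: "a1 \<in> A" "a2 \<in> A" "b1 \<in> B" "b2 \<in> B" for a1 a2 b1 b2
  proof -
    \<comment> \<open>For \<open>a2 < a1\<close> the truncated length
      \<open>ennreal (a2 - a1)\<close> is 0, and the maximum makes the segment degenerate to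
      match.\<close>
    define a where "a = max a1 a2" define b where "b = max b1 b2"
    have a: "a1 \<le> a" "a \<in> A" and b: "b1 \<le> b" "b \<in> B" using ab by (auto simp: a_def b_def max_def)
    define u where "u = (1 - l) * a1 + l * b1"
    define v where "v = (1 - l) * a + l * b"
    have uv: "v - u = (1 - l) * (a - a1) + l * (b - b1)" by (simp add: u_def v_def algebra_simps)
    have "0 \<le> v - u" unfolding uv using l a b by simp
    have "{u..v} \<subseteq> C"
    proof
      fix c assume c: "c \<in> {u..v}"
      show "c \<in> C"
      proof (cases "u = v")
        case True
        thus ?thesis using c sub[OF ab(1,3)] by (simp add: u_def)
      next
        case False
        with c have "u < v" by simp
        define s where "s = (c - u) / (v - u)"
        have s: "0 \<le> s" "s \<le> 1" "c = u + s * (v - u)" using c \<open>u < v\<close> by (auto simp: s_def)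
        have "(1 - s) *\<^sub>R a1 + s *\<^sub>R a \<in> A" "(1 - s) *\<^sub>R b1 + s *\<^sub>R b \<in> B"
          using s convexD[OF conv(1) ab(1) a(2), of "1 - s" s] convexD[OF conv(2) ab(3) b(2), of "1 - s" s] by auto
        from sub[OF this] have "(1 - l) * ((1 - s) * a1 + s * a) + l * ((1 - s) * b1 + s * b) \<in> C" by simp
        also have "(1 - l) * ((1 - s) * a1 + s * a) + l * ((1 - s) * b1 + s * b) = c"
          unfolding s(3) unfolding uv unfolding u_def by (simp add: algebra_simps)
        finally show ?thesis .
      qed
    qed
    have "ennreal (1 - l) * ennreal (a2 - a1) + ennreal l * ennreal (b2 - b1) \<le> ennreal (1 - l) * ennreal (a - a1) + ennreal l * ennreal (b - b1)"
      by (intro add_mono mult_left_mono ennreal_leI) (auto simp: a_def b_def)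
    also have "\<dots> = ennreal (v - u)"
      unfolding uv using l a b by (simp add: ennreal_mult ennreal_plus)
    also have "\<dots> = emeasure lborel {u..v}" using \<open>0 \<le> v - u\<close> by simp
    also have "\<dots> \<le> emeasure lborel C" using \<open>{u..v} \<subseteq> C\<close> C by (rule emeasure_mono)
    finally show ?thesis .
  qed
  have ne: "A \<times> A \<noteq> {}" "B \<times> B \<noteq> {}" using assms by auto
  have "ennreal (1 - l) * emeasure lborel A + ennreal l * emeasure lborel B \<le>
    ennreal (1 - l) * (SUP (x, y)\<in>A \<times> A. ennreal (y - x)) + ennreal l * (SUP (x, y)\<in>B \<times> B. ennreal (y - x))"
    using assms by (intro add_mono mult_left_mono emeasure_le_SUP_lengths) auto
  also have "\<dots> = (SUP p\<in>A \<times> A. ennreal (1 - l) * (case p of (x, y) \<Rightarrow> ennreal (y - x))) + (SUP p\<in>B \<times> B. ennreal l * (case p of (x, y) \<Rightarrow> ennreal (y - x)))"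
    by (simp add: SUP_mult_left_ennreal)
  also have "\<dots> = (SUP p\<in>A \<times> A. ennreal (1 - l) * (case p of (x, y) \<Rightarrow> ennreal (y - x)) + (SUP p\<in>B \<times> B. ennreal l * (case p of (x, y) \<Rightarrow> ennreal (y - x))))"
    using ne by (simp add: ennreal_SUP_add_left)
  also have "\<dots> = (SUP p\<in>A \<times> A. SUP q\<in>B \<times> B. ennreal (1 - l) * (case p of (x, y) \<Rightarrow> ennreal (y - x)) + ennreal l * (case q of (x, y) \<Rightarrow> ennreal (y - x)))"
    using ne by (simp add: ennreal_SUP_add_right)
  also have "\<dots> \<le> emeasure lborel C"
    using bnd by (intro SUP_least) auto
  finally show ?thesis .
qed

lemma nn_integral_layer_cake:
  fixes f :: "real \<Rightarrow> real"
  assumes [measurable]: "f \<in> borel_measurable borel"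
  shows "(\<integral>\<^sup>+x. ennreal (f x) \<partial>lborel) = (\<integral>\<^sup>+t. indicator {0..} t * emeasure lborel {x. t < f x} \<partial>lborel)"
proof -
  have "(\<integral>\<^sup>+x. ennreal (f x) \<partial>lborel) = (\<integral>\<^sup>+x. (\<integral>\<^sup>+t. indicator {0..} t * indicator {x. t < f x} x \<partial>lborel) \<partial>lborel)"
  proof (intro nn_integral_cong)
    fix x
    have "(\<integral>\<^sup>+t. indicator {0..} t * indicator {x. t < f x} x \<partial>lborel) = (\<integral>\<^sup>+t. indicator {0..<f x} t \<partial>lborel)"
      by (intro nn_integral_cong) (auto simp: indicator_def)
    also have "\<dots> = ennreal (f x)" by (cases "0 \<le> f x") (auto simp: ennreal_neg)
    finally show "ennreal (f x) = (\<integral>\<^sup>+t. indicator {0..} t * indicator {x. t < f x} x \<partial>lborel)" ..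
  qed
  also have "\<dots> = (\<integral>\<^sup>+t. (\<integral>\<^sup>+x. indicator {0..} t * indicator {x. t < f x} x \<partial>lborel) \<partial>lborel)"
    by (intro lborel_pair.Fubini') measurable
  also have "\<dots> = (\<integral>\<^sup>+t. indicator {0..} t * emeasure lborel {x. t < f x} \<partial>lborel)"
    by (intro nn_integral_cong) (simp add: nn_integral_cmult)
  finally show ?thesis .
qed

text \<open>Dividing \<open>f\<close> and \<open>g\<close> by their suprema makes both superlevel
  sets nonempty at all levels in [0, 1[ and empty beyond. Brunn-Minkowski at each level, integrated
  over the levels, gives the inequality with the arithmetic mean of the normalised integrals, which
  dominates the geometric one. Convex superlevel sets reduce everything to intervals.\<close>

lemma prekopa_leindler_quasiconcave:
  fixes f g h :: "real \<Rightarrow> real"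
  assumes [measurable]: "f \<in> borel_measurable borel" "g \<in> borel_measurable borel" "h \<in> borel_measurable borel"
    and int: "integrable lborel f" "integrable lborel g" "integrable lborel h"
    and nn: "\<And>x. 0 \<le> f x" "\<And>x. 0 \<le> g x" "\<And>x. 0 \<le> h x"
    and bd: "bdd_above (range f)" "bdd_above (range g)"
    and conv: "\<And>t. convex {x. t < f x}" "\<And>t. convex {x. t < g x}" and l: "0 < l" "l < 1"
    and le: "\<And>x y. f x powr (1 - l) * g y powr l \<le> h ((1 - l) * x + l * y)"
  shows "(\<integral>x. f x \<partial>lborel) powr (1 - l) * (\<integral>x. g x \<partial>lborel) powr l \<le> (\<integral>x. h x \<partial>lborel)"
proof (cases "(\<forall>x. f x = 0) \<or> (\<forall>x. g x = 0)")
  case True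
  then show ?thesis using nn by auto
next
  case False
  define a where "a = Sup (range f)"
  define b where "b = Sup (range g)"
  have fa: "f x \<le> a" and gb: "g x \<le> b" for x unfolding a_def b_def using bd by (auto intro!: cSup_upper)
  obtain x0 y0 where "f x0 \<noteq> 0" "g y0 \<noteq> 0" using False by blast
  hence "a > 0" "b > 0" using nn(1)[of x0] nn(2)[of y0] fa[of x0] gb[of y0] by linarith+
  \<comment> \<open>The scale of \<open>h\<close> that the pointwise hypothesis dictates: the levels
    \<open>a * t\<close> of \<open>f\<close> and \<open>b * t\<close> of \<open>g\<close> combine to
    the level \<open>c * t\<close> of \<open>h\<close>.\<close>
  define c where "c = a powr (1 - l) * b powr l"
  have "c > 0" using \<open>a > 0\<close> \<open>b > 0\<close> by (simp add: c_def)
  have ht: "ennreal (1 - l) * emeasure lborel {x. t < f x / a} + ennreal l * emeasure lborel {x. t < g x / b} \<le> emeasure lborel {x. t < h x / c}"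
    if t: "0 \<le> t" for t
  proof (cases "t < 1")
    case True
    have eqf: "{x. t < f x / a} = {x. a * t < f x}" and eqg: "{x. t < g x / b} = {x. b * t < g x}" and eqh: "{x. t < h x / c} = {x. c * t < h x}"
      using \<open>a > 0\<close> \<open>b > 0\<close> \<open>c > 0\<close> by (auto simp: field_simps)
    have "a * t < a" "b * t < b" using True \<open>a > 0\<close> \<open>b > 0\<close> by auto
    hence ne: "{x. a * t < f x} \<noteq> {}" "{x. b * t < g x} \<noteq> {}"
      using less_cSup_iff[of "range f" "a * t"] less_cSup_iff[of "range g" "b * t"] bd by (auto simp: a_def[symmetric] b_def[symmetric])
    show ?thesis unfolding eqf eqg eqh
    proof (rule brunn_minkowski_interval[OF ne conv])
      fix x y assume "x \<in> {x. a * t < f x}" "y \<in> {x. b * t < g x}"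
      hence xy: "a * t < f x" "b * t < g y" by auto
      have "0 \<le> a * t" "0 \<le> b * t" using t \<open>a > 0\<close> \<open>b > 0\<close> by auto
      hence "(a * t) powr (1 - l) * (b * t) powr l < f x powr (1 - l) * g y powr l"
        using xy l by (intro mult_strict_mono powr_less_mono2) auto
      also have "(a * t) powr (1 - l) * (b * t) powr l = c * (t powr (1 - l) * t powr l)"
        using t \<open>a > 0\<close> \<open>b > 0\<close> by (simp add: powr_mult c_def)
      also have "t powr (1 - l) * t powr l = t" using t by (simp add: powr_add[symmetric])
      finally show "(1 - l) * x + l * y \<in> {x. c * t < h x}" using le[of x y] by auto
    qed (use l in auto)
  next
    case False
    have e: "{x. t < f x / a} = {}" "{x. t < g x / b} = {}"
      using False fa gb \<open>a > 0\<close> \<open>b > 0\<close> by (auto simp: field_simps not_less intro: order_trans) 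
         (smt (verit) mult_le_cancel_left1)+
    show ?thesis unfolding e by simp
  qed
  have m[measurable]: "(\<lambda>t. emeasure lborel {x. t < k x}) \<in> borel_measurable lborel" if [measurable]: "k \<in> borel_measurable borel" for k :: "real \<Rightarrow> real"
  proof -
    have "(\<lambda>t. \<integral>\<^sup>+x. indicator {x. t < k x} x \<partial>lborel) \<in> borel_measurable lborel" by measurable
    moreover have "(\<integral>\<^sup>+x. indicator {x. t < k x} x \<partial>lborel) = emeasure lborel {x. t < k x}" for t by simp
    ultimately show ?thesis by simp
  qed
  define F where "F = (\<integral>x. f x \<partial>lborel) / a"
  define G where "G = (\<integral>x. g x \<partial>lborel) / b"
  define K where "K = (\<integral>x. h x \<partial>lborel) / c"
  have "F \<ge> 0" "G \<ge> 0" "K \<ge> 0" unfolding F_def G_def K_def using nn \<open>a > 0\<close> \<open>b > 0\<close> \<open>c > 0\<close> by auto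
  have F: "ennreal F = (\<integral>\<^sup>+x. ennreal (f x / a) \<partial>lborel)" and G: "ennreal G = (\<integral>\<^sup>+x. ennreal (g x / b) \<partial>lborel)"
    and K: "ennreal K = (\<integral>\<^sup>+x. ennreal (h x / c) \<partial>lborel)"
    unfolding F_def G_def K_def using int nn \<open>a > 0\<close> \<open>b > 0\<close> \<open>c > 0\<close> by (simp_all add: nn_integral_eq_integral)
  have "ennreal ((1 - l) * F + l * G) = ennreal (1 - l) * ennreal F + ennreal l * ennreal G"
    using l \<open>F \<ge> 0\<close> \<open>G \<ge> 0\<close> by (simp add: ennreal_mult ennreal_plus)
  also have "\<dots> = ennreal (1 - l) * (\<integral>\<^sup>+t. indicator {0..} t * emeasure lborel {x. t < f x / a} \<partial>lborel) + ennreal l * (\<integral>\<^sup>+t. indicator {0..} t * emeasure lborel {x. t < g x / b} \<partial>lborel)"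
    unfolding F G by (subst (1 2) nn_integral_layer_cake) auto
  also have "\<dots> = (\<integral>\<^sup>+t. ennreal (1 - l) * (indicator {0..} t * emeasure lborel {x. t < f x / a}) + ennreal l * (indicator {0..} t * emeasure lborel {x. t < g x / b}) \<partial>lborel)"
    by (simp add: nn_integral_add nn_integral_cmult)
  also have "\<dots> \<le> (\<integral>\<^sup>+t. indicator {0..} t * emeasure lborel {x. t < h x / c} \<partial>lborel)"
    by (intro nn_integral_mono) (auto simp: indicator_def intro: ht)
  also have "\<dots> = ennreal K" unfolding K using nn_integral_layer_cake[of "\<lambda>x. h x / c"] by simp
  finally have "(1 - l) * F + l * G \<le> K" using \<open>K \<ge> 0\<close> by (simp add: ennreal_le_iff)
  moreover have "F powr (1 - l) * G powr l \<le> (1 - l) * F + l * G"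
  proof (cases "F = 0 \<or> G = 0")
    case True
    thus ?thesis using l \<open>F \<ge> 0\<close> \<open>G \<ge> 0\<close> by auto
  next
    case False
    thus ?thesis using l \<open>F \<ge> 0\<close> \<open>G \<ge> 0\<close> by (intro Youngs_inequality_0) auto
  qed
  ultimately have "F powr (1 - l) * G powr l \<le> K" by linarith
  hence "c * (F powr (1 - l) * G powr l) \<le> c * K" using \<open>c > 0\<close> by simp
  moreover have "c * K = (\<integral>x. h x \<partial>lborel)" using \<open>c > 0\<close> by (simp add: K_def)
  moreover have "c * (F powr (1 - l) * G powr l) = (a * F) powr (1 - l) * (b * G) powr l"
    using \<open>a > 0\<close> \<open>b > 0\<close> \<open>F \<ge> 0\<close> \<open>G \<ge> 0\<close> by (simp add: c_def powr_mult)
  moreover have "a * F = (\<integral>x. f x \<partial>lborel)" "b * G = (\<integral>x. g x \<partial>lborel)"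
    using \<open>a > 0\<close> \<open>b > 0\<close> by (auto simp: F_def G_def)
  ultimately show ?thesis by simp
qed


section \<open>Log-concavity under products of the standard normal law\<close>

abbreviation std_normal :: "real measure" where
  "std_normal \<equiv> density lborel (\<lambda>x. ennreal (std_normal_density x))"

lemma std_normal_density_log_concave:
  assumes "0 < l" "l < 1"
  shows "std_normal_density x powr (1 - l) * std_normal_density y powr l \<le> std_normal_density ((1 - l) * x + l * y)"
proof -
  have e: "std_normal_density x powr a = (1 / sqrt (2 * pi)) powr a * exp (- (a * (x\<^sup>2 / 2)))" for x a
    by (simp add: std_normal_density_def powr_mult exp_powr_real powr_divide algebra_simps)
  have "((1 - l) * x + l * y)\<^sup>2 = (1 - l) * x\<^sup>2 + l * y\<^sup>2 - l * (1 - l) * (x - y)\<^sup>2"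
    by (simp add: power2_eq_square algebra_simps)
  also have "\<dots> \<le> (1 - l) * x\<^sup>2 + l * y\<^sup>2" using assms by simp
  finally have q: "((1 - l) * x + l * y)\<^sup>2 \<le> (1 - l) * x\<^sup>2 + l * y\<^sup>2" .
  have "std_normal_density x powr (1 - l) * std_normal_density y powr l = 
     ((1 / sqrt (2 * pi)) powr (1 - l) * (1 / sqrt (2 * pi)) powr l) * exp (- ((1 - l) * (x\<^sup>2 / 2)) - l * (y\<^sup>2 / 2))"
    unfolding e diff_conv_add_uminus[of "- ((1 - l) * (x\<^sup>2 / 2))"] exp_add by (simp only: ac_simps)
  also have "(1 / sqrt (2 * pi)) powr (1 - l) * (1 / sqrt (2 * pi)) powr l = 1 / sqrt (2 * pi)"
    by (simp add: powr_add[symmetric])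
  also have "(1 / sqrt (2 * pi)) * exp (- ((1 - l) * (x\<^sup>2 / 2)) - l * (y\<^sup>2 / 2)) \<le> (1 / sqrt (2 * pi)) * exp (- ((1 - l) * x + l * y)\<^sup>2 / 2)"
    using q by (intro mult_left_mono) auto
  also have "\<dots> = std_normal_density ((1 - l) * x + l * y)" by (simp add: std_normal_density_def)
  finally show ?thesis .
qed

text \<open>The level \<open>z\<close> enters the convex combination together with the point
  \<open>x\<close>, so that integrating out coordinates of \<open>x\<close> leaves log-concavity in
  \<open>z\<close>. Zeros impose nothing on a nonnegative \<open>f\<close>, since
  \<open>0 powr a = 0\<close>.\<close>

definition jointly_log_concave :: "(real \<Rightarrow> ('i \<Rightarrow> real) \<Rightarrow> real) \<Rightarrow> bool" where
  "jointly_log_concave f \<longleftrightarrow> (\<forall>z w x y l. 0 < l \<longrightarrow> l < 1 \<longrightarrow>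
     f z x powr (1 - l) * f w y powr l \<le> f ((1 - l) * z + l * w) (\<lambda>i. (1 - l) * x i + l * y i))"

lemma jointly_log_concaveD:
  "jointly_log_concave f \<Longrightarrow> 0 < l \<Longrightarrow> l < 1 \<Longrightarrow>
     f z x powr (1 - l) * f w y powr l \<le> f ((1 - l) * z + l * w) (\<lambda>i. (1 - l) * x i + l * y i)"
  by (auto simp: jointly_log_concave_def)

lemma prob_space_std_normal: "prob_space std_normal"
  using prob_space_normal_density[of 1 0] by simp

text \<open>Prekopa-Leindler in the single variable \<open>t\<close>, for the product of
  \<open>f\<close> with the normal density. The convexity of superlevel sets that it asks for is
  log-concavity in \<open>t\<close> alone, that is, the case of equal levels and equal
  points.\<close>

lemma jointly_log_concave_marginal:
  fixes f :: "real \<Rightarrow> ('i \<Rightarrow> real) \<Rightarrow> real"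
  assumes f: "jointly_log_concave f" and b: "\<And>z x. 0 \<le> f z x" "\<And>z x. f z x \<le> 1"
    and m: "\<And>z x. (\<lambda>t. f z (x(j := t))) \<in> borel_measurable borel"
  shows "jointly_log_concave (\<lambda>z x. \<integral>t. f z (x(j := t)) \<partial>std_normal)"
  unfolding jointly_log_concave_def
proof (intro allI impI)
  fix z w :: real and x y :: "'i \<Rightarrow> real" and l :: real
  assume l: "0 < l" "l < 1"
  interpret S: prob_space std_normal by (rule prob_space_std_normal)
  define F where "F z x t = std_normal_density t * f z (x(j := t))" for z x t
  have fm[measurable]: "(\<lambda>t. f z (x(j := t))) \<in> borel_measurable borel" for z x by (rule m)
  have I: "(\<integral>t. f z (x(j := t)) \<partial>std_normal) = (\<integral>t. F z x t \<partial>lborel)" for z x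
    unfolding F_def by (subst integral_density) auto
  have int: "integrable lborel (F z x)" for z x
  proof -
    have "integrable std_normal (\<lambda>t. f z (x(j := t)))"
      using b by (intro S.integrable_const_bound[of _ 1]) auto
    thus ?thesis unfolding F_def by (subst (asm) integrable_density) auto
  qed
  have nn: "0 \<le> F z x t" for z x t unfolding F_def using b by auto
  have lc: "F z x t powr (1 - l) * F w y s powr l \<le> F ((1 - l) * z + l * w) (\<lambda>i. (1 - l) * x i + l * y i) ((1 - l) * t + l * s)"
    if l: "0 < l" "l < 1" for z w x y t s l
  proof -
    have u: "(\<lambda>i. (1 - l) * x i + l * y i)(j := (1 - l) * t + l * s) = (\<lambda>i. (1 - l) * (x(j := t)) i + l * (y(j := s)) i)"
      by auto
    have "F z x t powr (1 - l) * F w y s powr l = (std_normal_density t powr (1 - l) * std_normal_density s powr l) * (f z (x(j := t)) powr (1 - l) * f w (y(j := s)) powr l)"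
      unfolding F_def using b by (simp add: powr_mult)
    also have "\<dots> \<le> std_normal_density ((1 - l) * t + l * s) * f ((1 - l) * z + l * w) (\<lambda>i. (1 - l) * (x(j := t)) i + l * (y(j := s)) i)"
      using l b by (intro mult_mono std_normal_density_log_concave jointly_log_concaveD[OF f]) auto
    finally show ?thesis unfolding F_def u .
  qed
  have conv: "convex {t. r < F z x t}" for r z x
  proof (rule convexI)
    fix s t :: real and u v :: real
    assume st: "s \<in> {t. r < F z x t}" "t \<in> {t. r < F z x t}" and uv: "0 \<le> u" "0 \<le> v" "u + v = 1"
    show "u *\<^sub>R s + v *\<^sub>R t \<in> {t. r < F z x t}"
    proof (cases "u = 0 \<or> v = 0")
      case True thus ?thesis using st uv by auto
    next
      case False
      hence v: "0 < v" "v < 1" and u: "u = 1 - v" using uv by auto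
      define q where "q = min (F z x s) (F z x t)"
      have "r < q" "0 \<le> q" using st nn by (auto simp: q_def)
      note \<open>r < q\<close>
      also have "q = q powr (1 - v) * q powr v" using \<open>0 \<le> q\<close> by (simp add: powr_add[symmetric])
      also have "\<dots> \<le> F z x s powr (1 - v) * F z x t powr v"
        using v \<open>0 \<le> q\<close> by (intro mult_mono powr_mono2) (auto simp: q_def)
      also have "\<dots> \<le> F ((1 - v) * z + v * z) (\<lambda>i. (1 - v) * x i + v * x i) ((1 - v) * s + v * t)"
        by (rule lc[OF v])
      also have "\<dots> = F z x (u *\<^sub>R s + v *\<^sub>R t)" unfolding u by (simp add: algebra_simps)
      finally show ?thesis by simp
    qed
  qed
  have bd: "bdd_above (range (F z x))" for z x
  proof (rule bdd_aboveI2)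
    fix t
    have "std_normal_density t \<le> 1 / sqrt (2 * pi)" by (simp add: std_normal_density_def divide_right_mono)
    moreover have "F z x t \<le> std_normal_density t * 1" unfolding F_def using b by (intro mult_left_mono) auto
    ultimately show "F z x t \<le> 1 / sqrt (2 * pi)" by simp
  qed
  have Fm: "F z x \<in> borel_measurable borel" for z x unfolding F_def by measurable
  show "(\<integral>t. f z (x(j := t)) \<partial>std_normal) powr (1 - l) * (\<integral>t. f w (y(j := t)) \<partial>std_normal) powr l
    \<le> (\<integral>t. f ((1 - l) * z + l * w) ((\<lambda>i. (1 - l) * x i + l * y i)(j := t)) \<partial>std_normal)"
    unfolding I by (rule prekopa_leindler_quasiconcave) (use Fm int nn bd conv l lc in auto)
qed

text \<open>One coordinate is integrated out at a time, and
  \<open>jointly_log_concave_marginal\<close> preserves the hypothesis for the rest. That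
  \<open>f\<close> depends only on the coordinates in \<open>I\<close> makes its values at arbitrary
  functions agree with those on the product space, where measurability is known.\<close>

lemma jointly_log_concave_expectation:
  fixes f :: "real \<Rightarrow> ('i \<Rightarrow> real) \<Rightarrow> real"
  assumes "finite I"
  assumes "jointly_log_concave f" and "\<And>z x. 0 \<le> f z x" "\<And>z x. f z x \<le> 1"
    and "\<And>z. f z \<in> borel_measurable (Pi\<^sub>M I (\<lambda>_. borel))" and "\<And>z x y. (\<And>i. i \<in> I \<Longrightarrow> x i = y i) \<Longrightarrow> f z x = f z y"
    and l: "0 < l" "l < 1"
  shows "(\<integral>x. f z x \<partial>Pi\<^sub>M I (\<lambda>_. std_normal)) powr (1 - l) * (\<integral>x. f w x \<partial>Pi\<^sub>M I (\<lambda>_. std_normal)) powr l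
    \<le> (\<integral>x. f ((1 - l) * z + l * w) x \<partial>Pi\<^sub>M I (\<lambda>_. std_normal))"
  using assms(1-6)
proof (induction I arbitrary: f rule: finite_induct)
  case empty
  interpret P: prob_space "Pi\<^sub>M {} (\<lambda>_::'i. std_normal)" by (intro prob_space_PiM prob_space_std_normal)
  have "(\<integral>x. f z x \<partial>Pi\<^sub>M {} (\<lambda>_. std_normal)) = (\<integral>x. f z (\<lambda>_. undefined) \<partial>Pi\<^sub>M {} (\<lambda>_::'i. std_normal))" for z
    by (intro Bochner_Integration.integral_cong) (auto simp: space_PiM_empty)
  hence "(\<integral>x. f z x \<partial>Pi\<^sub>M {} (\<lambda>_. std_normal)) = f z (\<lambda>_. undefined)" for z
    using P.prob_space by simp
  moreover have "(1 - l) * u + l * u = u" for u :: real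
    by (simp add: algebra_simps)
  ultimately show ?case using jointly_log_concaveD[OF empty(1) l, of z "\<lambda>_. undefined" w "\<lambda>_. undefined"] by simp
next
  case (insert j I)
  interpret S: prob_space std_normal by (rule prob_space_std_normal)
  interpret P: product_sigma_finite "\<lambda>_::'i. std_normal"
    by (intro product_sigma_finite.intro prob_space_imp_sigma_finite prob_space_std_normal)
  interpret PI: prob_space "Pi\<^sub>M (insert j I) (\<lambda>_. std_normal)"
    by (intro prob_space_PiM prob_space_std_normal)
  define g where "g z x = (\<integral>t. f z (x(j := t)) \<partial>std_normal)" for z x
  have sets_eq: "sets (Pi\<^sub>M K (\<lambda>_. std_normal)) = sets (Pi\<^sub>M K (\<lambda>_. borel))" for K :: "'i set"
    by (intro sets_PiM_cong) auto
  have fm: "f z \<in> borel_measurable (Pi\<^sub>M (insert j I) (\<lambda>_. std_normal))" for z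
    using insert.prems(4)[of z] by (simp add: measurable_cong_sets[OF sets_eq refl])
  have int: "integrable (Pi\<^sub>M (insert j I) (\<lambda>_. std_normal)) (f z)" for z
    using fm insert.prems(2,3) by (intro PI.integrable_const_bound[of _ 1]) auto
  have E: "(\<integral>x. f z x \<partial>Pi\<^sub>M (insert j I) (\<lambda>_. std_normal)) = (\<integral>x. g z x \<partial>Pi\<^sub>M I (\<lambda>_. std_normal))" for z
    unfolding g_def using P.product_integral_insert[OF insert(1,2) int[of z]] by simp
  have upd: "(\<lambda>(x, t). f z (x(j := t))) \<in> borel_measurable (Pi\<^sub>M I (\<lambda>_. borel) \<Otimes>\<^sub>M borel)" for z
    using measurable_compose[OF measurable_add_dim[of j I "\<lambda>_. borel"] insert.prems(4)[of z]] by (simp add: case_prod_unfold fun_upd_def)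
  have upd1: "(\<lambda>t. f z (x(j := t))) \<in> borel_measurable borel" for z x
  proof -
    have "restrict x I \<in> space (Pi\<^sub>M I (\<lambda>_. borel))" by (simp add: space_PiM)
    from measurable_Pair2[OF upd this] have "(\<lambda>t. f z ((restrict x I)(j := t))) \<in> borel_measurable borel" by simp
    also have "(\<lambda>t. f z ((restrict x I)(j := t))) = (\<lambda>t. f z (x(j := t)))"
      by (intro ext insert.prems(5)) auto
    finally show ?thesis .
  qed
  have int1: "integrable std_normal (\<lambda>t. f z (x(j := t)))" for z x
    using upd1 insert.prems(2,3) by (intro S.integrable_const_bound[of _ 1]) auto
  show ?case unfolding E
  proof (rule insert.IH)
    show "jointly_log_concave g"
      unfolding g_def by (rule jointly_log_concave_marginal[OF insert.prems(1-3) upd1])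
    show "0 \<le> g z x" for z x unfolding g_def using insert.prems(2) by simp
    show "g z x \<le> 1" for z x
      unfolding g_def using insert.prems(3) int1 by (intro S.integral_le_const) auto
    have "(\<lambda>(x, t). f z (x(j := t))) \<in> borel_measurable (Pi\<^sub>M I (\<lambda>_. borel) \<Otimes>\<^sub>M std_normal)" for z
      using upd[of z] by (subst measurable_cong_sets[OF sets_pair_measure_cong refl]) auto
    thus "g z \<in> borel_measurable (Pi\<^sub>M I (\<lambda>_. borel))" for z
      unfolding g_def by (intro S.borel_measurable_lebesgue_integral) auto
    show "g z x = g z y" if "\<And>i. i \<in> I \<Longrightarrow> x i = y i" for z x y
    proof -
      have "(\<lambda>t. f z (x(j := t))) = (\<lambda>t. f z (y(j := t)))"
        using that by (intro ext insert.prems(5)) auto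
      thus ?thesis by (simp add: g_def)
    qed
  qed
qed

section \<open>Gaussian Hilbert spaces\<close>

text \<open>For \<open>t > x \<ge> 0\<close> one has
  \<open>t\<^sup>2 \<ge> x\<^sup>2 + (t - x)\<^sup>2\<close>, so the density is at most
  \<open>exp (- x\<^sup>2 / 2)\<close> times its translate by \<open>x\<close>.\<close>

lemma normal_density_tail_le:
  assumes "0 \<le> x" shows "measure std_normal {x<..} \<le> exp (- x\<^sup>2 / 2)"
proof -
  interpret S: prob_space std_normal by (rule prob_space_std_normal)
  have "emeasure std_normal {x<..} = (\<integral>\<^sup>+t. ennreal (std_normal_density t) * indicator {x<..} t \<partial>lborel)"
    by (subst emeasure_density) auto
  also have "\<dots> \<le> (\<integral>\<^sup>+t. ennreal (exp (- x\<^sup>2 / 2)) * ennreal (std_normal_density (t - x)) \<partial>lborel)"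
  proof (intro nn_integral_mono)
    fix t
    show "ennreal (std_normal_density t) * indicator {x<..} t \<le> ennreal (exp (- x\<^sup>2 / 2)) * ennreal (std_normal_density (t - x))"
    proof (cases "x < t")
      case True
      have "t\<^sup>2 = x\<^sup>2 + (t - x)\<^sup>2 + 2 * x * (t - x)" by (simp add: power2_eq_square algebra_simps)
      moreover have "0 \<le> x * (t - x)" using True assms by simp
      ultimately have "- t\<^sup>2 / 2 \<le> - x\<^sup>2 / 2 + - (t - x)\<^sup>2 / 2" by simp
      hence "exp (- t\<^sup>2 / 2) \<le> exp (- x\<^sup>2 / 2) * exp (- (t - x)\<^sup>2 / 2)"
        unfolding exp_add[symmetric] by simp
      hence "1 / sqrt (2 * pi) * exp (- t\<^sup>2 / 2) \<le> 1 / sqrt (2 * pi) * (exp (- x\<^sup>2 / 2) * exp (- (t - x)\<^sup>2 / 2))"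
        by (intro mult_left_mono) auto
      hence "std_normal_density t \<le> exp (- x\<^sup>2 / 2) * std_normal_density (t - x)"
        unfolding std_normal_density_def by (simp only: ac_simps)
      thus ?thesis using True by (simp add: ennreal_mult[symmetric] ennreal_leI)
    qed simp
  qed
  also have "\<dots> = ennreal (exp (- x\<^sup>2 / 2)) * (\<integral>\<^sup>+t. ennreal (std_normal_density (t - x)) \<partial>lborel)"
    by (rule nn_integral_cmult) measurable
  also have "(\<integral>\<^sup>+t. ennreal (std_normal_density (t - x)) \<partial>lborel) = (\<integral>\<^sup>+t. ennreal (std_normal_density t) \<partial>lborel)"
    by (subst nn_integral_real_affine[where c=1 and t=x]) (auto simp: one_ennreal_def[symmetric])
  also have "\<dots> = 1"
    using nn_integral_eq_integral[OF integrable_normal_density[of 1 0]] by simp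
  finally show ?thesis by (simp add: S.emeasure_eq_measure ennreal_le_iff)
qed

text \<open>The mass of the unit interval below \<open>- m\<close> suffices, where
  \<open>t\<^sup>2 \<le> (m + 1)\<^sup>2 \<le> 2 * m\<^sup>2 + 2\<close>. The factor lost in the
  exponent affects constants only.\<close>

lemma normal_density_tail_ge:
  assumes "0 \<le> m" shows "exp (- m\<^sup>2 - 1) / sqrt (2 * pi) \<le> measure std_normal {..- m}"
proof -
  interpret S: prob_space std_normal by (rule prob_space_std_normal)
  have "ennreal (exp (- m\<^sup>2 - 1) / sqrt (2 * pi)) = (\<integral>\<^sup>+t. ennreal (exp (- m\<^sup>2 - 1) / sqrt (2 * pi)) * indicator {-m-1..-m} t \<partial>lborel)"
    by (subst nn_integral_cmult) auto
  also have "\<dots> \<le> (\<integral>\<^sup>+t. ennreal (std_normal_density t) * indicator {..-m} t \<partial>lborel)"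
  proof (intro nn_integral_mono)
    fix t
    show "ennreal (exp (- m\<^sup>2 - 1) / sqrt (2 * pi)) * indicator {-m-1..-m} t \<le> ennreal (std_normal_density t) * indicator {..-m} t"
    proof (cases "t \<in> {-m-1..-m}")
      case True
      hence "\<bar>t\<bar> \<le> m + 1" using assms by auto
      hence "t\<^sup>2 \<le> (m + 1)\<^sup>2" using assms by (simp add: abs_le_square_iff[symmetric])
      also have "\<dots> \<le> 2 * m\<^sup>2 + 2" using zero_le_power2[of "m - 1"] by (simp add: power2_eq_square algebra_simps)
      finally have "exp (- m\<^sup>2 - 1) \<le> exp (- t\<^sup>2 / 2)" by simp
      hence "exp (- m\<^sup>2 - 1) / sqrt (2 * pi) \<le> exp (- t\<^sup>2 / 2) / sqrt (2 * pi)" by (intro divide_right_mono) auto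
      thus ?thesis using True by (simp add: std_normal_density_def ennreal_leI)
    qed simp
  qed
  also have "\<dots> = emeasure std_normal {..-m}" by (subst emeasure_density) auto
  finally show ?thesis by (simp add: S.emeasure_eq_measure ennreal_le_iff)
qed

text \<open>A linear space of centred, possibly degenerate Gaussian variables:
  \<open>char_mem\<close> applied to multiples gives each characteristic function, and applied to
  linear combinations it makes finite families jointly Gaussian. Members are functions and not
  classes, hence the equalities below that hold only almost surely.\<close>

locale gaussian_space = prob_space M for M :: "'w measure" +
  fixes H :: "('w \<Rightarrow> real) set"
  assumes zero_mem: "(\<lambda>_. 0) \<in> H"
    and measurable_mem: "\<And>X. X \<in> H \<Longrightarrow> X \<in> borel_measurable M"
    and square_integrable: "\<And>X. X \<in> H \<Longrightarrow> integrable M (\<lambda>\<omega>. (X \<omega>)\<^sup>2)"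
    and add_mem: "\<And>X Y. X \<in> H \<Longrightarrow> Y \<in> H \<Longrightarrow> (\<lambda>\<omega>. X \<omega> + Y \<omega>) \<in> H"
    and scale_mem: "\<And>X c. X \<in> H \<Longrightarrow> (\<lambda>\<omega>. c * X \<omega>) \<in> H"
    and char_mem: "\<And>X. X \<in> H \<Longrightarrow> (CLINT \<omega>|M. iexp (X \<omega>)) = complex_of_real (exp (- (\<integral>\<omega>. (X \<omega>)\<^sup>2 \<partial>M) / 2))"
begin

definition ip :: "('w \<Rightarrow> real) \<Rightarrow> ('w \<Rightarrow> real) \<Rightarrow> real" where
  "ip X Y = (\<integral>\<omega>. X \<omega> * Y \<omega> \<partial>M)"

abbreviation incr_var :: "('w \<Rightarrow> real) \<Rightarrow> ('w \<Rightarrow> real) \<Rightarrow> real" where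
  "incr_var X Y \<equiv> ip (\<lambda>\<omega>. X \<omega> - Y \<omega>) (\<lambda>\<omega>. X \<omega> - Y \<omega>)"

lemma ip_commute: "ip X Y = ip Y X" by (simp add: ip_def mult.commute)

lemma ip_self: "ip X X = (\<integral>\<omega>. (X \<omega>)\<^sup>2 \<partial>M)" by (simp add: ip_def power2_eq_square)

lemma ip_self_nonneg: "0 \<le> ip X X" by (simp add: ip_self)

lemma integrable_prod: "X \<in> H \<Longrightarrow> Y \<in> H \<Longrightarrow> integrable M (\<lambda>\<omega>. X \<omega> * Y \<omega>)"
  by (intro integrable_mult_of_squares measurable_mem square_integrable)

lemma diff_mem: "X \<in> H \<Longrightarrow> Y \<in> H \<Longrightarrow> (\<lambda>\<omega>. X \<omega> - Y \<omega>) \<in> H"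
  using add_mem[of X "\<lambda>\<omega>. (-1) * Y \<omega>"] scale_mem[of Y "-1"] by simp

lemma sum_mem: "finite S \<Longrightarrow> (\<And>i. i \<in> S \<Longrightarrow> X i \<in> H) \<Longrightarrow> (\<lambda>\<omega>. \<Sum>i\<in>S. X i \<omega>) \<in> H"
  by (induction S rule: finite_induct) (auto intro: zero_mem add_mem)

lemma lincomb_mem: "finite S \<Longrightarrow> (\<And>i. i \<in> S \<Longrightarrow> X i \<in> H) \<Longrightarrow> (\<lambda>\<omega>. \<Sum>i\<in>S. c i * X i \<omega>) \<in> H"
  by (intro sum_mem scale_mem) auto

lemma ip_add: "X \<in> H \<Longrightarrow> Y \<in> H \<Longrightarrow> Z \<in> H \<Longrightarrow> ip (\<lambda>\<omega>. X \<omega> + Y \<omega>) Z = ip X Z + ip Y Z"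
  unfolding ip_def distrib_right by (intro Bochner_Integration.integral_add integrable_prod)

lemma ip_diff: "X \<in> H \<Longrightarrow> Y \<in> H \<Longrightarrow> Z \<in> H \<Longrightarrow> ip (\<lambda>\<omega>. X \<omega> - Y \<omega>) Z = ip X Z - ip Y Z"
  unfolding ip_def left_diff_distrib by (intro Bochner_Integration.integral_diff integrable_prod)

lemma ip_scale: "ip (\<lambda>\<omega>. c * X \<omega>) Z = c * ip X Z"
  unfolding ip_def mult.assoc by simp

lemma ip_zero: "ip (\<lambda>_. 0) Z = 0" by (simp add: ip_def)

lemma ip_sum: "finite S \<Longrightarrow> (\<And>i. i \<in> S \<Longrightarrow> X i \<in> H) \<Longrightarrow> Z \<in> H \<Longrightarrow> ip (\<lambda>\<omega>. \<Sum>i\<in>S. X i \<omega>) Z = (\<Sum>i\<in>S. ip (X i) Z)"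
  by (induction S rule: finite_induct) (auto simp: ip_zero ip_add sum_mem)

lemma ip_lincomb: "finite S \<Longrightarrow> (\<And>i. i \<in> S \<Longrightarrow> X i \<in> H) \<Longrightarrow> Z \<in> H \<Longrightarrow> ip (\<lambda>\<omega>. \<Sum>i\<in>S. c i * X i \<omega>) Z = (\<Sum>i\<in>S. c i * ip (X i) Z)"
  by (subst ip_sum) (auto simp: ip_scale intro: scale_mem)

lemma ip_diff2: "X \<in> H \<Longrightarrow> Y \<in> H \<Longrightarrow> Z \<in> H \<Longrightarrow> ip Z (\<lambda>\<omega>. X \<omega> - Y \<omega>) = ip Z X - ip Z Y"
  using ip_diff[of X Y Z] by (simp add: ip_commute)

lemma ip_add2: "X \<in> H \<Longrightarrow> Y \<in> H \<Longrightarrow> Z \<in> H \<Longrightarrow> ip Z (\<lambda>\<omega>. X \<omega> + Y \<omega>) = ip Z X + ip Z Y"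
  using ip_add[of X Y Z] by (simp add: ip_commute)

lemma ip_scale2: "ip Z (\<lambda>\<omega>. c * X \<omega>) = c * ip Z X"
  using ip_scale[of c X Z] by (simp add: ip_commute)

lemma char_ip: "X \<in> H \<Longrightarrow> (CLINT \<omega>|M. iexp (X \<omega>)) = complex_of_real (exp (- ip X X / 2))"
  by (simp add: char_mem ip_self)

lemma AE_zero: assumes "X \<in> H" "ip X X = 0" shows "AE \<omega> in M. X \<omega> = 0"
  using assms integral_nonneg_eq_0_iff_AE[OF square_integrable[OF assms(1)]] by (simp add: ip_self)

lemma Cauchy_Schwarz: assumes [simp]: "X \<in> H" "Y \<in> H" shows "(ip X Y)\<^sup>2 \<le> ip X X * ip Y Y"
proof (cases "ip Y Y = 0")
  case True
  have "AE \<omega> in M. X \<omega> * Y \<omega> = 0" using AE_zero[OF assms(2) True] by auto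
  hence "ip X Y = 0" unfolding ip_def by (rule integral_eq_zero_AE)
  thus ?thesis using True by simp
next
  case False
  hence p: "ip Y Y > 0" using ip_self_nonneg[of Y] by simp
  define c where "c = ip X Y / ip Y Y"
  define Z where "Z = (\<lambda>\<omega>. X \<omega> - c * Y \<omega>)"
  have [simp]: "Z \<in> H" "(\<lambda>\<omega>. c * Y \<omega>) \<in> H"
    unfolding Z_def using diff_mem[OF assms(1) scale_mem[OF assms(2)]] scale_mem[OF assms(2)] by blast+
  have "ip Z Y = ip X Y - c * ip Y Y" unfolding Z_def by (simp add: ip_diff ip_scale)
  hence "ip Z Y = 0" using p by (simp add: c_def)
  hence "ip Z Z = ip Z X" unfolding Z_def by (subst ip_diff2) (auto simp: ip_scale2 Z_def[symmetric])
  also have "\<dots> = ip X X - c * ip X Y" unfolding Z_def by (simp add: ip_diff ip_scale ip_commute[of Y X])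
  finally have "0 \<le> ip X X - ip X Y / ip Y Y * ip X Y" using ip_self_nonneg[of Z] by (simp add: c_def)
  thus ?thesis using p by (simp add: field_simps power2_eq_square)
qed

lemma distr_std_normal:
  assumes "X \<in> H" "ip X X = 1" shows "distr M borel X = std_normal"
proof (rule Levy_uniqueness)
  have [measurable]: "X \<in> borel_measurable M" using assms measurable_mem by simp
  show "real_distribution (distr M borel X)" by (intro real_distribution_distr) simp
  show "real_distribution std_normal" by (rule real_dist_normal_dist)
  show "char (distr M borel X) = char std_normal"
  proof
    fix t
    have "char (distr M borel X) t = (CLINT \<omega>|M. iexp (t * X \<omega>))"
      unfolding char_def by (subst integral_distr) auto
    also have "\<dots> = exp (- (t\<^sup>2) / 2)"
      using char_ip[OF scale_mem[OF assms(1), of t]] assms by (simp add: ip_scale ip_scale2 power2_eq_square)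
    finally show "char (distr M borel X) t = char std_normal t" by (simp add: char_std_normal_distribution)
  qed
qed

lemma prob_std_normal:
  assumes "X \<in> H" "ip X X = 1" "A \<in> sets borel"
  shows "prob {\<omega> \<in> space M. X \<omega> \<in> A} = measure std_normal A"
proof -
  have "measure (distr M borel X) A = prob (X -` A \<inter> space M)"
    using assms measurable_mem by (intro measure_distr) auto
  also have "X -` A \<inter> space M = {\<omega> \<in> space M. X \<omega> \<in> A}" by auto
  finally show ?thesis using distr_std_normal[OF assms(1,2)] by simp
qed

lemma normalize_mem:
  assumes "X \<in> H" "ip X X > 0"
  shows "(\<lambda>\<omega>. (1 / sqrt (ip X X)) * X \<omega>) \<in> H" "ip (\<lambda>\<omega>. (1 / sqrt (ip X X)) * X \<omega>) (\<lambda>\<omega>. (1 / sqrt (ip X X)) * X \<omega>) = 1"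
proof -
  have "1 / sqrt (ip X X) * (1 / sqrt (ip X X) * ip X X) = 1"
    using assms(2) by (simp add: field_simps power2_eq_square[symmetric])
  thus "ip (\<lambda>\<omega>. (1 / sqrt (ip X X)) * X \<omega>) (\<lambda>\<omega>. (1 / sqrt (ip X X)) * X \<omega>) = 1"
    unfolding ip_scale ip_scale2 .
qed (rule scale_mem[OF assms(1)])

lemma prob_gt_le:
  assumes "X \<in> H" "ip X X \<le> v" "0 < v" "0 \<le> x"
  shows "prob {\<omega> \<in> space M. X \<omega> > x} \<le> exp (- x\<^sup>2 / (2 * v))"
proof (cases "ip X X = 0")
  case True
  have "AE \<omega> in M. \<not> X \<omega> > x" using AE_zero[OF assms(1) True] assms(4) by auto
  hence "prob {\<omega> \<in> space M. X \<omega> > x} = 0" 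
    using measurable_mem[OF assms(1)] by (subst prob_eq_0) auto
  thus ?thesis by simp
next
  case False
  hence p: "ip X X > 0" using ip_self_nonneg[of X] by simp
  define s where "s = sqrt (ip X X)"
  have "s > 0" using p by (simp add: s_def)
  have "prob {\<omega> \<in> space M. X \<omega> > x} = prob {\<omega> \<in> space M. (1 / s) * X \<omega> \<in> {x / s<..}}"
    using \<open>s > 0\<close> by (intro arg_cong[where f=prob]) (auto simp: field_simps)
  also have "\<dots> = measure std_normal {x / s<..}"
    using normalize_mem[OF assms(1) p] by (intro prob_std_normal) (auto simp: s_def)
  also have "\<dots> \<le> exp (- (x / s)\<^sup>2 / 2)" using assms \<open>s > 0\<close> by (intro normal_density_tail_le) simp
  also have "(x / s)\<^sup>2 = x\<^sup>2 / ip X X" using p by (simp add: power_divide s_def)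
  also have "exp (- (x\<^sup>2 / ip X X) / 2) \<le> exp (- x\<^sup>2 / (2 * v))"
    using p assms mult_right_mono[OF assms(2) zero_le_power2[of x]] by (simp add: field_simps)
  finally show ?thesis .
qed

lemma prob_le_neg_ge:
  assumes "X \<in> H" "ip X X = 1" "0 \<le> m"
  shows "exp (- m\<^sup>2 - 1) / sqrt (2 * pi) \<le> prob {\<omega> \<in> space M. X \<omega> \<le> - m}"
  using prob_std_normal[OF assms(1,2), of "{..-m}"] normal_density_tail_ge[OF assms(3)] by simp


text \<open>Gram-Schmidt; a new vector is added only when the residual \<open>R\<close> has positive
  variance, so that linearly dependent families are allowed and \<open>m\<close> may be smaller than
  \<open>n\<close>.\<close>

lemma orthonormal_decomposition:
  fixes n :: nat
  assumes "\<And>i. i < n \<Longrightarrow> X i \<in> H"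
  shows "\<exists>m (\<xi> :: nat \<Rightarrow> 'w \<Rightarrow> real) c. (\<forall>j<m. \<xi> j \<in> H) \<and> (\<forall>j<m. \<forall>k<m. ip (\<xi> j) (\<xi> k) = (if j = k then 1 else 0))
    \<and> (\<forall>i<n. AE \<omega> in M. X i \<omega> = (\<Sum>j<m. c i j * \<xi> j \<omega>))"
  using assms
proof (induction n)
  case 0
  show ?case by (rule exI[of _ 0]) auto
next
  case (Suc n)
  obtain m and \<xi> :: "nat \<Rightarrow> 'w \<Rightarrow> real" and c where IH: "\<forall>j<m. \<xi> j \<in> H" "\<forall>j<m. \<forall>k<m. ip (\<xi> j) (\<xi> k) = (if j = k then 1 else 0)"
    "\<forall>i<n. AE \<omega> in M. X i \<omega> = (\<Sum>j<m. c i j * \<xi> j \<omega>)"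
    using Suc.IH[OF Suc.prems[OF less_SucI]] by blast
  hence \<xi>: "\<And>j. j < m \<Longrightarrow> \<xi> j \<in> H" and orth: "\<And>j k. j < m \<Longrightarrow> k < m \<Longrightarrow> ip (\<xi> j) (\<xi> k) = (if j = k then 1 else 0)"
    and c: "\<And>i. i < n \<Longrightarrow> AE \<omega> in M. X i \<omega> = (\<Sum>j<m. c i j * \<xi> j \<omega>)"
    by blast+
  have Xn: "X n \<in> H" using Suc.prems by simp
  define d where "d j = ip (X n) (\<xi> j)" for j
  define P where "P = (\<lambda>\<omega>. \<Sum>j<m. d j * \<xi> j \<omega>)"
  have P: "P \<in> H" unfolding P_def using \<xi> by (intro lincomb_mem) auto
  define R where "R = (\<lambda>\<omega>. X n \<omega> - P \<omega>)"
  have R: "R \<in> H" unfolding R_def using Xn P by (rule diff_mem)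
  have RO: "ip R (\<xi> k) = 0" if "k < m" for k
  proof -
    have "ip P (\<xi> k) = (\<Sum>j<m. d j * ip (\<xi> j) (\<xi> k))"
      unfolding P_def using \<xi> that by (intro ip_lincomb) auto
    also have "\<dots> = (\<Sum>j<m. if j = k then d j else 0)" using that orth by (intro sum.cong) auto
    also have "\<dots> = d k" using that by simp
    finally show ?thesis unfolding R_def using Xn P \<xi>[OF that] by (simp add: ip_diff d_def)
  qed
  show ?case
  proof (cases "ip R R = 0")
    case True
    have "AE \<omega> in M. X n \<omega> = (\<Sum>j<m. d j * \<xi> j \<omega>)"
      using AE_zero[OF R True] by (auto simp: R_def P_def)
    hence "\<forall>i<Suc n. AE \<omega> in M. X i \<omega> = (\<Sum>j<m. (c(n := d)) i j * \<xi> j \<omega>)"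
      using c by (auto simp: less_Suc_eq)
    thus ?thesis using \<xi> orth by blast
  next
    case False
    hence p: "ip R R > 0" using ip_self_nonneg[of R] by simp
    define s where "s = sqrt (ip R R)"
    have "s > 0" using p by (simp add: s_def)
    define \<eta> where "\<eta> = \<xi>(m := (\<lambda>\<omega>. (1 / s) * R \<omega>))"
    have \<eta>H: "\<forall>j<Suc m. \<eta> j \<in> H" using \<xi> scale_mem[OF R, of "1 / s"] by (auto simp: \<eta>_def less_Suc_eq)
    have e1: "ip (\<eta> m) (\<eta> m) = 1" using normalize_mem(2)[OF R p] by (simp add: \<eta>_def s_def)
    have e2: "ip (\<eta> m) (\<eta> k) = 0" "ip (\<eta> k) (\<eta> m) = 0" if "k < m" for k
      using that RO[OF that] ip_scale[of "1 / s" R "\<xi> k"] by (auto simp: \<eta>_def ip_commute[of "\<xi> k"])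
    have e3: "ip (\<eta> j) (\<eta> k) = (if j = k then 1 else 0)" if "j < m" "k < m" for j k
      using that orth by (auto simp: \<eta>_def)
    have "\<forall>j<Suc m. \<forall>k<Suc m. ip (\<eta> j) (\<eta> k) = (if j = k then 1 else 0)"
      using e1 e2 e3 by (auto simp: less_Suc_eq)
    \<comment> \<open>Rows below \<open>n\<close> get coefficient 0 at the new vector; row
      \<open>n\<close> consists of the projection coefficients \<open>d\<close> and the norm
      \<open>s\<close> of the residual.\<close>
    moreover have "\<forall>i<Suc n. AE \<omega> in M. X i \<omega> = (\<Sum>j<Suc m. ((\<lambda>i. (c i)(m := 0))(n := d(m := s))) i j * \<eta> j \<omega>)"
    proof (intro allI impI)
      fix i assume "i < Suc n"
      then consider "i < n" | "i = n" by linarith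
      then show "AE \<omega> in M. X i \<omega> = (\<Sum>j<Suc m. ((\<lambda>i. (c i)(m := 0))(n := d(m := s))) i j * \<eta> j \<omega>)"
      proof cases
        case 1
        have "(\<Sum>j<Suc m. ((\<lambda>i. (c i)(m := 0))(n := d(m := s))) i j * \<eta> j \<omega>) = (\<Sum>j<m. c i j * \<xi> j \<omega>)" for \<omega>
          using 1 by (auto simp: \<eta>_def intro!: sum.cong)
        thus ?thesis using c[OF 1] by simp
      next
        case 2
        have "(\<Sum>j<Suc m. ((\<lambda>i. (c i)(m := 0))(n := d(m := s))) i j * \<eta> j \<omega>) = (\<Sum>j<m. d j * \<xi> j \<omega>) + s * (1 / s * R \<omega>)" for \<omega>
          using 2 by (auto simp: \<eta>_def intro!: sum.cong)
        hence "(\<Sum>j<Suc m. ((\<lambda>i. (c i)(m := 0))(n := d(m := s))) i j * \<eta> j \<omega>) = X n \<omega>" for \<omega>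
          using \<open>s > 0\<close> by (simp add: R_def P_def)
        thus ?thesis using 2 by simp
      qed
    qed
    ultimately show ?thesis using \<eta>H by blast
  qed
qed

text \<open>Uncorrelated jointly Gaussian variables are independent: the family has the same
  characteristic function as when \<open>X\<close> and the \<open>Y i\<close> are read off from two
  independent copies of the space, where probabilities factorise. In the index type,
  \<open>None\<close> belongs to \<open>X\<close>.\<close>

lemma indep_orthogonal:
  fixes Y :: "'i \<Rightarrow> 'w \<Rightarrow> real"
  assumes X: "X \<in> H" and I: "finite I" and Y: "\<And>i. i \<in> I \<Longrightarrow> Y i \<in> H" and orth: "\<And>i. i \<in> I \<Longrightarrow> ip X (Y i) = 0"
    and A: "A \<in> sets borel" and B: "\<And>i. i \<in> I \<Longrightarrow> B i \<in> sets borel"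
  shows "prob {\<omega> \<in> space M. X \<omega> \<in> A \<and> (\<forall>i\<in>I. Y i \<omega> \<in> B i)}
    = prob {\<omega> \<in> space M. X \<omega> \<in> A} * prob {\<omega> \<in> space M. \<forall>i\<in>I. Y i \<omega> \<in> B i}"
proof -
  let ?N = "M \<Otimes>\<^sub>M M" and ?J = "insert None (Some ` I)"
  define U where "U k = (case k of None \<Rightarrow> X | Some i \<Rightarrow> Y i)" for k
  define V where "V k \<omega> = (case k of None \<Rightarrow> X (fst \<omega>) | Some i \<Rightarrow> Y i (snd \<omega>))" for k and \<omega> :: "'w \<times> 'w"
  define K where "K x \<longleftrightarrow> x None \<in> A \<and> (\<forall>i\<in>I. x (Some i) \<in> B i)" for x :: "'i option \<Rightarrow> real"
  interpret MM: pair_prob_space M M ..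
  have [measurable]: "X \<in> borel_measurable M" "A \<in> sets borel" using X A measurable_mem by auto
  have Ym[measurable]: "Y i \<in> borel_measurable M" if "i \<in> I" for i using Y that measurable_mem by auto
  have "prob {\<omega> \<in> space M. K (\<lambda>k. U k \<omega>)} = measure ?N {\<omega> \<in> space ?N. K (\<lambda>k. V k \<omega>)}"
  proof (rule cramer_wold_prob[where I = ?J])
    show "prob_space M" "prob_space ?N" "finite ?J" using I by (auto intro: prob_space_axioms MM.prob_space_axioms)
    show "U i \<in> borel_measurable M" if "i \<in> ?J" for i using that by (auto simp: U_def)
    show "V i \<in> borel_measurable ?N" if "i \<in> ?J" for i using that by (auto simp: V_def[abs_def])
    show "K x = K y" if "\<And>i. i \<in> ?J \<Longrightarrow> x i = y i" for x y using that by (auto simp: K_def)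
    have "{x \<in> space (Pi\<^sub>M ?J (\<lambda>_. borel)). K x} = Pi\<^sub>E ?J (\<lambda>k. case k of None \<Rightarrow> A | Some i \<Rightarrow> B i)"
      by (auto simp: space_PiM K_def PiE_def Pi_def extensional_def)
    also have "\<dots> \<in> sets (Pi\<^sub>M ?J (\<lambda>_. borel))"
      using I A B by (intro sets_PiM_I_finite) auto
    finally show "{x \<in> space (Pi\<^sub>M ?J (\<lambda>_. borel)). K x} \<in> sets (Pi\<^sub>M ?J (\<lambda>_. borel))" .
    fix a
    define S where "S = (\<lambda>\<omega>. \<Sum>i\<in>I. a (Some i) * Y i \<omega>)"
    have S: "S \<in> H" unfolding S_def using I Y by (intro lincomb_mem) auto
    have [measurable]: "S \<in> borel_measurable M" using S by (rule measurable_mem)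
    define X' where "X' = (\<lambda>\<omega>. a None * X \<omega>)"
    have X': "X' \<in> H" unfolding X'_def using X by (rule scale_mem)
    have [measurable]: "X' \<in> borel_measurable M" using X' by (rule measurable_mem)
    have "ip S X = (\<Sum>i\<in>I. a (Some i) * ip (Y i) X)" unfolding S_def using I Y X by (intro ip_lincomb) auto
    also have "\<dots> = 0" using orth by (simp add: ip_commute[of _ X])
    finally have "ip X' S = 0" by (simp add: X'_def ip_scale ip_commute)
    hence ip: "ip (\<lambda>\<omega>. X' \<omega> + S \<omega>) (\<lambda>\<omega>. X' \<omega> + S \<omega>) = ip X' X' + ip S S"
      using X' S by (simp add: ip_add ip_add2 add_mem ip_commute[of S X'])
    have inj: "inj_on Some I" by simp
    have sU: "(\<Sum>i\<in>?J. a i * U i \<omega>) = X' \<omega> + S \<omega>" for \<omega>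
      using I by (simp add: sum.reindex U_def X'_def S_def)
    have sV: "(\<Sum>i\<in>?J. a i * V i \<omega>) = X' (fst \<omega>) + S (snd \<omega>)" for \<omega>
      using I by (simp add: sum.reindex V_def X'_def S_def)
    have i1: "integrable M (\<lambda>\<omega>. iexp (Z \<omega>))" if [measurable]: "Z \<in> borel_measurable M" for Z
      by (intro integrable_const_bound[of _ 1]) auto
    have "(CLINT \<omega>|?N. iexp (X' (fst \<omega>) + S (snd \<omega>))) = (CLINT \<omega>|?N. iexp (X' (fst \<omega>)) * iexp (S (snd \<omega>)))"
      by (simp add: exp_add[symmetric] algebra_simps)
    also have "\<dots> = (\<integral>x. (\<integral>y. iexp (X' x) * iexp (S y) \<partial>M) \<partial>M)"
    proof -
      have "integrable ?N (\<lambda>\<omega>. iexp (X' (fst \<omega>)) * iexp (S (snd \<omega>)))"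
        by (intro MM.integrable_const_bound[of _ 1]) (auto simp: norm_mult)
      from MM.integral_fst'[OF this] show ?thesis by simp
    qed
    also have "\<dots> = (CLINT x|M. iexp (X' x)) * (CLINT y|M. iexp (S y))"
      using i1 by simp
    also have "\<dots> = complex_of_real (exp (- ip X' X' / 2) * exp (- ip S S / 2))"
      using char_ip[OF X'] char_ip[OF S] by simp
    also have "exp (- ip X' X' / 2) * exp (- ip S S / 2) = exp (- ip (\<lambda>\<omega>. X' \<omega> + S \<omega>) (\<lambda>\<omega>. X' \<omega> + S \<omega>) / 2)"
      unfolding ip by (simp add: exp_add[symmetric] field_simps)
    finally show "(CLINT \<omega>|M. iexp (\<Sum>i\<in>?J. a i * U i \<omega>)) = (CLINT \<omega>|?N. iexp (\<Sum>i\<in>?J. a i * V i \<omega>))"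
      unfolding sU sV using char_ip[OF add_mem[OF X' S]] by simp
  qed
  also have "{\<omega> \<in> space ?N. K (\<lambda>k. V k \<omega>)} = {\<omega> \<in> space M. X \<omega> \<in> A} \<times> {\<omega> \<in> space M. \<forall>i\<in>I. Y i \<omega> \<in> B i}"
    by (auto simp: space_pair_measure K_def V_def)
  also have "measure ?N \<dots> = prob {\<omega> \<in> space M. X \<omega> \<in> A} * prob {\<omega> \<in> space M. \<forall>i\<in>I. Y i \<omega> \<in> B i}"
  proof -
    have 1: "{\<omega> \<in> space M. X \<omega> \<in> A} \<in> sets M" by measurable
    have "{\<omega> \<in> space M. Y i \<omega> \<in> B i} \<in> sets M" if "i \<in> I" for i
      using that B Ym by measurable
    hence 2: "{\<omega> \<in> space M. \<forall>i\<in>I. Y i \<omega> \<in> B i} \<in> sets M" using I by (intro sets.sets_Collect_finite_All) auto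
    show ?thesis
      unfolding measure_def using emeasure_pair_measure_Times[OF 1 2] by (simp add: enn2real_mult)
  qed
  finally show ?thesis by (simp add: K_def U_def)
qed


section \<open>Log-concavity of strip probabilities\<close>

lemma char_orthonormal:
  fixes m :: nat
  assumes \<xi>: "\<And>j. j < m \<Longrightarrow> \<xi> j \<in> H" and orth: "\<And>j k. j < m \<Longrightarrow> k < m \<Longrightarrow> ip (\<xi> j) (\<xi> k) = (if j = k then 1 else 0)"
  shows "(CLINT \<omega>|M. iexp (\<Sum>j<m. a j * \<xi> j \<omega>)) = complex_of_real (\<Prod>j<m. exp (- (a j)\<^sup>2 / 2))"
proof -
  define S where "S = (\<lambda>\<omega>. \<Sum>j<m. a j * \<xi> j \<omega>)"
  have S: "S \<in> H" unfolding S_def using \<xi> by (intro lincomb_mem) auto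
  have "ip S S = (\<Sum>j<m. a j * ip (\<xi> j) S)" unfolding S_def using \<xi> S by (intro ip_lincomb) (auto simp: S_def)
  also have "\<dots> = (\<Sum>j<m. a j * (\<Sum>k<m. a k * ip (\<xi> k) (\<xi> j)))"
    unfolding S_def using \<xi> by (intro sum.cong refl arg_cong2[where f="(*)"]) (auto simp: ip_commute[of "\<xi> _" "\<lambda>\<omega>. \<Sum>j<m. a j * \<xi> j \<omega>"] intro!: ip_lincomb)
  also have "\<dots> = (\<Sum>j<m. a j * (\<Sum>k<m. if k = j then a k else 0))"
    using orth by (intro sum.cong refl arg_cong2[where f="(*)"]) auto
  also have "\<dots> = (\<Sum>j<m. (a j)\<^sup>2)" by (intro sum.cong) (auto simp: power2_eq_square)
  finally have v: "ip S S = (\<Sum>j<m. (a j)\<^sup>2)" .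
  have "exp (- ip S S / 2) = (\<Prod>j<m. exp (- (a j)\<^sup>2 / 2))"
    unfolding v by (simp add: exp_sum[symmetric] sum_negf sum_divide_distrib)
  thus ?thesis using char_ip[OF S] by (simp add: S_def)
qed

end

lemma char_product_std_normal:
  "(CLINT x|Pi\<^sub>M {..<m::nat} (\<lambda>_. std_normal). iexp (\<Sum>j<m. a j * x j)) = complex_of_real (\<Prod>j<m. exp (- (a j)\<^sup>2 / 2))"
proof -
  interpret P: product_sigma_finite "\<lambda>_::nat. std_normal"
    by (intro product_sigma_finite.intro prob_space_imp_sigma_finite prob_space_std_normal)
  interpret S: prob_space std_normal by (rule prob_space_std_normal)
  have "(CLINT x|Pi\<^sub>M {..<m} (\<lambda>_. std_normal). iexp (\<Sum>j<m. a j * x j)) = (CLINT x|Pi\<^sub>M {..<m} (\<lambda>_. std_normal). (\<Prod>j<m. iexp (a j * x j)))"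
    by (simp add: exp_sum sum_distrib_left)
  also have "\<dots> = (\<Prod>j<m. CLINT t|std_normal. iexp (a j * t))"
    by (intro P.product_integral_prod) (auto intro!: S.integrable_const_bound[of _ 1])
  also have "\<dots> = (\<Prod>j<m. char std_normal (a j))" by (simp add: char_def)
  finally show ?thesis by (simp add: char_std_normal_distribution)
qed

context gaussian_space
begin

text \<open>In orthonormal coordinates \<open>L z\<close> is the standard normal measure of the set
  of \<open>x\<close> with \<open>K z x\<close>. The pairs \<open>(z, x)\<close> with
  \<open>K z x\<close> form a convex set, since \<open>K\<close> consists of linear inequalities in
  both, so the indicator is jointly log-concave.\<close>

lemma prob_strip_log_concave:
  fixes n :: nat and a b :: real
  assumes F: "F \<in> H" and X: "\<And>i. i < n \<Longrightarrow> X i \<in> H" and l: "0 < l" "l < (1::real)"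
  defines "L \<equiv> \<lambda>z. prob {\<omega> \<in> space M. F \<omega> \<in> {a..b} \<and> (\<forall>i<n. X i \<omega> \<le> z)}"
  shows "L z powr (1 - l) * L w powr l \<le> L ((1 - l) * z + l * w)"
proof -
  \<comment> \<open>\<open>F\<close> is stored at the free index \<open>n\<close>, to be decomposed
    together with the \<open>X i\<close>.\<close>
  have mem: "(X(n := F)) i \<in> H" if "i < Suc n" for i using that F X by (auto simp: less_Suc_eq)
  obtain m and \<xi> :: "nat \<Rightarrow> 'w \<Rightarrow> real" and c where
    D: "\<forall>j<m. \<xi> j \<in> H" "\<forall>j<m. \<forall>k<m. ip (\<xi> j) (\<xi> k) = (if j = k then 1 else 0)"
      "\<forall>i<Suc n. AE \<omega> in M. (X(n := F)) i \<omega> = (\<Sum>j<m. c i j * \<xi> j \<omega>)"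
    using orthonormal_decomposition[of "Suc n" "X(n := F)"] mem by auto
  define K where "K z x \<longleftrightarrow> (\<Sum>j<m. c n j * x j) \<in> {a..b} \<and> (\<forall>i<n. (\<Sum>j<m. c i j * x j) \<le> z)" for z :: real and x :: "nat \<Rightarrow> real"
  define f where "f z x = (if K z x then 1 else 0 :: real)" for z x
  let ?P = "Pi\<^sub>M {..<m} (\<lambda>_. std_normal)"
  let ?B = "Pi\<^sub>M {..<m} (\<lambda>_. borel) :: (nat \<Rightarrow> real) measure"
  interpret P: prob_space ?P by (intro prob_space_PiM prob_space_std_normal)
  have sets_eq: "sets ?P = sets ?B" by (intro sets_PiM_cong) auto
  have ss: "(\<lambda>x. \<Sum>j<m. c i j * x j) \<in> borel_measurable ?B" for i by measurable
  have Km: "{x \<in> space ?B. K z x} \<in> sets ?B" for z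
  proof -
    have [measurable]: "(\<lambda>x. \<Sum>j<m. c i j * x j) \<in> borel_measurable ?B" for i by (rule ss)
    show ?thesis unfolding K_def by measurable
  qed
  have \<xi>m: "\<xi> j \<in> borel_measurable M" if "j < m" for j using D(1) that measurable_mem by auto
  have LK: "L z = measure ?P {x \<in> space ?P. K z x}" for z
  proof -
    have 1: "AE \<omega> in M. \<forall>i\<in>{..<Suc n}. (X(n := F)) i \<omega> = (\<Sum>j<m. c i j * \<xi> j \<omega>)"
      using D(3) by (subst AE_ball_countable) auto
    have 2: "AE \<omega> in M. F \<omega> = (\<Sum>j<m. c n j * \<xi> j \<omega>) \<and> (\<forall>i<n. X i \<omega> = (\<Sum>j<m. c i j * \<xi> j \<omega>))"
      using 1
    proof eventually_elim
      case (elim \<omega>)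
      have "X i \<omega> = (\<Sum>j<m. c i j * \<xi> j \<omega>)" if "i < n" for i using bspec[OF elim, of i] that by simp
      thus ?case using bspec[OF elim, of n] by simp
    qed
    have "L z = prob {\<omega> \<in> space M. K z (\<lambda>j. \<xi> j \<omega>)}"
      unfolding L_def
    proof (rule measure_eq_AE)
      show "AE \<omega> in M. (\<omega> \<in> {\<omega> \<in> space M. F \<omega> \<in> {a..b} \<and> (\<forall>i<n. X i \<omega> \<le> z)}) = (\<omega> \<in> {\<omega> \<in> space M. K z (\<lambda>j. \<xi> j \<omega>)})"
        using 2 by eventually_elim (auto simp: K_def)
      show "{\<omega> \<in> space M. F \<omega> \<in> {a..b} \<and> (\<forall>i<n. X i \<omega> \<le> z)} \<in> sets M"
      proof -
        have [measurable]: "F \<in> borel_measurable M" using F measurable_mem by simp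
        have "{\<omega> \<in> space M. X i \<omega> \<le> z} \<in> sets M" if "i \<in> {..<n}" for i
        proof -
          have [measurable]: "X i \<in> borel_measurable M" using X that measurable_mem by simp
          show ?thesis by measurable
        qed
        hence [measurable]: "{\<omega> \<in> space M. \<forall>i\<in>{..<n}. X i \<omega> \<le> z} \<in> sets M" by (intro sets.sets_Collect_finite_All) auto
        have "{\<omega> \<in> space M. F \<omega> \<in> {a..b} \<and> (\<forall>i<n. X i \<omega> \<le> z)} = {\<omega> \<in> space M. F \<omega> \<in> {a..b}} \<inter> {\<omega> \<in> space M. \<forall>i\<in>{..<n}. X i \<omega> \<le> z}" by auto
        thus ?thesis by simp
      qed
      have [measurable]: "(\<lambda>\<omega>. \<Sum>j<m. c i j * \<xi> j \<omega>) \<in> borel_measurable M" for i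
        using \<xi>m by (intro borel_measurable_sum borel_measurable_times) auto
      show "{\<omega> \<in> space M. K z (\<lambda>j. \<xi> j \<omega>)} \<in> sets M"
        unfolding K_def by measurable
    qed
    also have "\<dots> = measure ?P {x \<in> space ?P. K z (\<lambda>j. x j)}"
    proof (rule cramer_wold_prob[where I = "{..<m}"])
      show "prob_space M" "prob_space ?P" by (rule prob_space_axioms P.prob_space_axioms)+
      show "(\<lambda>x. x j) \<in> borel_measurable ?P" if "j \<in> {..<m}" for j
        using measurable_component_singleton[OF that, of "\<lambda>_. std_normal"] by simp
      show "(CLINT \<omega>|M. iexp (\<Sum>j<m. a j * \<xi> j \<omega>)) = (CLINT x|?P. iexp (\<Sum>j<m. a j * x j))" for a
        unfolding char_product_std_normal by (rule char_orthonormal) (use D(1,2) in auto)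
      show "K z x = K z y" if "\<And>i. i \<in> {..<m} \<Longrightarrow> x i = y i" for x y using that by (simp add: K_def)
    qed (use \<xi>m Km in auto)
    finally show ?thesis by simp
  qed
  have Lf: "L z = (\<integral>x. f z x \<partial>?P)" for z
  proof -
    have "{x \<in> space ?P. K z x} \<in> sets ?P" unfolding sets_eq_imp_space_eq[OF sets_eq] sets_eq by (rule Km)
    hence "L z = (\<integral>x. indicator {x \<in> space ?P. K z x} x \<partial>?P)" unfolding LK by simp
    also have "\<dots> = (\<integral>x. f z x \<partial>?P)" by (intro Bochner_Integration.integral_cong) (auto simp: f_def)
    finally show ?thesis .
  qed
  show ?thesis unfolding Lf
  proof (rule jointly_log_concave_expectation)
    show "jointly_log_concave f"
      unfolding jointly_log_concave_def
    proof (intro allI impI)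
      fix z w :: real and x y :: "nat \<Rightarrow> real" and l :: real assume l: "0 < l" "l < 1"
      have lin: "(\<Sum>j<m. d j * ((1 - l) * x j + l * y j)) = (1 - l) * (\<Sum>j<m. d j * x j) + l * (\<Sum>j<m. d j * y j)" for d
      proof -
        have "(\<Sum>j<m. d j * ((1 - l) * x j + l * y j)) = (\<Sum>j<m. (1 - l) * (d j * x j) + l * (d j * y j))"
          by (intro sum.cong) (auto simp: algebra_simps)
        thus ?thesis by (simp only: sum.distrib sum_distrib_left)
      qed
      have "K ((1 - l) * z + l * w) (\<lambda>i. (1 - l) * x i + l * y i)" if K: "K z x" "K w y"
      proof -
        have "(1 - l) * a + l * a \<le> (1 - l) * (\<Sum>j<m. c n j * x j) + l * (\<Sum>j<m. c n j * y j)"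
          using K l unfolding K_def by (intro add_mono mult_left_mono) auto
        moreover have "(1 - l) * (\<Sum>j<m. c n j * x j) + l * (\<Sum>j<m. c n j * y j) \<le> (1 - l) * b + l * b"
          using K l unfolding K_def by (intro add_mono mult_left_mono) auto
        moreover have "(1 - l) * (\<Sum>j<m. c i j * x j) + l * (\<Sum>j<m. c i j * y j) \<le> (1 - l) * z + l * w" if "i < n" for i
          using K l that unfolding K_def by (intro add_mono mult_left_mono) auto
        ultimately show ?thesis unfolding K_def lin by (auto simp: algebra_simps)
      qed
      thus "f z x powr (1 - l) * f w y powr l \<le> f ((1 - l) * z + l * w) (\<lambda>i. (1 - l) * x i + l * y i)"
        unfolding f_def by auto
    qed
    show "f z \<in> borel_measurable ?B" for z
      unfolding f_def by (rule measurable_If[OF _ _ Km]) auto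
    show "f z x = f z y" if "\<And>i. i \<in> {..<m} \<Longrightarrow> x i = y i" for z x y using that by (simp add: f_def K_def)
  qed (use l in \<open>auto simp: f_def\<close>)
qed

end

section \<open>Chaining\<close>

text \<open>The binary expansion of \<open>i\<close> leads from 0 to \<open>i\<close> by jumps over
  dyadic intervals, at most one of each length.\<close>

lemma dyadic_chain_bound:
  fixes y t :: "nat \<Rightarrow> real"
  assumes inc: "\<And>m j. m \<le> n \<Longrightarrow> Suc j * 2 ^ m \<le> 2 ^ n \<Longrightarrow> y (Suc j * 2 ^ m) - y (j * 2 ^ m) \<le> t m"
    and t: "\<And>m. 0 \<le> t m" and i: "i \<le> 2 ^ n"
  shows "y i \<le> y 0 + (\<Sum>m\<le>n. t m)"
proof -
  \<comment> \<open>Inside a block of length \<open>2 ^ m\<close> only jumps of levels below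
    \<open>m\<close> occur.\<close>
  have *: "y (a * 2 ^ m + i) \<le> y (a * 2 ^ m) + (\<Sum>k<m. t k)" if "m \<le> n" "i < 2 ^ m" "a * 2 ^ m + i \<le> 2 ^ n" for m a i
    using that
  proof (induction m arbitrary: a i)
    case 0
    then show ?case by simp
  next
    case (Suc m)
    show ?case
    proof (cases "i < 2 ^ m")
      case True
      have "y ((2 * a) * 2 ^ m + i) \<le> y ((2 * a) * 2 ^ m) + (\<Sum>k<m. t k)"
        using Suc.prems True by (intro Suc.IH) (auto simp: ac_simps)
      thus ?thesis using t[of m] by (simp add: ac_simps)
    next
      case False
      define i' where "i' = i - 2 ^ m"
      have i': "i = 2 ^ m + i'" "i' < 2 ^ m" using False Suc.prems by (auto simp: i'_def)
      have e: "a * 2 ^ Suc m + i = (Suc (2 * a)) * 2 ^ m + i'" "a * 2 ^ Suc m = (2 * a) * 2 ^ m" unfolding i'(1) by (simp_all add: algebra_simps)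
      have "y ((Suc (2 * a)) * 2 ^ m + i') \<le> y ((Suc (2 * a)) * 2 ^ m) + (\<Sum>k<m. t k)"
        using Suc.prems i' e by (intro Suc.IH) auto
      moreover have "y (Suc (2 * a) * 2 ^ m) - y ((2 * a) * 2 ^ m) \<le> t m"
        using Suc.prems e by (intro inc) auto
      moreover have "y (a * 2 ^ Suc m + i) = y (Suc (2 * a) * 2 ^ m + i')" by (simp only: e(1))
      moreover have "y (a * 2 ^ Suc m) = y ((2 * a) * 2 ^ m)" by (simp only: e(2))
      ultimately show ?thesis unfolding sum.lessThan_Suc by linarith
    qed
  qed
  show ?thesis
  proof (cases "i < 2 ^ n")
    case True
    then show ?thesis using *[of n i 0] t[of n] by (simp add: lessThan_Suc_atMost[symmetric])
  next
    case False
    hence "i = 2 ^ n" using i by simp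
    moreover have "y (Suc 0 * 2 ^ n) - y (0 * 2 ^ n) \<le> t n" by (intro inc) auto
    moreover have "0 \<le> (\<Sum>m<n. t m)" using t by (intro sum_nonneg) auto
    ultimately show ?thesis by (simp add: lessThan_Suc_atMost[symmetric])
  qed
qed

text \<open>
  In the chaining argument the increments at level \<open>l\<close> have standard deviation proportional to \<open>q8 ^ (2 * l)\<close> and
  are allowed the share \<open>(1 - q8) * q8 ^ l\<close> of the total deviation.
\<close>

definition q8 :: real where "q8 = (1 / 2) powr (1 / 8)"

lemma q8: "0 < q8" "q8 < 1" "q8 ^ 8 = 1 / 2"
proof -
  show "0 < q8" by (simp add: q8_def)
  have "q8 ^ 8 = (1 / 2) powr ((1 / 8) * real 8)" unfolding q8_def by (subst powr_powr[symmetric]) (simp add: powr_realpow)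
  thus e: "q8 ^ 8 = 1 / 2" by simp
  show "q8 < 1"
  proof (rule ccontr)
    assume "\<not> q8 < 1" hence "1 \<le> q8 ^ 8" by (intro one_le_power) simp
    thus False using e by simp
  qed
qed

lemma q8_power: "(q8 ^ (4 * l))\<^sup>2 = (1 / 2) ^ l"
proof -
  have "(q8 ^ (4 * l))\<^sup>2 = (q8 ^ 8) ^ l" by (simp add: power_mult[symmetric] mult.commute)
  thus ?thesis by (simp only: q8)
qed

lemma sqrt_dyadic: "m \<le> n \<Longrightarrow> sqrt (2 ^ m / 2 ^ n) = q8 ^ (4 * (n - m))"
proof -
  assume "m \<le> n"
  hence "(2::real) ^ m / 2 ^ n = (1 / 2) ^ (n - m)" by (simp add: power_diff field_simps power_one_over)
  also have "\<dots> = (q8 ^ (4 * (n - m)))\<^sup>2" by (rule q8_power[symmetric])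
  finally show ?thesis using q8 by simp
qed

text \<open>The squared ratio of the allowed deviation to the standard deviation at level
  \<open>l\<close> grows like \<open>1 / q8 ^ (2 * l)\<close>. Linear growth with slope 1/8 is
  enough to beat the number \<open>2 ^ l\<close> of increments; it comes from
  \<open>q8\<^sup>2 \<le> 8 / 9\<close> and Bernoulli's inequality.\<close>

lemma q8_growth: "1 + real l / 8 \<le> 1 / q8 ^ (2 * l)"
proof -
  have "q8\<^sup>2 \<le> 8 / 9"
  proof (rule ccontr)
    assume "\<not> q8\<^sup>2 \<le> 8 / 9"
    hence "(8 / 9) ^ 4 < (q8\<^sup>2) ^ 4" by (intro power_strict_mono) auto
    also have "(q8\<^sup>2) ^ 4 = 1 / 2" using q8(3) by simp
    finally show False by (simp add: field_simps)
  qed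
  hence "1 + 1 / 8 \<le> 1 / q8\<^sup>2" using q8 by (simp add: field_simps)
  hence "(1 + 1 / 8) ^ l \<le> (1 / q8\<^sup>2) ^ l" by (intro power_mono) auto
  moreover have "1 + real l * (1 / 8) \<le> (1 + 1 / 8) ^ l" by (intro Bernoulli_inequality) auto
  ultimately show ?thesis by (simp add: power_one_over power_mult)
qed

lemma four_le_exp_2: "4 \<le> exp (2::real)"
proof -
  have "(2::real) \<le> exp 1" using exp_ge_add_one_self[of 1] by simp
  hence "2 * 2 \<le> exp 1 * exp (1::real)" by (intro mult_mono) auto
  thus ?thesis by (simp add: exp_add[symmetric])
qed

text \<open>For \<open>y \<ge> 16\<close> the terms are dominated by a geometric series with ratio
  1/2. The generous factor \<open>exp 16\<close> is chosen for \<open>chaining\<close>, whose bound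
  it makes trivial for \<open>y < 16\<close>.\<close>

lemma chain_series_le:
  fixes y :: real
  assumes "16 \<le> y" shows "(\<Sum>l\<le>n. 2 ^ l * exp (- y * (1 + real l / 8))) \<le> exp 16 * exp (- y)"
proof -
  have "exp (- y / 8) \<le> exp (- 2)" using assms by simp
  also have "\<dots> \<le> 1 / 4" using four_le_exp_2 by (simp add: exp_minus field_simps)
  finally have r: "2 * exp (- y / 8) \<le> 1 / 2" by simp
  have "(\<Sum>l\<le>n. 2 ^ l * exp (- y * (1 + real l / 8))) = (\<Sum>l\<le>n. exp (- y) * (2 * exp (- y / 8)) ^ l)"
  proof (intro sum.cong refl)
    fix l
    have "exp (- y * (1 + real l / 8)) = exp (- y) * exp (- y / 8) ^ l"
      by (simp add: exp_of_nat_mult[symmetric] exp_add[symmetric] algebra_simps)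
    thus "2 ^ l * exp (- y * (1 + real l / 8)) = exp (- y) * (2 * exp (- y / 8)) ^ l" by (simp add: power_mult_distrib)
  qed
  also have "\<dots> \<le> (\<Sum>l\<le>n. exp (- y) * (1 / 2) ^ l)" using r by (intro sum_mono mult_left_mono power_mono) auto
  also have "\<dots> = exp (- y) * (\<Sum>l\<le>n. (1 / 2) ^ l)" by (simp add: sum_distrib_left)
  also have "(\<Sum>l\<le>n. (1 / 2) ^ l) \<le> (2::real)" by (subst sum_gp0) (simp add: field_simps)
  also have "(2::real) \<le> exp 16" using exp_ge_add_one_self[of 16] by simp
  finally show ?thesis by (simp add: mult.commute mult_left_mono)
qed

context gaussian_space
begin

text \<open>If no dyadic increment exceeds its share of \<open>x\<close>, then
  \<open>dyadic_chain_bound\<close> keeps all \<open>Y i\<close> at or below \<open>x\<close>; the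
  union bound over the exceptional increments sums to the claim. The bound does not depend on
  \<open>n\<close>, which permits the passage from grids to continuous time.\<close>

lemma chaining:
  assumes Y: "\<And>i. i \<le> 2 ^ n \<Longrightarrow> Y i \<in> H" and Y0: "Y 0 = (\<lambda>_. 0)" and V: "0 < V" and x: "0 \<le> x"
    and inc: "\<And>i j. i \<le> j \<Longrightarrow> j \<le> 2 ^ n \<Longrightarrow> incr_var (Y j) (Y i) \<le> V * sqrt (real (j - i) / 2 ^ n)"
  shows "prob {\<omega> \<in> space M. \<exists>i\<le>2 ^ n. Y i \<omega> > x} \<le> exp 16 * exp (- (x\<^sup>2 * (1 - q8)\<^sup>2 / (2 * V)))"
proof -
  define y where "y = x\<^sup>2 * (1 - q8)\<^sup>2 / (2 * V)"
  show ?thesis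
  proof (cases "16 \<le> y")
    case False
    hence "1 \<le> exp 16 * exp (- y)" by (simp add: exp_add[symmetric])
    thus ?thesis unfolding y_def[symmetric] using prob_le_1 order_trans by blast
  next
    case True
    \<comment> \<open>The level is \<open>n - m\<close>, as \<open>m\<close> counts from the finest
      scale; the shares form a geometric series with sum at most \<open>x\<close>.\<close>
    define t where "t m = x * (1 - q8) * q8 ^ (n - m)" for m
    have t0: "0 \<le> t m" for m using x q8 by (simp add: t_def)
    have "(\<Sum>m\<le>n. t m) = x * (1 - q8) * (\<Sum>m\<le>n. q8 ^ (n - m))" by (simp add: t_def sum_distrib_left)
    also have "(\<Sum>m\<le>n. q8 ^ (n - m)) = (\<Sum>l\<le>n. q8 ^ l)"
      by (rule sum.reindex_bij_witness[of _ "\<lambda>l. n - l" "\<lambda>l. n - l"]) auto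
    also have "x * (1 - q8) * (\<Sum>l\<le>n. q8 ^ l) = x * (1 - q8 ^ Suc n)"
      using q8 by (simp add: sum_gp0)
    also have "\<dots> \<le> x" using x q8 by (simp add: mult_left_le)
    finally have tsum: "(\<Sum>m\<le>n. t m) \<le> x" .
    define E where "E m j = {\<omega> \<in> space M. Y (Suc j * 2 ^ m) \<omega> - Y (j * 2 ^ m) \<omega> > t m}" for m j
    have le2: "Suc j * 2 ^ m \<le> 2 ^ n" if "m \<le> n" "j < 2 ^ (n - m)" for m j
    proof -
      have "Suc j * 2 ^ m \<le> 2 ^ (n - m) * 2 ^ m" using that by (intro mult_right_mono) auto
      also have "\<dots> = (2::nat) ^ n" using that by (simp add: power_add[symmetric])
      finally show ?thesis .
    qed
    have EP: "E m j \<in> events \<and> prob (E m j) \<le> exp (- y * (1 + real (n - m) / 8))" if mj: "m \<le> n" "j < 2 ^ (n - m)" for m j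
    proof -
      have le: "Suc j * 2 ^ m \<le> 2 ^ n" using le2[OF mj] .
      hence "j * 2 ^ m \<le> 2 ^ n" by (rule order_trans[rotated]) simp
      have D: "(\<lambda>\<omega>. Y (Suc j * 2 ^ m) \<omega> - Y (j * 2 ^ m) \<omega>) \<in> H"
        using Y[OF le] Y[OF \<open>j * 2 ^ m \<le> 2 ^ n\<close>] by (rule diff_mem)
      have "incr_var (Y (Suc j * 2 ^ m)) (Y (j * 2 ^ m)) \<le> V * sqrt (real (Suc j * 2 ^ m - j * 2 ^ m) / 2 ^ n)"
        by (intro inc le) simp
      also have "\<dots> = V * q8 ^ (4 * (n - m))" using sqrt_dyadic[OF mj(1)] by simp
      finally have v: "incr_var (Y (Suc j * 2 ^ m)) (Y (j * 2 ^ m)) \<le> V * q8 ^ (4 * (n - m))" .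
      have "prob (E m j) \<le> exp (- (t m)\<^sup>2 / (2 * (V * q8 ^ (4 * (n - m)))))"
        unfolding E_def using V q8 t0 by (intro prob_gt_le[OF D v]) auto
      also have "(t m)\<^sup>2 / (2 * (V * q8 ^ (4 * (n - m)))) = y * (1 / q8 ^ (2 * (n - m)))"
      proof -
        define Q where "Q = q8 ^ (2 * (n - m))"
        define p where "p = x\<^sup>2 * (1 - q8)\<^sup>2"
        have "(q8 ^ (n - m))\<^sup>2 = Q" by (simp add: power_mult[symmetric] mult.commute Q_def)
        hence t: "(t m)\<^sup>2 = p * Q" by (simp only: t_def power_mult_distrib p_def)
        have 4: "q8 ^ (4 * (n - m)) = Q * Q" by (simp add: power_add[symmetric] Q_def)
        have "Q > 0" using q8 by (simp add: Q_def)
        thus ?thesis unfolding t 4 y_def p_def[symmetric] Q_def[symmetric] using V by (simp add: field_simps)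
      qed
      hence "- (t m)\<^sup>2 / (2 * (V * q8 ^ (4 * (n - m)))) = - (y * (1 / q8 ^ (2 * (n - m))))" by simp
      also have "\<dots> \<le> - y * (1 + real (n - m) / 8)"
        using mult_left_mono[OF q8_growth[of "n - m"], of y] True by simp
      finally have "prob (E m j) \<le> exp (- y * (1 + real (n - m) / 8))" by simp
      moreover have "E m j \<in> events" unfolding E_def using measurable_mem[OF D] by measurable
      ultimately show ?thesis by blast
    qed
    have sub: "{\<omega> \<in> space M. \<exists>i\<le>2 ^ n. Y i \<omega> > x} \<subseteq> (\<Union>m\<le>n. \<Union>j<2 ^ (n - m). E m j)"
    proof (rule subsetI, rule ccontr)
      fix \<omega> assume w: "\<omega> \<in> {\<omega> \<in> space M. \<exists>i\<le>2 ^ n. Y i \<omega> > x}" and nE: "\<omega> \<notin> (\<Union>m\<le>n. \<Union>j<2 ^ (n - m). E m j)"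
      then obtain i where i: "i \<le> 2 ^ n" "Y i \<omega> > x" and sp: "\<omega> \<in> space M" by auto
      have "Y i \<omega> \<le> Y 0 \<omega> + (\<Sum>m\<le>n. t m)"
      proof (rule dyadic_chain_bound[OF _ t0 i(1)])
        fix m j assume mj: "m \<le> n" "Suc j * 2 ^ m \<le> 2 ^ n"
        have "Suc j \<le> 2 ^ (n - m)"
        proof (rule ccontr)
          assume "\<not> Suc j \<le> 2 ^ (n - m)"
          hence "2 ^ (n - m) * 2 ^ m < Suc j * 2 ^ m" by (intro mult_strict_right_mono) (auto simp: not_le)
          moreover have "2 ^ (n - m) * 2 ^ m = (2::nat) ^ n" using mj(1) by (simp add: power_add[symmetric])
          ultimately show False using mj(2) by linarith
        qed
        thus "Y (Suc j * 2 ^ m) \<omega> - Y (j * 2 ^ m) \<omega> \<le> t m"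
          using nE mj(1) sp unfolding E_def by (auto simp: not_less)
      qed
      thus False using tsum i(2) Y0 by simp
    qed
    have Eu: "(\<Union>j<2 ^ (n - m). E m j) \<in> events" if "m \<le> n" for m
      using EP that by (intro sets.finite_UN) auto
    have Eu2: "(\<Union>m\<le>n. \<Union>j<2 ^ (n - m). E m j) \<in> events"
      by (rule sets.finite_UN[OF finite_atMost]) (use Eu in auto)
    have "prob {\<omega> \<in> space M. \<exists>i\<le>2 ^ n. Y i \<omega> > x} \<le> prob (\<Union>m\<le>n. \<Union>j<2 ^ (n - m). E m j)"
      using sub Eu2 by (rule finite_measure_mono)
    also have "\<dots> \<le> (\<Sum>m\<le>n. prob (\<Union>j<2 ^ (n - m). E m j))"
      using Eu by (intro finite_measure_subadditive_finite) auto
    also have "\<dots> \<le> (\<Sum>m\<le>n. \<Sum>j<2 ^ (n - m). prob (E m j))"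
      using EP by (intro sum_mono finite_measure_subadditive_finite) auto
    also have "\<dots> \<le> (\<Sum>m\<le>n. \<Sum>j<2 ^ (n - m)::nat. exp (- y * (1 + real (n - m) / 8)))"
      using EP by (intro sum_mono) auto
    also have "\<dots> = (\<Sum>m\<le>n. 2 ^ (n - m) * exp (- y * (1 + real (n - m) / 8)))"
      by simp
    also have "\<dots> = (\<Sum>l\<le>n. 2 ^ l * exp (- y * (1 + real l / 8)))"
      by (rule sum.reindex_bij_witness[of _ "\<lambda>l. n - l" "\<lambda>l. n - l"]) auto
    also have "\<dots> \<le> exp 16 * exp (- y)" using True by (rule chain_series_le)
    finally show ?thesis unfolding y_def .
  qed
qed

end

section \<open>Conditioning on a Gaussian variable\<close>

text \<open>
  \<open>F\<close> stands for \<open>u(s\<^sub>0, y\<^sub>0)\<close>, \<open>X i\<close> for the increment of \<open>u(\<cdot>, y\<^sub>0)\<close> from \<open>s\<^sub>0\<close> to the dyadic time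
  \<open>s\<^sub>0 + \<delta>\<^sub>1 i / 2 ^ N\<close>, so that \<open>F + X (2 ^ N)\<close> is the value at the final time, and \<open>\<beta> = \<delta>\<^sub>1\<^bsup>1/4\<^esup>\<close>.
\<close>

locale gaussian_grid = gaussian_space M H for M :: "'w measure" and H :: "('w \<Rightarrow> real) set" +
  fixes F :: "'w \<Rightarrow> real" and X :: "nat \<Rightarrow> 'w \<Rightarrow> real" and N :: nat and \<beta> vmin vmax K k1 \<kappa>0 :: real
  assumes F: "F \<in> H" and X: "\<And>i. i \<le> 2 ^ N \<Longrightarrow> X i \<in> H" and X0: "X 0 = (\<lambda>_. 0)"
    and pos: "0 < vmin" "0 < K" "0 < k1" "0 < \<kappa>0" "0 < \<beta>" "\<beta> \<le> 1"
    and var: "vmin \<le> ip F F" "ip F F \<le> vmax"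
    and incr: "\<And>i j. i \<le> j \<Longrightarrow> j \<le> 2 ^ N \<Longrightarrow> incr_var (X j) (X i) \<le> K * \<beta>\<^sup>2 * sqrt (real (j - i) / 2 ^ N)"
    and neg_corr: "\<And>i. i \<le> 2 ^ N \<Longrightarrow> ip (X i) F \<le> - (k1 * \<beta>\<^sup>2 * sqrt (real i / 2 ^ N))"
    and end_corr: "\<And>i. i \<le> 2 ^ N \<Longrightarrow> 0 \<le> ip (X i) F + ip (X i) (X (2 ^ N))"
    and end_base: "\<kappa>0 \<le> ip F F + ip (X (2 ^ N)) F"
begin

text \<open>Not a conditional expectation: the residual of \<open>Z\<close> after orthogonal
  projection on \<open>D\<close>, which for Gaussian variables is the part of \<open>Z\<close>
  independent of \<open>D\<close>.\<close>

definition cond :: "('w \<Rightarrow> real) \<Rightarrow> ('w \<Rightarrow> real) \<Rightarrow> 'w \<Rightarrow> real" where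
  "cond D Z = (\<lambda>\<omega>. Z \<omega> - ip Z D / ip D D * D \<omega>)"

lemma cond_mem: "D \<in> H \<Longrightarrow> Z \<in> H \<Longrightarrow> cond D Z \<in> H"
  unfolding cond_def by (rule diff_mem[OF _ scale_mem])

lemma ip_cond: "D \<in> H \<Longrightarrow> Z \<in> H \<Longrightarrow> Y \<in> H \<Longrightarrow> ip (cond D Z) Y = ip Z Y - ip Z D * ip D Y / ip D D"
  unfolding cond_def by (simp only: ip_diff scale_mem ip_scale) (simp only: times_divide_eq_left)

lemma cond_orth: "D \<in> H \<Longrightarrow> Z \<in> H \<Longrightarrow> 0 < ip D D \<Longrightarrow> ip (cond D Z) D = 0"
  by (simp add: ip_cond)

lemma cond_diff: "D \<in> H \<Longrightarrow> Z \<in> H \<Longrightarrow> Y \<in> H \<Longrightarrow> (\<lambda>\<omega>. cond D Z \<omega> - cond D Y \<omega>) = cond D (\<lambda>\<omega>. Z \<omega> - Y \<omega>)"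
  unfolding cond_def by (subst ip_diff) (auto simp: fun_eq_iff algebra_simps diff_divide_distrib)

lemma cond_self_le: 
  assumes "D \<in> H" "Z \<in> H" "0 < ip D D"
  shows "ip (cond D Z) (cond D Z) \<le> ip Z Z"
proof -
  have c: "cond D Z \<in> H" using assms by (simp add: cond_mem)
  have "ip (cond D Z) (cond D Z) = ip Z (cond D Z) - ip Z D * ip D (cond D Z) / ip D D"
    using assms c by (simp add: ip_cond)
  also have "ip D (cond D Z) = 0" using cond_orth[OF assms] by (simp add: ip_commute)
  also have "ip Z (cond D Z) = ip Z Z - ip Z D * ip D Z / ip D D" using ip_cond[OF assms(1,2,2)] by (simp add: ip_commute)
  finally have "ip (cond D Z) (cond D Z) = ip Z Z - ip Z D * ip Z D / ip D D" by (simp add: ip_commute[of D Z])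
  moreover have "0 \<le> ip Z D * ip Z D / ip D D" using assms(3) by simp
  ultimately show ?thesis by linarith
qed

lemma cond_zero: "cond D (\<lambda>_. 0) = (\<lambda>_. 0)"
  by (simp add: cond_def ip_zero)

lemma FF: "0 < ip F F" using pos var by linarith

definition Y0 :: "nat \<Rightarrow> 'w \<Rightarrow> real" where "Y0 i = cond F (X i)"

lemma Y0_mem: "i \<le> 2 ^ N \<Longrightarrow> Y0 i \<in> H" unfolding Y0_def using F X by (simp add: cond_mem)

lemma Y0_orth: "i \<le> 2 ^ N \<Longrightarrow> ip (Y0 i) F = 0"
  unfolding Y0_def using F X FF by (simp add: cond_orth)

lemma Y0_incr:
  assumes "i \<le> j" "j \<le> 2 ^ N"
  shows "incr_var (Y0 j) (Y0 i) \<le> K * \<beta>\<^sup>2 * sqrt (real (j - i) / 2 ^ N)"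
proof -
  have "X i \<in> H" "X j \<in> H" using assms X by auto
  thus ?thesis unfolding Y0_def
    using cond_self_le[OF F diff_mem FF, of "X j" "X i"] incr[OF assms] by (simp add: cond_diff[OF F])
qed

lemma X_self_le: assumes "i \<le> 2 ^ N" shows "ip (X i) (X i) \<le> K * \<beta>\<^sup>2"
proof -
  have "ip (X i) (X i) \<le> K * \<beta>\<^sup>2 * sqrt (real i / 2 ^ N)" using incr[of 0 i] assms by (simp add: X0)
  also have "real i \<le> real (2 ^ N)" using assms by (simp only: of_nat_le_iff)
  hence "K * \<beta>\<^sup>2 * sqrt (real i / 2 ^ N) \<le> K * \<beta>\<^sup>2 * 1" using pos by (intro mult_left_mono) auto
  finally show ?thesis by simp
qed

lemma prob_independent_of_F:
  assumes "finite I" "\<And>i. i \<in> I \<Longrightarrow> Y i \<in> H" "\<And>i. i \<in> I \<Longrightarrow> ip F (Y i) = 0"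
  shows "prob {\<omega> \<in> space M. F \<omega> \<in> {a..b} \<and> (\<forall>i\<in>I. Y i \<omega> \<le> y i)} = prob {\<omega> \<in> space M. F \<omega> \<in> {a..b}} * prob {\<omega> \<in> space M. \<forall>i\<in>I. Y i \<omega> \<le> y i}"
  using indep_orthogonal[OF F assms(1) assms(2) assms(3), where A = "{a..b}" and B = "\<lambda>i. {..y i}"] by simp

lemma sets_all_le:
  assumes "finite I" "\<And>i. i \<in> I \<Longrightarrow> Y i \<in> H"
  shows "{\<omega> \<in> space M. \<forall>i\<in>I. Y i \<omega> \<le> y i} \<in> sets M"
proof (rule sets.sets_Collect_finite_All[OF _ assms(1)])
  fix i assume "i \<in> I"
  hence [measurable]: "Y i \<in> borel_measurable M" using assms measurable_mem by simp
  show "{\<omega> \<in> space M. Y i \<omega> \<le> y i} \<in> sets M" by measurable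
qed

lemma sets_strip:
  assumes "\<And>i. i \<le> n \<Longrightarrow> Y i \<in> H"
  shows "{\<omega> \<in> space M. F \<omega> \<in> {a..b} \<and> (\<forall>i\<le>n::nat. Y i \<omega> \<le> z)} \<in> sets M"
proof -
  have [measurable]: "F \<in> borel_measurable M" using F measurable_mem by simp
  have [measurable]: "{\<omega> \<in> space M. \<forall>i\<in>{..n}. Y i \<omega> \<le> z} \<in> sets M" by (rule sets_all_le) (use assms in auto)
  have "{\<omega> \<in> space M. F \<omega> \<in> {a..b} \<and> (\<forall>i\<le>n. Y i \<omega> \<le> z)} = {\<omega> \<in> space M. F \<omega> \<in> {a..b}} \<inter> {\<omega> \<in> space M. \<forall>i\<in>{..n}. Y i \<omega> \<le> z}" by auto
  thus ?thesis by simp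
qed

lemma prob_all_le_ge:
  assumes "\<And>i. i \<le> 2 ^ n \<Longrightarrow> Y i \<in> H" "Y 0 = (\<lambda>_. 0)" "0 < V" "0 \<le> x"
    and "\<And>i j. i \<le> j \<Longrightarrow> j \<le> 2 ^ n \<Longrightarrow> incr_var (Y j) (Y i) \<le> V * sqrt (real (j - i) / 2 ^ n)"
  shows "1 - exp 16 * exp (- (x\<^sup>2 * (1 - q8)\<^sup>2 / (2 * V))) \<le> prob {\<omega> \<in> space M. \<forall>i\<in>{..2 ^ n}. Y i \<omega> \<le> x}"
proof -
  have "{\<omega> \<in> space M. \<forall>i\<in>{..2 ^ n}. Y i \<omega> \<le> x} \<in> sets M" by (rule sets_all_le) (use assms in auto)
  from prob_compl[OF this]
  have "prob (space M - {\<omega> \<in> space M. \<forall>i\<in>{..2 ^ n}. Y i \<omega> \<le> x}) = 1 - prob {\<omega> \<in> space M. \<forall>i\<in>{..2 ^ n}. Y i \<omega> \<le> x}" .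
  also have "space M - {\<omega> \<in> space M. \<forall>i\<in>{..2 ^ n}. Y i \<omega> \<le> x} = {\<omega> \<in> space M. \<exists>i\<le>2 ^ n. Y i \<omega> > x}"
    by (force simp: not_le)
  finally show ?thesis using chaining[OF assms] by simp
qed

text \<open>By Cauchy-Schwarz the regression coefficient of \<open>X i\<close> on \<open>F\<close>
  is at most \<open>sqrt (K / vmin) * \<beta>\<close> in modulus, so \<open>F\<close> contributes at
  most \<open>w / 2\<close> as long as its modulus is at most \<open>z\<close>. Chaining keeps the
  residuals \<open>Y0 i\<close>, which are independent of \<open>F\<close>, below the other
  half.\<close>

lemma strip_prob_moderate:
  assumes ab: "\<bar>a\<bar> \<le> z" "\<bar>b\<bar> \<le> z" and w: "0 \<le> w" and small: "sqrt (K / vmin) * \<beta> * z \<le> w / 2"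
  shows "prob {\<omega> \<in> space M. F \<omega> \<in> {a..b}} * (1 - exp 16 * exp (- ((w / 2)\<^sup>2 * (1 - q8)\<^sup>2 / (2 * (K * \<beta>\<^sup>2)))))
    \<le> prob {\<omega> \<in> space M. F \<omega> \<in> {a..b} \<and> (\<forall>i\<le>2 ^ N. X i \<omega> \<le> w)}"
proof -
  have rho: "\<bar>ip (X i) F / ip F F\<bar> * z \<le> w / 2" if i: "i \<le> 2 ^ N" for i
  proof -
    have "(ip (X i) F / ip F F)\<^sup>2 \<le> ip (X i) (X i) * ip F F / (ip F F)\<^sup>2"
      using Cauchy_Schwarz[OF X[OF i] F] by (simp add: power_divide divide_right_mono)
    also have "\<dots> = ip (X i) (X i) / ip F F" using FF by (simp add: power2_eq_square)
    also have "\<dots> \<le> K * \<beta>\<^sup>2 / vmin" using X_self_le[OF i] pos var FF by (intro frac_le) (auto simp: ip_self_nonneg)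
    also have "\<dots> = (sqrt (K / vmin) * \<beta>)\<^sup>2" using pos by (simp add: power_mult_distrib)
    finally have "\<bar>ip (X i) F / ip F F\<bar> \<le> sqrt (K / vmin) * \<beta>" using pos by (simp add: abs_le_square_iff[symmetric])
    hence "\<bar>ip (X i) F / ip F F\<bar> * z \<le> sqrt (K / vmin) * \<beta> * z" using ab by (intro mult_right_mono) auto
    thus ?thesis using small by linarith
  qed
  have sub: "{\<omega> \<in> space M. F \<omega> \<in> {a..b} \<and> (\<forall>i\<in>{..2 ^ N}. Y0 i \<omega> \<le> w / 2)} \<subseteq> {\<omega> \<in> space M. F \<omega> \<in> {a..b} \<and> (\<forall>i\<le>2 ^ N. X i \<omega> \<le> w)}"
  proof (intro subsetI CollectI conjI allI impI)
    fix \<omega> and i :: nat assume w1: "\<omega> \<in> {\<omega> \<in> space M. F \<omega> \<in> {a..b} \<and> (\<forall>i\<in>{..2 ^ N}. Y0 i \<omega> \<le> w / 2)}" and i: "i \<le> 2 ^ N"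
    have "X i \<omega> = Y0 i \<omega> + ip (X i) F / ip F F * F \<omega>" by (simp add: Y0_def cond_def)
    also have "\<dots> \<le> w / 2 + \<bar>ip (X i) F / ip F F\<bar> * \<bar>F \<omega>\<bar>"
    proof (intro add_mono)
      show "Y0 i \<omega> \<le> w / 2" using w1 i by auto
      show "ip (X i) F / ip F F * F \<omega> \<le> \<bar>ip (X i) F / ip F F\<bar> * \<bar>F \<omega>\<bar>" by (metis abs_ge_self abs_mult)
    qed
    also have "\<dots> \<le> w / 2 + \<bar>ip (X i) F / ip F F\<bar> * z"
      using w1 ab by (intro add_mono mult_left_mono) auto
    also have "\<dots> \<le> w" using rho[OF i] by linarith
    finally show "X i \<omega> \<le> w" .
  qed auto
  have "prob {\<omega> \<in> space M. F \<omega> \<in> {a..b}} * (1 - exp 16 * exp (- ((w / 2)\<^sup>2 * (1 - q8)\<^sup>2 / (2 * (K * \<beta>\<^sup>2))))) 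
    \<le> prob {\<omega> \<in> space M. F \<omega> \<in> {a..b}} * prob {\<omega> \<in> space M. \<forall>i\<in>{..2 ^ N}. Y0 i \<omega> \<le> w / 2}"
  proof (intro mult_left_mono prob_all_le_ge)
    show "Y0 0 = (\<lambda>_. 0)" by (simp add: Y0_def X0 cond_zero)
  qed (use Y0_mem pos w Y0_incr in auto)
  also have "\<dots> = prob {\<omega> \<in> space M. F \<omega> \<in> {a..b} \<and> (\<forall>i\<in>{..2 ^ N}. Y0 i \<omega> \<le> w / 2)}"
    using Y0_mem Y0_orth by (subst prob_independent_of_F) (auto simp: ip_commute[of F])
  also have "\<dots> \<le> prob {\<omega> \<in> space M. F \<omega> \<in> {a..b} \<and> (\<forall>i\<le>2 ^ N. X i \<omega> \<le> w)}"
    using sub sets_strip[of "2 ^ N" X] X by (intro finite_measure_mono) auto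
  finally show ?thesis .
qed

text \<open>\<open>X i\<close> splits into a multiple of \<open>F\<close>, a nonnegative multiple
  \<open>al i\<close> of the normalised residual \<open>D / d\<close> of the final value, and a
  remainder \<open>Y i\<close>, the three parts being independent. Where
  \<open>D / d \<le> - m\<close>, the first two parts add up to at most \<open>- al i * R\<close>.
  Beyond the initial block of the grid this outweighs \<open>Y i \<le> A * \<beta>\<close>; in the
  block the variance of \<open>Y i\<close> is so small that
  \<open>Y i \<le> \<beta> / 2 \<le> w\<close> is likely.\<close>

lemma strip_prob_lower:
  assumes ab: "\<bar>a\<bar> \<le> z" "\<bar>b\<bar> \<le> z" and w: "\<beta> / 2 \<le> w" and m0: "m0 \<le> N" and R: "0 \<le> R" and A: "0 \<le> A"
    and small1: "exp 16 * exp (- ((1 - q8)\<^sup>2 / (8 * K * q8 ^ (4 * m0)))) \<le> 1 / 4"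
    and small2: "exp 16 * exp (- (A\<^sup>2 * (1 - q8)\<^sup>2 / (2 * K))) \<le> 1 / 4"
    and RA: "A \<le> R * (\<kappa>0 / vmax) * k1 * q8 ^ (4 * m0) / sqrt K"
  shows "prob {\<omega> \<in> space M. F \<omega> \<in> {a..b}} * (exp (- (z * sqrt K / \<kappa>0 + R)\<^sup>2 - 1) / sqrt (2 * pi) * (1 / 2))
    \<le> prob {\<omega> \<in> space M. F \<omega> \<in> {a..b} \<and> (\<forall>i\<le>2 ^ N. X i \<omega> \<le> w)}"
proof -
  define D where "D = Y0 (2 ^ N)"
  have D: "D \<in> H" by (simp add: D_def Y0_mem)
  have DF: "ip D F = 0" unfolding D_def by (simp add: Y0_orth)
  have YD: "ip (Y0 i) D = ip (X i) D" if i: "i \<le> 2 ^ N" for i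
    unfolding Y0_def using ip_cond[OF F X[OF i] D] DF by (simp add: ip_commute)
  have z0: "0 \<le> z" using ab by linarith
  define V where "V = ip F F"
  \<comment> \<open>The regression coefficient on \<open>F\<close> of the final value
    \<open>F + X (2 ^ N)\<close>; \<open>D\<close> is the residual of this value too, because the
    residual of \<open>F\<close> itself vanishes.\<close>
  define \<kappa> where "\<kappa> = (ip F F + ip (X (2 ^ N)) F) / V"
  have V: "0 < V" "V \<le> vmax" using FF var by (auto simp: V_def)
  have \<kappa>V: "\<kappa>0 \<le> \<kappa> * V" using end_base V by (simp add: \<kappa>_def)
  have \<kappa>: "\<kappa>0 / vmax \<le> \<kappa>"
  proof -
    have "\<kappa>0 / vmax \<le> \<kappa>0 / V" using V pos by (intro divide_left_mono) auto
    also have "\<dots> \<le> \<kappa>" using \<kappa>V V by (simp add: field_simps)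
    finally show ?thesis .
  qed
  have "0 < \<kappa>0 / vmax" using pos V by simp
  hence \<kappa>0: "0 < \<kappa>" using \<kappa> by linarith
  have XF: "0 \<le> - ip (X i) F" if "i \<le> 2 ^ N" for i
  proof -
    have "0 \<le> k1 * \<beta>\<^sup>2 * sqrt (real i / 2 ^ N)" using pos by simp
    thus ?thesis using neg_corr[OF that] by linarith
  qed
  \<comment> \<open>The covariance of \<open>X i\<close> with \<open>D\<close> is that with the
    final value, nonnegative by \<open>end_corr\<close>, minus \<open>\<kappa>\<close> times the
    negative covariance with \<open>F\<close>.\<close>
  have XD: "\<kappa> * (- ip (X i) F) \<le> ip (X i) D" if i: "i \<le> 2 ^ N" for i
  proof -
    have "ip (X i) D = ip D (X i)" by (rule ip_commute)
    also have "\<dots> = ip (X (2 ^ N)) (X i) - ip (X (2 ^ N)) F * ip F (X i) / V"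
      unfolding D_def Y0_def V_def using F X i by (simp add: ip_cond)
    also have "\<dots> = (ip (X i) (X (2 ^ N)) + ip (X i) F) + \<kappa> * (- ip (X i) F)"
    proof -
      have e: "ip F (X i) = ip (X i) F" "ip (X (2 ^ N)) (X i) = ip (X i) (X (2 ^ N))" by (rule ip_commute)+
      have \<kappa>e: "\<kappa> = 1 + ip (X (2 ^ N)) F / V" using V by (simp add: \<kappa>_def V_def add_divide_distrib)
      show ?thesis unfolding e \<kappa>e by (simp add: algebra_simps)
    qed
    finally show ?thesis using end_corr[OF i] by linarith
  qed
  define d2 where "d2 = ip D D"
  have d2: "d2 = ip (X (2 ^ N)) D" using YD[of "2 ^ N"] by (simp add: d2_def D_def)
  have "0 < \<kappa> * (k1 * \<beta>\<^sup>2)" using \<kappa>0 pos by simp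
  also have "\<dots> \<le> \<kappa> * (- ip (X (2 ^ N)) F)" using neg_corr[of "2 ^ N"] \<kappa>0 by (intro mult_left_mono) auto
  also have "\<dots> \<le> d2" unfolding d2 by (rule XD) simp
  finally have d2p: "0 < d2" .
  have "d2 \<le> ip (X (2 ^ N)) (X (2 ^ N))" unfolding d2_def D_def Y0_def using F X FF by (intro cond_self_le) auto
  also have "\<dots> \<le> K * \<beta>\<^sup>2" by (rule X_self_le) simp
  finally have d2K: "d2 \<le> K * \<beta>\<^sup>2" .
  define d where "d = sqrt d2"
  have d: "0 < d" "d * d = d2" using d2p by (auto simp: d_def)
  have "d \<le> sqrt (K * \<beta>\<^sup>2)" unfolding d_def using d2K by simp
  also have "\<dots> = sqrt K * \<beta>" using pos by (simp add: real_sqrt_mult)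
  finally have dK: "d \<le> sqrt K * \<beta>" .
  define al where "al i = ip (X i) D / d" for i
  have al_ge: "\<kappa> * (- ip (X i) F) / d \<le> al i" if "i \<le> 2 ^ N" for i
    unfolding al_def using XD[OF that] d by (intro divide_right_mono) auto
  have al0: "0 \<le> al i" if "i \<le> 2 ^ N" for i
  proof -
    have "0 \<le> \<kappa> * (- ip (X i) F) / d" using XF[OF that] \<kappa>0 d by (intro divide_nonneg_pos mult_nonneg_nonneg) auto
    thus ?thesis using al_ge[OF that] by linarith
  qed
  define Y where "Y i = cond D (Y0 i)" for i
  have Ymem: "Y i \<in> H" if "i \<le> 2 ^ N" for i unfolding Y_def using D Y0_mem[OF that] by (rule cond_mem)
  have YincK: "incr_var (Y j) (Y i) \<le> K * \<beta>\<^sup>2 * sqrt (real (j - i) / 2 ^ N)" if ij: "i \<le> j" "j \<le> 2 ^ N" for i j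
  proof -
    have "Y0 i \<in> H" "Y0 j \<in> H" using ij Y0_mem by auto
    thus ?thesis unfolding Y_def
      using cond_self_le[OF D diff_mem d2p[unfolded d2_def], of "Y0 j" "Y0 i"] Y0_incr[OF ij] by (simp add: cond_diff[OF D])
  qed
  have Yz: "Y 0 = (\<lambda>_. 0)" by (simp add: Y_def Y0_def X0 cond_zero)
  have Yorth: "ip (Y i) D = 0" "ip (Y i) F = 0" if i: "i \<le> 2 ^ N" for i
    unfolding Y_def using cond_orth[OF D Y0_mem[OF i]] d2p ip_cond[OF D Y0_mem[OF i] F] Y0_orth[OF i] DF by (auto simp: d2_def)
  have dec: "X i \<omega> = ip (X i) F / V * F \<omega> + al i * (D \<omega> / d) + Y i \<omega>" if i: "i \<le> 2 ^ N" for i \<omega>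
  proof -
    have "X i \<omega> = Y0 i \<omega> + ip (X i) F / V * F \<omega>" by (simp add: Y0_def cond_def V_def)
    moreover have "Y0 i \<omega> = Y i \<omega> + ip (Y0 i) D / d2 * D \<omega>" by (simp add: Y_def cond_def d2_def)
    moreover have "ip (Y0 i) D / d2 * D \<omega> = al i * (D \<omega> / d)" using YD[OF i] d by (simp add: al_def field_simps)
    ultimately show ?thesis by simp
  qed
  \<comment> \<open>The first summand cancels the contribution of \<open>F\<close>, the second
    leaves the margin \<open>al i * R\<close>; see \<open>push\<close>.\<close>
  define m where "m = z * sqrt K / \<kappa>0 + R"
  have m0': "0 \<le> m" using z0 pos R by (simp add: m_def)
  have push: "\<bar>ip (X i) F / V\<bar> * z + al i * R \<le> al i * m" if i: "i \<le> 2 ^ N" for i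
  proof -
    have "\<bar>ip (X i) F / V\<bar> = - ip (X i) F / V" using XF[OF i] V by (simp add: abs_if divide_less_0_iff)
    also have "\<dots> \<le> al i * (sqrt K / \<kappa>0)"
    proof -
      have "- ip (X i) F / V * \<kappa>0 \<le> - ip (X i) F / V * (\<kappa> * V)" using \<kappa>V XF[OF i] V by (intro mult_left_mono divide_nonneg_pos) auto
      also have "\<dots> = \<kappa> * (- ip (X i) F) / d * d" using V d by simp
      also have "\<dots> \<le> al i * d" using al_ge[OF i] d by (intro mult_right_mono) auto
      also have "\<dots> \<le> al i * sqrt K" 
      proof (intro mult_left_mono al0 i)
        have "sqrt K * \<beta> \<le> sqrt K * 1" using pos by (intro mult_left_mono) auto
        thus "d \<le> sqrt K" using dK by simp
      qed
      finally show ?thesis using pos by (simp add: field_simps)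
    qed
    finally have "\<bar>ip (X i) F / V\<bar> * z \<le> al i * (sqrt K / \<kappa>0) * z" using z0 by (rule mult_right_mono)
    thus ?thesis by (simp add: m_def algebra_simps)
  qed
  \<comment> \<open>Beyond the initial block \<open>neg_corr\<close> bounds \<open>al i\<close>
    below by a multiple of \<open>\<beta>\<^sup>2 / d\<close>, and
    \<open>d \<le> sqrt K * \<beta>\<close> leaves a multiple of \<open>\<beta>\<close>.\<close>
  have alA: "A * \<beta> \<le> al i * R" if i: "i \<le> 2 ^ N" "2 ^ (N - m0) \<le> i" for i
  proof -
    have "q8 ^ (4 * m0) = sqrt (2 ^ (N - m0) / 2 ^ N)" using sqrt_dyadic[of "N - m0" N] m0 by simp
    also have "\<dots> \<le> sqrt (real i / 2 ^ N)"
    proof (intro real_sqrt_le_mono divide_right_mono)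
      have "real (2 ^ (N - m0)) \<le> real i" using i(2) by (simp only: of_nat_le_iff)
      thus "2 ^ (N - m0) \<le> real i" by simp
    qed simp
    finally have qi: "q8 ^ (4 * m0) \<le> sqrt (real i / 2 ^ N)" .
    have "A * \<beta> \<le> (R * (\<kappa>0 / vmax) * k1 * q8 ^ (4 * m0) / sqrt K) * \<beta>" using RA pos by (intro mult_right_mono) auto
    also have "\<dots> = R * ((\<kappa>0 / vmax) * (k1 * \<beta>\<^sup>2 * q8 ^ (4 * m0)) / (sqrt K * \<beta>))" using pos by (simp add: field_simps power2_eq_square)
    also have "\<dots> \<le> R * (\<kappa> * (- ip (X i) F) / d)"
    proof (intro mult_left_mono frac_le mult_mono R)
      have "k1 * \<beta>\<^sup>2 * q8 ^ (4 * m0) \<le> k1 * \<beta>\<^sup>2 * sqrt (real i / 2 ^ N)" using qi pos by (intro mult_left_mono) auto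
      also have "\<dots> \<le> - ip (X i) F" using neg_corr[OF i(1)] by linarith
      finally show "k1 * \<beta>\<^sup>2 * q8 ^ (4 * m0) \<le> - ip (X i) F" .
    qed (use \<kappa> \<kappa>0 dK d pos q8 XF[OF i(1)] mult_nonneg_nonneg[OF less_imp_le[OF \<kappa>0] XF[OF i(1)]] in auto)
    also have "\<dots> \<le> R * al i" using al_ge[OF i(1)] R by (intro mult_left_mono) auto
    finally show ?thesis by (simp add: mult.commute)
  qed
  define I1 where "I1 = {..(2::nat) ^ (N - m0)}"
  define I2 where "I2 = {..(2::nat) ^ N}"
  define E1 where "E1 = {\<omega> \<in> space M. \<forall>i\<in>I1. Y i \<omega> \<le> \<beta> / 2}"
  define E2 where "E2 = {\<omega> \<in> space M. \<forall>i\<in>I2. Y i \<omega> \<le> A * \<beta>}"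
  have N0: "(2::nat) ^ (N - m0) \<le> 2 ^ N" by (intro power_increasing) auto
  \<comment> \<open>The block is itself a dyadic grid, with \<open>N - m0\<close> levels; its
    shorter length lowers the variance constant by the factor \<open>q8 ^ (4 * m0)\<close>.\<close>
  have P1: "3 / 4 \<le> prob E1"
  proof -
    have "1 - exp 16 * exp (- ((\<beta> / 2)\<^sup>2 * (1 - q8)\<^sup>2 / (2 * (K * \<beta>\<^sup>2 * q8 ^ (4 * m0))))) \<le> prob E1"
      unfolding E1_def I1_def
    proof (rule prob_all_le_ge)
      show "Y i \<in> H" if "i \<le> 2 ^ (N - m0)" for i using order_trans[OF that N0] by (rule Ymem)
      show "0 < K * \<beta>\<^sup>2 * q8 ^ (4 * m0)" using pos q8 by simp
      fix i j :: nat assume ij: "i \<le> j" "j \<le> 2 ^ (N - m0)"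
      have "incr_var (Y j) (Y i) \<le> K * \<beta>\<^sup>2 * sqrt (real (j - i) / 2 ^ N)"
        by (intro YincK ij(1) order_trans[OF ij(2) N0])
      also have "real (j - i) / 2 ^ N = (2 ^ (N - m0) / 2 ^ N) * (real (j - i) / 2 ^ (N - m0))" by simp
      also have "sqrt \<dots> = q8 ^ (4 * m0) * sqrt (real (j - i) / 2 ^ (N - m0))"
        using sqrt_dyadic[of "N - m0" N] m0 by (simp only: real_sqrt_mult) simp
      finally show "incr_var (Y j) (Y i) \<le> K * \<beta>\<^sup>2 * q8 ^ (4 * m0) * sqrt (real (j - i) / 2 ^ (N - m0))"
        by (simp add: mult.assoc)
    qed (use Yz pos in auto)
    also have "(\<beta> / 2)\<^sup>2 * (1 - q8)\<^sup>2 / (2 * (K * \<beta>\<^sup>2 * q8 ^ (4 * m0))) = (1 - q8)\<^sup>2 / (8 * K * q8 ^ (4 * m0))"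
      using pos q8 by (simp add: power_divide)
    finally show ?thesis using small1 by linarith
  qed
  have P2: "3 / 4 \<le> prob E2"
  proof -
    have "1 - exp 16 * exp (- ((A * \<beta>)\<^sup>2 * (1 - q8)\<^sup>2 / (2 * (K * \<beta>\<^sup>2)))) \<le> prob E2"
      unfolding E2_def I2_def
      by (rule prob_all_le_ge) (use Ymem Yz pos A YincK in auto)
    also have "(A * \<beta>)\<^sup>2 * (1 - q8)\<^sup>2 / (2 * (K * \<beta>\<^sup>2)) = A\<^sup>2 * (1 - q8)\<^sup>2 / (2 * K)"
      using pos by (simp add: power_mult_distrib)
    finally show ?thesis using small2 by linarith
  qed
  have I12: "I1 \<subseteq> I2" "finite I1" "finite I2" using N0 by (auto simp: I1_def I2_def)
  have Esets: "E1 \<in> sets M" "E2 \<in> sets M"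
    unfolding E1_def E2_def by (rule sets_all_le; use I12 Ymem in \<open>auto simp: I2_def\<close>)+
  \<comment> \<open>One threshold per index expresses both events at once, in the form that
    \<open>indep_orthogonal\<close> takes: indices in \<open>I1\<close> are subject to both
    bounds.\<close>
  define y where "y i = (if i \<in> I1 then min (\<beta> / 2) (A * \<beta>) else A * \<beta>)" for i
  define E where "E = {\<omega> \<in> space M. \<forall>i\<in>I2. Y i \<omega> \<le> y i}"
  have "E = E1 \<inter> E2" unfolding E_def E1_def E2_def y_def using I12 by auto
  moreover have "prob (E1 \<inter> E2) \<ge> prob E1 + prob E2 - 1"
    using finite_measure_Union'[OF Esets] prob_le_1[of "E1 \<union> E2"] measure_Un3[of E1 M E2] Esets by (simp add: fmeasurable_eq_sets)
  ultimately have PE: "1 / 2 \<le> prob E" using P1 P2 by auto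
  define Dn where "Dn = (\<lambda>\<omega>. (1 / d) * D \<omega>)"
  have Dn: "Dn \<in> H" "ip Dn Dn = 1"
    using normalize_mem[OF D] d2p unfolding Dn_def d_def d2_def by auto
  have DnY: "ip Dn (Y i) = 0" if "i \<in> I2" for i
    unfolding Dn_def ip_scale using Yorth(1)[of i] that by (simp add: ip_commute[of D] I2_def)
  have PD: "prob {\<omega> \<in> space M. Dn \<omega> \<in> {..- m} \<and> (\<forall>i\<in>I2. Y i \<omega> \<in> {..y i})} = prob {\<omega> \<in> space M. Dn \<omega> \<in> {..- m}} * prob {\<omega> \<in> space M. \<forall>i\<in>I2. Y i \<omega> \<in> {..y i}}"
    using Dn I12 DnY Ymem by (intro indep_orthogonal) (auto simp: I2_def)
  \<comment> \<open>\<open>Dn\<close> joins the family at the free index \<open>Suc (2 ^ N)\<close>,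
    so that a single statement gives independence of \<open>F\<close> from everything else.\<close>
  define Z where "Z i = (if i = Suc (2 ^ N) then Dn else Y i)" for i
  define y' where "y' i = (if i = Suc (2 ^ N) then - m else y i)" for i
  define I3 where "I3 = insert (Suc (2 ^ N)) I2"
  have ZE: "(\<forall>i\<in>I3. Z i \<omega> \<le> y' i) \<longleftrightarrow> Dn \<omega> \<le> - m \<and> (\<forall>i\<in>I2. Y i \<omega> \<le> y i)" for \<omega>
    unfolding I3_def Z_def y'_def I2_def by auto
  have ind: "prob {\<omega> \<in> space M. F \<omega> \<in> {a..b} \<and> (\<forall>i\<in>I3. Z i \<omega> \<le> y' i)} = prob {\<omega> \<in> space M. F \<omega> \<in> {a..b}} * prob {\<omega> \<in> space M. \<forall>i\<in>I3. Z i \<omega> \<le> y' i}"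
  proof (rule prob_independent_of_F)
    show "finite I3" using I12 by (simp add: I3_def)
    show "Z i \<in> H" if "i \<in> I3" for i using that Ymem Dn by (auto simp: Z_def I3_def I2_def)
    have "ip F Dn = 0" unfolding Dn_def ip_scale2 using DF by (simp add: ip_commute[of F])
    thus "ip F (Z i) = 0" if "i \<in> I3" for i using that Yorth(2)[of i] by (auto simp: Z_def I3_def I2_def ip_commute)
  qed
  have sub: "{\<omega> \<in> space M. F \<omega> \<in> {a..b} \<and> (\<forall>i\<in>I3. Z i \<omega> \<le> y' i)} \<subseteq> {\<omega> \<in> space M. F \<omega> \<in> {a..b} \<and> (\<forall>i\<le>2 ^ N. X i \<omega> \<le> w)}"
  proof (intro subsetI CollectI conjI allI impI)
    fix \<omega> and i :: nat assume w1: "\<omega> \<in> {\<omega> \<in> space M. F \<omega> \<in> {a..b} \<and> (\<forall>i\<in>I3. Z i \<omega> \<le> y' i)}" and i: "i \<le> 2 ^ N"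
    hence Dm: "D \<omega> / d \<le> - m" and Yy: "Y i \<omega> \<le> y i" and Fz: "\<bar>F \<omega>\<bar> \<le> z" using ZE[of \<omega>] ab by (auto simp: Dn_def I2_def)
    have "X i \<omega> = ip (X i) F / V * F \<omega> + al i * (D \<omega> / d) + Y i \<omega>" by (rule dec[OF i])
    also have "\<dots> \<le> \<bar>ip (X i) F / V\<bar> * z + al i * (- m) + y i"
    proof (intro add_mono Yy mult_left_mono Dm al0 i)
      have "ip (X i) F / V * F \<omega> \<le> \<bar>ip (X i) F / V\<bar> * \<bar>F \<omega>\<bar>" by (metis abs_ge_self abs_mult)
      also have "\<dots> \<le> \<bar>ip (X i) F / V\<bar> * z" using Fz by (intro mult_left_mono) auto
      finally show "ip (X i) F / V * F \<omega> \<le> \<bar>ip (X i) F / V\<bar> * z" .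
    qed
    also have "\<dots> \<le> y i - al i * R" using push[OF i] by simp
    also have "\<dots> \<le> w"
    proof (cases "i \<in> I1")
      case True
      hence "y i \<le> \<beta> / 2" by (simp add: y_def)
      moreover have "0 \<le> al i * R" using al0[OF i] R by simp
      ultimately show ?thesis using w by linarith
    next
      case False
      hence "y i = A * \<beta>" "2 ^ (N - m0) \<le> i" by (auto simp: y_def I1_def)
      thus ?thesis using alA[OF i] w pos by simp
    qed
    finally show "X i \<omega> \<le> w" .
  qed auto
  have "exp (- m\<^sup>2 - 1) / sqrt (2 * pi) * (1 / 2) \<le> prob {\<omega> \<in> space M. Dn \<omega> \<le> - m} * prob E"
    using prob_le_neg_ge[OF Dn m0'] PE by (intro mult_mono) auto
  also have "\<dots> = prob {\<omega> \<in> space M. \<forall>i\<in>I3. Z i \<omega> \<le> y' i}" using PD unfolding ZE E_def by simp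
  finally have "prob {\<omega> \<in> space M. F \<omega> \<in> {a..b}} * (exp (- m\<^sup>2 - 1) / sqrt (2 * pi) * (1 / 2)) \<le> prob {\<omega> \<in> space M. F \<omega> \<in> {a..b}} * prob {\<omega> \<in> space M. \<forall>i\<in>I3. Z i \<omega> \<le> y' i}"
    by (intro mult_left_mono) auto
  also have "\<dots> = prob {\<omega> \<in> space M. F \<omega> \<in> {a..b} \<and> (\<forall>i\<in>I3. Z i \<omega> \<le> y' i)}" by (rule ind[symmetric])
  also have "\<dots> \<le> prob {\<omega> \<in> space M. F \<omega> \<in> {a..b} \<and> (\<forall>i\<le>2 ^ N. X i \<omega> \<le> w)}"
    using sub sets_strip[of "2 ^ N" X] X by (intro finite_measure_mono) auto
  finally show ?thesis unfolding m_def .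
qed

end

section \<open>Suprema of continuous Gaussian paths\<close>

text \<open>With \<open>z\<close> as a convex combination of \<open>w\<close> and \<open>y\<close>,
  log-concavity gives \<open>L z \<ge> L y * exp (- ((1 - l) * ln (L y / L w)))\<close>, and
  \<open>exp x \<ge> 1 + x\<close> turns this into a bound for the increment. Enlarging
  \<open>L y\<close> to \<open>\<pi>\<close> leaves \<open>L w\<close> as the only quantity to be
  estimated.\<close>

lemma log_concave_increment:
  fixes L :: "real \<Rightarrow> real"
  assumes lc: "\<And>l. 0 < l \<Longrightarrow> l < 1 \<Longrightarrow> L w powr (1 - l) * L y powr l \<le> L ((1 - l) * w + l * y)"
    and z: "w < z" "z < y" and L: "0 < L w" "L w \<le> L y" "L y \<le> \<pi>"
  shows "L y - L z \<le> \<pi> * ((y - z) / (z - w)) * ln (\<pi> / L w)"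
proof -
  define l where "l = (z - w) / (y - w)"
  have l: "0 < l" "l < 1" using z by (auto simp: l_def field_simps)
  have "l * (y - w) = z - w" using z by (simp add: l_def)
  hence "(1 - l) * w + l * y = z" by (simp add: algebra_simps)
  hence "L w powr (1 - l) * L y powr l \<le> L z" using lc[OF l] by simp
  moreover have Ly: "0 < L y" using L by linarith
  have "L w powr (1 - l) * L y powr l = exp ((1 - l) * ln (L w) + l * ln (L y))"
    using L Ly by (simp add: powr_def exp_add)
  also have "(1 - l) * ln (L w) + l * ln (L y) = ln (L y) + - ((1 - l) * ln (L y / L w))"
    using L Ly by (simp add: ln_div algebra_simps)
  also have "exp \<dots> = L y * exp (- ((1 - l) * ln (L y / L w)))" unfolding exp_add using Ly by simp
  also have "\<dots> \<ge> L y * (1 + - ((1 - l) * ln (L y / L w)))"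
    using Ly by (intro mult_left_mono exp_ge_add_one_self) auto
  ultimately have "L y - L z \<le> L y * ((1 - l) * ln (L y / L w))" by (simp add: algebra_simps)
  also have "\<dots> \<le> \<pi> * (((y - z) / (z - w)) * ln (\<pi> / L w))"
  proof (intro mult_mono)
    have "1 - l = (y - z) / (y - w)" using z by (simp add: l_def field_simps)
    also have "\<dots> \<le> (y - z) / (z - w)" using z by (intro divide_left_mono) auto
    finally show "1 - l \<le> (y - z) / (z - w)" .
    show "ln (L y / L w) \<le> ln (\<pi> / L w)" using L Ly by (intro ln_mono divide_right_mono) auto
    show "0 \<le> ln (L y / L w)" using L by simp
    thus "0 \<le> (1 - l) * ln (L y / L w)" using l by simp
  qed (use L l z in auto)
  finally show ?thesis by (simp add: mult.assoc)
qed

text \<open>The properties of \<open>u\<close> at a fixed point of space that the argument uses,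
  with constants free of the grid. \<open>neg_corr\<close> says that the covariance with the initial
  value drops by at least a multiple of \<open>sqrt (t - s)\<close>; \<open>end_corr\<close> says
  that no time in the interval has a smaller covariance with the final time than \<open>s\<close>
  has.\<close>

locale gaussian_path = gaussian_space M H for M :: "'w measure" and H :: "('w \<Rightarrow> real) set" +
  fixes U :: "real \<Rightarrow> 'w \<Rightarrow> real" and s \<delta> vmin vmax K k1 \<kappa>0 :: real
  assumes \<delta>: "0 < \<delta>" "\<delta> \<le> 1"
    and U: "\<And>t. s \<le> t \<Longrightarrow> t \<le> s + \<delta> \<Longrightarrow> U t \<in> H"
    and cont: "\<And>\<omega>. \<omega> \<in> space M \<Longrightarrow> continuous_on {s..s + \<delta>} (\<lambda>t. U t \<omega>)"
    and pos: "0 < vmin" "0 < K" "0 < k1" "0 < \<kappa>0"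
    and var: "vmin \<le> ip (U s) (U s)" "ip (U s) (U s) \<le> vmax"
    and incr: "\<And>r t. s \<le> r \<Longrightarrow> r \<le> t \<Longrightarrow> t \<le> s + \<delta> \<Longrightarrow> incr_var (U t) (U r) \<le> K * sqrt (t - r)"
    and neg_corr: "\<And>t. s \<le> t \<Longrightarrow> t \<le> s + \<delta> \<Longrightarrow> ip (U t) (U s) - ip (U s) (U s) \<le> - (k1 * sqrt (t - s))"
    and end_corr: "\<And>t. s \<le> t \<Longrightarrow> t \<le> s + \<delta> \<Longrightarrow> ip (U s) (U (s + \<delta>)) \<le> ip (U t) (U (s + \<delta>))"
    and end_base: "\<kappa>0 \<le> ip (U (s + \<delta>)) (U s)"
begin

definition \<beta> where "\<beta> = \<delta> powr (1 / 4)"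

lemma \<beta>: "0 < \<beta>" "\<beta> \<le> 1" "\<beta>\<^sup>2 = sqrt \<delta>"
proof -
  show "0 < \<beta>" using \<delta> by (simp add: \<beta>_def)
  show "\<beta> \<le> 1" using \<delta> by (simp add: \<beta>_def powr_le1)
  have "\<beta>\<^sup>2 = \<delta> powr (1 / 4 + 1 / 4)" unfolding \<beta>_def powr_add power2_eq_square ..
  thus "\<beta>\<^sup>2 = sqrt \<delta>" using \<delta> by (simp add: powr_half_sqrt)
qed

definition tm :: "nat \<Rightarrow> nat \<Rightarrow> real" where "tm N i = s + \<delta> * (real i / 2 ^ N)"

lemma tm_bounds: assumes "i \<le> 2 ^ N" shows "s \<le> tm N i" "tm N i \<le> s + \<delta>"
proof -
  have "real i \<le> real (2 ^ N)" using assms by (simp only: of_nat_le_iff)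
  hence "real i / 2 ^ N \<le> 1" by simp
  hence "\<delta> * (real i / 2 ^ N) \<le> \<delta> * 1" using \<delta> by (intro mult_left_mono) auto
  thus "tm N i \<le> s + \<delta>" by (simp add: tm_def)
  show "s \<le> tm N i" using \<delta> by (simp add: tm_def)
qed

definition X :: "nat \<Rightarrow> nat \<Rightarrow> 'w \<Rightarrow> real" where "X N i = (\<lambda>\<omega>. U (tm N i) \<omega> - U s \<omega>)"

lemma grid: "gaussian_grid M H (U s) (X N) N \<beta> vmin vmax K k1 \<kappa>0"
proof
  have Us: "U s \<in> H" using U \<delta> by simp
  have Ue: "U (s + \<delta>) \<in> H" using U \<delta> by simp
  have e: "tm N (2 ^ N) = s + \<delta>" by (simp add: tm_def)
  show "U s \<in> H" by fact
  show "X N i \<in> H" if "i \<le> 2 ^ N" for i unfolding X_def using U tm_bounds[OF that] Us by (intro diff_mem) auto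
  show "X N 0 = (\<lambda>_. 0)" by (simp add: X_def tm_def)
  show "0 < \<beta>" "\<beta> \<le> 1" by (rule \<beta>)+
  show "incr_var (X N j) (X N i) \<le> K * \<beta>\<^sup>2 * sqrt (real (j - i) / 2 ^ N)" if "i \<le> j" "j \<le> 2 ^ N" for i j
  proof -
    have "tm N i \<le> tm N j" using that \<delta> by (simp add: tm_def divide_right_mono)
    moreover have "tm N j - tm N i = \<delta> * (real (j - i) / 2 ^ N)" using that by (simp add: tm_def algebra_simps diff_divide_distrib of_nat_diff)
    moreover have "(\<lambda>\<omega>. X N j \<omega> - X N i \<omega>) = (\<lambda>\<omega>. U (tm N j) \<omega> - U (tm N i) \<omega>)" by (simp add: X_def)
    ultimately show ?thesis
      using incr[of "tm N i" "tm N j"] tm_bounds[of i N] tm_bounds[of j N] that by (simp add: \<beta> real_sqrt_mult real_sqrt_divide mult.assoc)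
  qed
  fix i :: nat assume i: "i \<le> 2 ^ N"
  have Ui: "U (tm N i) \<in> H" using U tm_bounds[OF i] by simp
  have b: "tm N i - s = \<delta> * (real i / 2 ^ N)" by (simp add: tm_def)
  show "ip (X N i) (U s) \<le> - (k1 * \<beta>\<^sup>2 * sqrt (real i / 2 ^ N))"
    using neg_corr[OF tm_bounds[OF i]] Ui Us unfolding b X_def by (simp add: ip_diff \<beta> real_sqrt_mult real_sqrt_divide mult.assoc)
  show "0 \<le> ip (X N i) (U s) + ip (X N i) (X N (2 ^ N))"
    using end_corr[OF tm_bounds[OF i]] Ui Us Ue unfolding X_def e by (simp add: ip_diff ip_diff2 diff_mem)
next
  have Us: "U s \<in> H" and Ue: "U (s + \<delta>) \<in> H" using U \<delta> by simp_all
  have e: "tm N (2 ^ N) = s + \<delta>" by (simp add: tm_def)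
  show "\<kappa>0 \<le> ip (U s) (U s) + ip (X N (2 ^ N)) (U s)"
    using end_base Us Ue unfolding X_def e by (simp add: ip_diff)
qed (use pos var in auto)

definition sup_incr :: "'w \<Rightarrow> real" where
  "sup_incr \<omega> = (SUP t\<in>{s..s + \<delta>}. U t \<omega> - U s \<omega>)"

text \<open>By continuity the dyadic times determine the supremum, which makes the event a countable
  intersection of grid events; this also gives its measurability.\<close>

lemma sup_incr_le_iff:
  assumes \<omega>: "\<omega> \<in> space M"
  shows "sup_incr \<omega> \<le> z \<longleftrightarrow> (\<forall>N. \<forall>i\<le>2 ^ N. X N i \<omega> \<le> z)"
proof -
  have c: "continuous_on {s..s + \<delta>} (\<lambda>t. U t \<omega> - U s \<omega>)" using cont[OF \<omega>] by (intro continuous_intros)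
  have "compact ((\<lambda>t. U t \<omega> - U s \<omega>) ` {s..s + \<delta>})" using c by (rule compact_continuous_image) simp
  hence "bdd_above ((\<lambda>t. U t \<omega> - U s \<omega>) ` {s..s + \<delta>})" by (intro bounded_imp_bdd_above compact_imp_bounded)
  hence "sup_incr \<omega> \<le> z \<longleftrightarrow> (\<forall>t\<in>{s..s + \<delta>}. U t \<omega> - U s \<omega> \<le> z)"
    unfolding sup_incr_def using \<delta> by (intro cSUP_le_iff) auto
  also have "\<dots> \<longleftrightarrow> (\<forall>N. \<forall>i\<le>2 ^ N. X N i \<omega> \<le> z)"
  proof
    assume "\<forall>t\<in>{s..s + \<delta>}. U t \<omega> - U s \<omega> \<le> z"
    thus "\<forall>N. \<forall>i\<le>2 ^ N. X N i \<omega> \<le> z" using tm_bounds by (auto simp: X_def)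
  next
    assume G: "\<forall>N. \<forall>i\<le>2 ^ N. X N i \<omega> \<le> z"
    show "\<forall>t\<in>{s..s + \<delta>}. U t \<omega> - U s \<omega> \<le> z"
    proof
      fix t assume t: "t \<in> {s..s + \<delta>}"
      define r where "r = (t - s) / \<delta>"
      have r: "0 \<le> r" "r \<le> 1" "t = s + \<delta> * r" using t \<delta> by (auto simp: r_def)
      define i where "i N = nat \<lfloor>r * 2 ^ N\<rfloor>" for N
      have ir: "real (i N) \<le> r * 2 ^ N" "r * 2 ^ N - 1 < real (i N)" for N
        using r by (auto simp: i_def)
      have i2: "i N \<le> 2 ^ N" for N
      proof -
        have "real (i N) \<le> 1 * 2 ^ N" using ir(1)[of N] r by (intro order_trans[OF ir(1)] mult_right_mono) auto
        hence "real (i N) \<le> real (2 ^ N)" by simp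
        thus ?thesis by (simp only: of_nat_le_iff)
      qed
      have "(\<lambda>N. real (i N) / 2 ^ N) \<longlonglongrightarrow> r"
      proof (rule tendsto_sandwich)
        show "\<forall>\<^sub>F N in sequentially. r - (1 / 2) ^ N \<le> real (i N) / 2 ^ N"
        proof (intro always_eventually allI)
          fix N
          have "r - (1 / 2) ^ N = (r * 2 ^ N - 1) / 2 ^ N" by (simp add: diff_divide_distrib power_one_over)
          also have "\<dots> \<le> real (i N) / 2 ^ N" using ir(2)[of N] by (intro divide_right_mono) auto
          finally show "r - (1 / 2) ^ N \<le> real (i N) / 2 ^ N" .
        qed
        show "\<forall>\<^sub>F N in sequentially. real (i N) / 2 ^ N \<le> r"
          using ir(1) by (intro always_eventually allI) (simp add: field_simps)
        have "(\<lambda>N. (1 / 2) ^ N) \<longlonglongrightarrow> (0::real)" by (rule LIMSEQ_realpow_zero) auto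
        from tendsto_diff[OF tendsto_const[of r] this] show "(\<lambda>N. r - (1 / 2) ^ N) \<longlonglongrightarrow> r" by simp
      qed simp
      hence "(\<lambda>N. tm N (i N)) \<longlonglongrightarrow> t" unfolding tm_def r(3) by (intro tendsto_intros)
      hence "(\<lambda>N. U (tm N (i N)) \<omega> - U s \<omega>) \<longlonglongrightarrow> U t \<omega> - U s \<omega>"
        using c t tm_bounds i2 by (intro continuous_on_tendsto_compose[OF c]) auto
      thus "U t \<omega> - U s \<omega> \<le> z"
        by (rule LIMSEQ_le_const2) (use G i2 in \<open>auto simp: X_def\<close>)
    qed
  qed
  finally show ?thesis .
qed

definition L :: "real \<Rightarrow> real \<Rightarrow> real \<Rightarrow> real" where
  "L a b z = prob {\<omega> \<in> space M. U s \<omega> \<in> {a..b} \<and> sup_incr \<omega> \<le> z}"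

definition LN :: "nat \<Rightarrow> real \<Rightarrow> real \<Rightarrow> real \<Rightarrow> real" where
  "LN N a b z = prob {\<omega> \<in> space M. U s \<omega> \<in> {a..b} \<and> (\<forall>i\<le>2 ^ N. X N i \<omega> \<le> z)}"

lemma LN_tendsto: "(\<lambda>N. LN N a b z) \<longlonglongrightarrow> L a b z"
proof -
  define E where "E N = {\<omega> \<in> space M. U s \<omega> \<in> {a..b} \<and> (\<forall>i\<le>2 ^ N. X N i \<omega> \<le> z)}" for N
  have E: "E N \<in> sets M" for N
  proof -
    interpret gaussian_grid M H "U s" "X N" N \<beta> vmin vmax K k1 \<kappa>0 by (rule grid)
    show ?thesis unfolding E_def by (rule sets_strip) (rule X)
  qed
  have "E (Suc N) \<subseteq> E N" for N
  proof
    fix \<omega> assume w: "\<omega> \<in> E (Suc N)"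
    have "X N i \<omega> \<le> z" if "i \<le> 2 ^ N" for i
    proof -
      \<comment> \<open>Halving the mesh doubles the index, so finer grids impose more
        conditions.\<close>
      have "X N i = X (Suc N) (2 * i)" by (simp add: X_def tm_def)
      thus ?thesis using w that by (auto simp: E_def)
    qed
    thus "\<omega> \<in> E N" using w by (auto simp: E_def)
  qed
  hence "decseq E" by (rule decseq_SucI)
  moreover have "range E \<subseteq> sets M" using E by auto
  ultimately have "(\<lambda>N. prob (E N)) \<longlonglongrightarrow> prob (\<Inter>N. E N)" by (intro finite_Lim_measure_decseq)
  also have "(\<Inter>N. E N) = {\<omega> \<in> space M. U s \<omega> \<in> {a..b} \<and> sup_incr \<omega> \<le> z}"
    using sup_incr_le_iff by (auto simp: E_def)
  finally show ?thesis by (simp add: LN_def L_def E_def)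
qed

lemma L_log_concave:
  assumes l: "0 < l" "l < 1"
  shows "L a b z powr (1 - l) * L a b w powr l \<le> L a b ((1 - l) * z + l * w)"
proof (rule LIMSEQ_le)
  show "(\<lambda>N. LN N a b z powr (1 - l) * LN N a b w powr l) \<longlonglongrightarrow> L a b z powr (1 - l) * L a b w powr l"
    using l by (intro tendsto_mult tendsto_powr' LN_tendsto tendsto_const) (auto simp: LN_def)
  show "(\<lambda>N. LN N a b ((1 - l) * z + l * w)) \<longlonglongrightarrow> L a b ((1 - l) * z + l * w)" by (rule LN_tendsto)
  have "LN N a b z powr (1 - l) * LN N a b w powr l \<le> LN N a b ((1 - l) * z + l * w)" for N
  proof -
    interpret gaussian_grid M H "U s" "X N" N \<beta> vmin vmax K k1 \<kappa>0 by (rule grid)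
    have "(\<forall>i\<le>2 ^ N. Y i) \<longleftrightarrow> (\<forall>i<Suc (2 ^ N). Y i)" for Y by (simp add: less_Suc_eq_le)
    thus ?thesis unfolding LN_def
      using prob_strip_log_concave[OF F _ l, of "Suc (2 ^ N)" "X N" a b z w] X by (simp add: less_Suc_eq_le)
  qed
  thus "\<exists>N0. \<forall>N\<ge>N0. LN N a b z powr (1 - l) * LN N a b w powr l \<le> LN N a b ((1 - l) * z + l * w)" by blast
qed

lemma L_moderate:
  assumes "\<bar>a\<bar> \<le> z" "\<bar>b\<bar> \<le> z" "0 \<le> w" "sqrt (K / vmin) * \<beta> * z \<le> w / 2"
  shows "prob {\<omega> \<in> space M. U s \<omega> \<in> {a..b}} * (1 - exp 16 * exp (- ((w / 2)\<^sup>2 * (1 - q8)\<^sup>2 / (2 * (K * \<beta>\<^sup>2))))) \<le> L a b w"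
proof (rule LIMSEQ_le_const[OF LN_tendsto])
  have "prob {\<omega> \<in> space M. U s \<omega> \<in> {a..b}} * (1 - exp 16 * exp (- ((w / 2)\<^sup>2 * (1 - q8)\<^sup>2 / (2 * (K * \<beta>\<^sup>2))))) \<le> LN N a b w" for N
  proof -
    interpret gaussian_grid M H "U s" "X N" N \<beta> vmin vmax K k1 \<kappa>0 by (rule grid)
    show ?thesis unfolding LN_def by (rule strip_prob_moderate[OF assms])
  qed
  thus "\<exists>N0. \<forall>N\<ge>N0. prob {\<omega> \<in> space M. U s \<omega> \<in> {a..b}} * (1 - exp 16 * exp (- ((w / 2)\<^sup>2 * (1 - q8)\<^sup>2 / (2 * (K * \<beta>\<^sup>2))))) \<le> LN N a b w" by blast
qed

lemma L_lower:
  assumes "\<bar>a\<bar> \<le> z" "\<bar>b\<bar> \<le> z" "\<beta> / 2 \<le> w" "0 \<le> R" "0 \<le> A"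
    and "exp 16 * exp (- ((1 - q8)\<^sup>2 / (8 * K * q8 ^ (4 * m0)))) \<le> 1 / 4"
    and "exp 16 * exp (- (A\<^sup>2 * (1 - q8)\<^sup>2 / (2 * K))) \<le> 1 / 4"
    and "A \<le> R * (\<kappa>0 / vmax) * k1 * q8 ^ (4 * m0) / sqrt K"
  shows "prob {\<omega> \<in> space M. U s \<omega> \<in> {a..b}} * (exp (- (z * sqrt K / \<kappa>0 + R)\<^sup>2 - 1) / sqrt (2 * pi) * (1 / 2)) \<le> L a b w"
proof (rule LIMSEQ_le_const[OF LN_tendsto])
  have "prob {\<omega> \<in> space M. U s \<omega> \<in> {a..b}} * (exp (- (z * sqrt K / \<kappa>0 + R)\<^sup>2 - 1) / sqrt (2 * pi) * (1 / 2)) \<le> LN N a b w" if "m0 \<le> N" for N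
  proof -
    interpret gaussian_grid M H "U s" "X N" N \<beta> vmin vmax K k1 \<kappa>0 by (rule grid)
    show ?thesis unfolding LN_def by (rule strip_prob_lower[OF assms(1-3) that assms(4-8)])
  qed
  thus "\<exists>N0. \<forall>N\<ge>N0. prob {\<omega> \<in> space M. U s \<omega> \<in> {a..b}} * (exp (- (z * sqrt K / \<kappa>0 + R)\<^sup>2 - 1) / sqrt (2 * pi) * (1 / 2)) \<le> LN N a b w" by blast
qed

lemma sets_L: "{\<omega> \<in> space M. U s \<omega> \<in> {a..b} \<and> sup_incr \<omega> \<le> z} \<in> sets M"
proof -
  have E: "{\<omega> \<in> space M. U s \<omega> \<in> {a..b} \<and> (\<forall>i\<le>2 ^ N. X N i \<omega> \<le> z)} \<in> sets M" for N
  proof -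
    interpret gaussian_grid M H "U s" "X N" N \<beta> vmin vmax K k1 \<kappa>0 by (rule grid)
    show ?thesis by (rule sets_strip) (rule X)
  qed
  have "{\<omega> \<in> space M. U s \<omega> \<in> {a..b} \<and> sup_incr \<omega> \<le> z} = (\<Inter>N. {\<omega> \<in> space M. U s \<omega> \<in> {a..b} \<and> (\<forall>i\<le>2 ^ N. X N i \<omega> \<le> z)})"
    using sup_incr_le_iff by auto
  thus ?thesis using E by simp
qed

lemma sets_F: "{\<omega> \<in> space M. U s \<omega> \<in> {a..b}} \<in> sets M"
proof -
  have [measurable]: "U s \<in> borel_measurable M" using U \<delta> by (intro measurable_mem) auto
  show ?thesis by measurable
qed

lemma L_mono: "z \<le> w \<Longrightarrow> L a b z \<le> L a b w"
  unfolding L_def using sets_L[of a b w] by (intro finite_measure_mono) auto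

lemma L_le: "L a b z \<le> prob {\<omega> \<in> space M. U s \<omega> \<in> {a..b}}"
  unfolding L_def using sets_F[of a b] by (intro finite_measure_mono) auto

lemma prob_box_eq:
  assumes "z \<le> y"
  shows "prob {\<omega> \<in> space M. U s \<omega> \<in> {a..b} \<and> z < sup_incr \<omega> \<and> sup_incr \<omega> \<le> y} = L a b y - L a b z"
proof -
  have "{\<omega> \<in> space M. U s \<omega> \<in> {a..b} \<and> z < sup_incr \<omega> \<and> sup_incr \<omega> \<le> y} = {\<omega> \<in> space M. U s \<omega> \<in> {a..b} \<and> sup_incr \<omega> \<le> y} - {\<omega> \<in> space M. U s \<omega> \<in> {a..b} \<and> sup_incr \<omega> \<le> z}"
    by auto
  thus ?thesis unfolding L_def using sets_L assms by (subst finite_measure_Diff[symmetric]) auto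
qed

lemma prob_box_le:
  assumes "0 < z" "0 < k" "0 < L a b (z / 2)"
  shows "prob {\<omega> \<in> space M. U s \<omega> \<in> {a..b} \<and> z < sup_incr \<omega> \<and> sup_incr \<omega> \<le> z + k}
    \<le> prob {\<omega> \<in> space M. U s \<omega> \<in> {a..b}} * (2 * k / z) * ln (prob {\<omega> \<in> space M. U s \<omega> \<in> {a..b}} / L a b (z / 2))"
proof -
  have "L a b (z + k) - L a b z \<le> prob {\<omega> \<in> space M. U s \<omega> \<in> {a..b}} * ((z + k - z) / (z - z / 2)) * ln (prob {\<omega> \<in> space M. U s \<omega> \<in> {a..b}} / L a b (z / 2))"
    using assms by (intro log_concave_increment L_log_concave L_mono L_le) auto
  moreover have "z \<le> z + k" using assms by simp
  ultimately show ?thesis unfolding prob_box_eq[OF \<open>z \<le> z + k\<close>] using assms by (simp add: ac_simps)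
qed

end

section \<open>The Wiener integral\<close>

lemma (in prob_space) gaussian_rv_square_integrable:
  assumes g: "gaussian_rv M X"
  shows "integrable M (\<lambda>\<omega>. (X \<omega>)\<^sup>2)"
proof -
  have [measurable]: "X \<in> borel_measurable M" using g by (simp add: gaussian_rv_def)
  show ?thesis
  proof (cases "\<exists>\<mu>. AE \<omega> in M. X \<omega> = \<mu>")
    case True
    then obtain \<mu> where \<mu>: "AE \<omega> in M. X \<omega> = \<mu>" by blast
    have "integrable M (\<lambda>\<omega>. (X \<omega>)\<^sup>2) \<longleftrightarrow> integrable M (\<lambda>_. \<mu>\<^sup>2)" using \<mu> by (intro integrable_cong_AE) auto
    thus ?thesis by simp
  next
    case False
    then obtain \<mu> \<sigma> where \<sigma>: "0 < \<sigma>" and D: "distributed M lborel X (normal_density \<mu> \<sigma>)" using g by (auto simp: gaussian_rv_def)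
    have "integrable M (\<lambda>\<omega>. (X \<omega> - \<mu>)\<^sup>2)"
      using integrable_normal_moment[OF \<sigma>, of \<mu> 2] distributed_integrable[OF D, of "\<lambda>x. (x - \<mu>)\<^sup>2"] by simp
    hence "integrable M (\<lambda>\<omega>. 2 * (X \<omega> - \<mu>)\<^sup>2 + 2 * \<mu>\<^sup>2)" by simp
    thus ?thesis
    proof (rule Bochner_Integration.integrable_bound)
      have "(x::real)\<^sup>2 \<le> 2 * (x - \<mu>)\<^sup>2 + 2 * \<mu>\<^sup>2" for x
        using zero_le_power2[of "x - 2 * \<mu>"] by (simp add: power2_eq_square algebra_simps)
      thus "AE \<omega> in M. norm ((X \<omega>)\<^sup>2) \<le> norm (2 * (X \<omega> - \<mu>)\<^sup>2 + 2 * \<mu>\<^sup>2)" by simp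
    qed simp
  qed
qed

lemma (in prob_space) gaussian_rv_centered:
  assumes g: "gaussian_rv M X" and mean: "(\<integral>\<omega>. X \<omega> \<partial>M) = 0"
  shows "(CLINT \<omega>|M. iexp (X \<omega>)) = complex_of_real (exp (- (\<integral>\<omega>. (X \<omega>)\<^sup>2 \<partial>M) / 2))"
proof -
  have [measurable]: "X \<in> borel_measurable M" using g by (simp add: gaussian_rv_def)
  show ?thesis
  proof (cases "\<exists>\<mu>. AE \<omega> in M. X \<omega> = \<mu>")
    case True
    then obtain \<mu> where \<mu>: "AE \<omega> in M. X \<omega> = \<mu>" by blast
    have "(\<integral>\<omega>. X \<omega> \<partial>M) = (\<integral>\<omega>. \<mu> \<partial>M)" using \<mu> by (intro integral_cong_AE) auto
    hence "\<mu> = 0" using mean prob_space by simp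
    hence 0: "AE \<omega> in M. X \<omega> = 0" using \<mu> by simp
    have "(\<integral>\<omega>. (X \<omega>)\<^sup>2 \<partial>M) = (\<integral>\<omega>. 0 \<partial>M)" using 0 by (intro integral_cong_AE) auto
    moreover have "(CLINT \<omega>|M. iexp (X \<omega>)) = (CLINT \<omega>|M. 1)" using 0 by (intro integral_cong_AE) auto
    ultimately show ?thesis using prob_space by simp
  next
    case False
    then obtain \<mu> \<sigma> where \<sigma>: "0 < \<sigma>" and D: "distributed M lborel X (normal_density \<mu> \<sigma>)" using g by (auto simp: gaussian_rv_def)
    have "expectation X = \<mu>" using normal_distributed_expectation[OF \<sigma> D] .
    hence \<mu>: "\<mu> = 0" using mean by simp
    have "variance X = \<sigma>\<^sup>2" using normal_distributed_variance[OF \<sigma> D] .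
    hence v: "(\<integral>\<omega>. (X \<omega>)\<^sup>2 \<partial>M) = \<sigma>\<^sup>2" using mean by simp
    have Z: "distributed M lborel (\<lambda>\<omega>. (X \<omega> - \<mu>) / \<sigma>) std_normal_density"
      using D normal_standard_normal_convert[OF \<sigma>] by simp
    have "(CLINT \<omega>|M. iexp (X \<omega>)) = (CLINT \<omega>|M. iexp (\<sigma> * ((X \<omega> - \<mu>) / \<sigma>)))" using \<sigma> \<mu> by simp
    also have "\<dots> = (CLINT z|distr M lborel (\<lambda>\<omega>. (X \<omega> - \<mu>) / \<sigma>). iexp (\<sigma> * z))"
      by (subst integral_distr) auto
    also have "\<dots> = char std_normal \<sigma>" using distributed_distr_eq_density[OF Z] by (simp add: char_def)
    also have "\<dots> = complex_of_real (exp (- (\<sigma>\<^sup>2) / 2))" by (simp add: char_std_normal_distribution)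
    finally show ?thesis using v by simp
  qed
qed

locale sheet = prob_space M for M :: "'w measure" +
  fixes W :: "real \<Rightarrow> real \<Rightarrow> 'w \<Rightarrow> real"
  assumes W: "brownian_sheet M W"
begin

definition lincomb :: "('w \<Rightarrow> real) \<Rightarrow> bool" where
  "lincomb X \<longleftrightarrow> (\<exists>S a. finite S \<and> S \<subseteq> {0..} \<times> {0..1} \<and> X = (\<lambda>\<omega>. \<Sum>i\<in>S. a i * (case i of (t, x) \<Rightarrow> W t x \<omega>)))"

lemma lincomb_zero: "lincomb (\<lambda>_. 0)"
  unfolding lincomb_def by (rule exI[of _ "{}"]) auto

lemma lincomb_scale: assumes "lincomb X" shows "lincomb (\<lambda>\<omega>. c * X \<omega>)"
proof -
  obtain S a where S: "finite S" "S \<subseteq> {0..} \<times> {0..1}" "X = (\<lambda>\<omega>. \<Sum>i\<in>S. a i * (case i of (t, x) \<Rightarrow> W t x \<omega>))" using assms by (auto simp: lincomb_def)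
  show ?thesis unfolding lincomb_def
    by (rule exI[of _ S], rule exI[of _ "\<lambda>i. c * a i"]) (use S in \<open>auto simp: sum_distrib_left mult.assoc\<close>)
qed

lemma lincomb_add: assumes "lincomb X" "lincomb Y" shows "lincomb (\<lambda>\<omega>. X \<omega> + Y \<omega>)"
proof -
  obtain S a where S: "finite S" "S \<subseteq> {0..} \<times> {0..1}" "X = (\<lambda>\<omega>. \<Sum>i\<in>S. a i * (case i of (t, x) \<Rightarrow> W t x \<omega>))" using assms(1) by (auto simp: lincomb_def)
  obtain S' a' where S': "finite S'" "S' \<subseteq> {0..} \<times> {0..1}" "Y = (\<lambda>\<omega>. \<Sum>i\<in>S'. a' i * (case i of (t, x) \<Rightarrow> W t x \<omega>))" using assms(2) by (auto simp: lincomb_def)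
  define b where "b i = (if i \<in> S then a i else 0) + (if i \<in> S' then a' i else 0)" for i
  have "X \<omega> + Y \<omega> = (\<Sum>i\<in>S \<union> S'. b i * (case i of (t, x) \<Rightarrow> W t x \<omega>))" for \<omega>
  proof -
    have "X \<omega> = (\<Sum>i\<in>S \<union> S'. (if i \<in> S then a i else 0) * (case i of (t, x) \<Rightarrow> W t x \<omega>))"
      unfolding S(3) using S S' by (intro sum.mono_neutral_cong_left) auto
    moreover have "Y \<omega> = (\<Sum>i\<in>S \<union> S'. (if i \<in> S' then a' i else 0) * (case i of (t, x) \<Rightarrow> W t x \<omega>))"
      unfolding S'(3) using S S' by (intro sum.mono_neutral_cong_left) auto
    ultimately show ?thesis by (simp only: b_def distrib_right sum.distrib)
  qed
  thus ?thesis unfolding lincomb_def using S S' by (intro exI[of _ "S \<union> S'"] exI[of _ b]) auto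
qed

lemma lincomb_W: assumes "0 \<le> t" "x \<in> {0..1}" shows "lincomb (W t x)"
  unfolding lincomb_def by (rule exI[of _ "{(t, x)}"], rule exI[of _ "\<lambda>_. 1"]) (use assms in auto)

lemma lincomb_diff: "lincomb X \<Longrightarrow> lincomb Y \<Longrightarrow> lincomb (\<lambda>\<omega>. X \<omega> - Y \<omega>)"
  using lincomb_add[of X "\<lambda>\<omega>. (-1) * Y \<omega>"] lincomb_scale[of Y "-1"] by simp

lemma lincomb_gaussian: assumes "lincomb X" shows "gaussian_rv M X"
proof -
  obtain S a where S: "finite S" "S \<subseteq> {0..} \<times> {0..1}" "X = (\<lambda>\<omega>. \<Sum>i\<in>S. a i * (case i of (t, x) \<Rightarrow> W t x \<omega>))" using assms by (auto simp: lincomb_def)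
  have "gaussian_process M ({0..} \<times> {0..1}) (\<lambda>(t, x). W t x)" using W by (simp add: brownian_sheet_def)
  hence "gaussian_rv M (\<lambda>\<omega>. \<Sum>i\<in>S. a i * (case i of (t, x) \<Rightarrow> W t x) \<omega>)" using S unfolding gaussian_process_def by blast
  thus ?thesis unfolding S(3) by (simp add: case_prod_unfold)
qed

lemma lincomb_measurable: "lincomb X \<Longrightarrow> X \<in> borel_measurable M"
  using lincomb_gaussian by (simp add: gaussian_rv_def)

lemma lincomb_square: "lincomb X \<Longrightarrow> integrable M (\<lambda>\<omega>. (X \<omega>)\<^sup>2)"
  using lincomb_gaussian gaussian_rv_square_integrable by blast

lemma lincomb_prod: "lincomb X \<Longrightarrow> lincomb Y \<Longrightarrow> integrable M (\<lambda>\<omega>. X \<omega> * Y \<omega>)"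
  by (intro integrable_mult_of_squares lincomb_measurable lincomb_square)

lemma lincomb_integrable: assumes "lincomb X" shows "integrable M X"
  using lincomb_measurable[OF assms] lincomb_square[OF assms] by (rule square_integrable_imp_integrable)

lemma lincomb_mean: assumes "lincomb X" shows "(\<integral>\<omega>. X \<omega> \<partial>M) = 0"
proof -
  obtain S a where S: "finite S" "S \<subseteq> {0..} \<times> {0..1}" "X = (\<lambda>\<omega>. \<Sum>i\<in>S. a i * (case i of (t, x) \<Rightarrow> W t x \<omega>))" using assms by (auto simp: lincomb_def)
  have i: "integrable M (\<lambda>\<omega>. case i of (t, x) \<Rightarrow> W t x \<omega>) \<and> (\<integral>\<omega>. (case i of (t, x) \<Rightarrow> W t x \<omega>) \<partial>M) = 0" if "i \<in> S" for i
  proof -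
    obtain t x where i: "i = (t, x)" by (cases i)
    hence tx: "i = (t, x)" "0 \<le> t" "x \<in> {0..1}" using S that by auto
    have "(\<integral>\<omega>. W t x \<omega> \<partial>M) = 0" using W tx unfolding brownian_sheet_def by blast
    thus ?thesis using lincomb_integrable[OF lincomb_W[OF tx(2,3)]] tx(1) by simp
  qed
  show ?thesis unfolding S(3) using i by (subst Bochner_Integration.integral_sum) auto
qed

lemma lincomb_char: "lincomb X \<Longrightarrow> (CLINT \<omega>|M. iexp (X \<omega>)) = complex_of_real (exp (- (\<integral>\<omega>. (X \<omega>)\<^sup>2 \<partial>M) / 2))"
  using gaussian_rv_centered lincomb_gaussian lincomb_mean by blast

text \<open>This and the next two functions are the contributions of a single tuple to
  \<open>step_integral\<close>, \<open>step_fun\<close> and \<open>valid_step\<close>, named so that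
  lists can be treated by induction.\<close>

fun rect_integral :: "real \<times> real \<times> real \<times> real \<times> real \<Rightarrow> 'w \<Rightarrow> real" where
  "rect_integral (q, a, b, x, y) \<omega> = q * (W b y \<omega> - W a y \<omega> - W b x \<omega> + W a x \<omega>)"

fun rect_fun :: "real \<times> real \<times> real \<times> real \<times> real \<Rightarrow> real \<times> real \<Rightarrow> real" where
  "rect_fun (q, a, b, x, y) z = q * indicator ({a<..b} \<times> {x<..y}) z"

fun valid_rect :: "real \<times> real \<times> real \<times> real \<times> real \<Rightarrow> bool" where
  "valid_rect (q, a, b, x, y) \<longleftrightarrow> 0 \<le> a \<and> a \<le> b \<and> 0 \<le> x \<and> x \<le> y \<and> y \<le> 1"

lemma step_eqs:
  "step_integral W L \<omega> = (\<Sum>e\<leftarrow>L. rect_integral e \<omega>)" "step_fun L z = (\<Sum>e\<leftarrow>L. rect_fun e z)" "valid_step L \<longleftrightarrow> (\<forall>e\<in>set L. valid_rect e)"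
  unfolding step_integral_def step_fun_def valid_step_def by (auto intro!: arg_cong[where f=sum_list] simp: fun_eq_iff)

lemma rect_lincomb: "valid_rect e \<Longrightarrow> lincomb (rect_integral e)"
proof (cases e)
  fix q a b x y assume v: "valid_rect e" and e: "e = (q, a, b, x, y)"
  have "lincomb (\<lambda>\<omega>. q * (W b y \<omega> - W a y \<omega> - W b x \<omega> + W a x \<omega>))"
    using v e by (intro lincomb_scale lincomb_add lincomb_diff lincomb_W) auto
  moreover have "rect_integral e = (\<lambda>\<omega>. q * (W b y \<omega> - W a y \<omega> - W b x \<omega> + W a x \<omega>))" using e by auto
  ultimately show ?thesis by simp
qed

lemma step_lincomb: "valid_step L \<Longrightarrow> lincomb (step_integral W L)"
proof -
  assume "valid_step L"
  hence "\<forall>e\<in>set L. valid_rect e" by (simp add: step_eqs)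
  hence "lincomb (\<lambda>\<omega>. \<Sum>e\<leftarrow>L. rect_integral e \<omega>)"
    by (induction L) (auto intro: lincomb_zero lincomb_add rect_lincomb)
  moreover have "step_integral W L = (\<lambda>\<omega>. \<Sum>e\<leftarrow>L. rect_integral e \<omega>)" by (simp add: fun_eq_iff step_eqs)
  ultimately show ?thesis by simp
qed

text \<open>The double increment of the Brownian covariance \<open>min\<close> over
  \<open>]a, b]\<close> and \<open>]c, d]\<close> is the length of their overlap.\<close>

lemma min_increment:
  assumes "a \<le> b" "c \<le> (d::real)"
  shows "min b d - min b c - min a d + min a c = max 0 (min b d - max a c)"
  using assms by (auto simp: min_def max_def)

text \<open>The covariance of the sheet factorises in time and space, so
  \<open>min_increment\<close> in each variable gives the area of the intersection of the two
  rectangles.\<close>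

lemma rect_cov:
  assumes "valid_rect e" "valid_rect e'"
  shows "(\<integral>\<omega>. rect_integral e \<omega> * rect_integral e' \<omega> \<partial>M) = (\<integral>z. rect_fun e z * rect_fun e' z \<partial>lborel)"
    "integrable lborel (\<lambda>z. rect_fun e z * rect_fun e' z)"
proof -
  obtain q a b x y where e: "e = (q, a, b, x, y)" by (cases e)
  obtain q' a' b' x' y' where e': "e' = (q', a', b', x', y')" by (cases e')
  note v = assms[unfolded e e', simplified]
  have cov: "(\<integral>\<omega>. W t u \<omega> * W s v \<omega> \<partial>M) = min t s * min u v" if "0 \<le> t" "0 \<le> s" "u \<in> {0..1}" "v \<in> {0..1}" for t s u v
    using W that unfolding brownian_sheet_def by blast
  have int: "integrable M (\<lambda>\<omega>. W t u \<omega> * W s v \<omega>)" if "0 \<le> t" "0 \<le> s" "u \<in> {0..1}" "v \<in> {0..1}" for t s u v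
    using that by (intro lincomb_prod lincomb_W)
  have "(\<integral>\<omega>. (W b y \<omega> - W a y \<omega> - W b x \<omega> + W a x \<omega>) * (W b' y' \<omega> - W a' y' \<omega> - W b' x' \<omega> + W a' x' \<omega>) \<partial>M)
    = (min b b' - min b a' - min a b' + min a a') * (min y y' - min y x' - min x y' + min x x')"
  proof -
    have "(\<integral>\<omega>. (W b y \<omega> - W a y \<omega> - W b x \<omega> + W a x \<omega>) * (W b' y' \<omega> - W a' y' \<omega> - W b' x' \<omega> + W a' x' \<omega>) \<partial>M)
      = (\<integral>\<omega>. W b y \<omega> * W b' y' \<omega> - W b y \<omega> * W a' y' \<omega> - W b y \<omega> * W b' x' \<omega> + W b y \<omega> * W a' x' \<omega> - W a y \<omega> * W b' y' \<omega> + W a y \<omega> * W a' y' \<omega> + W a y \<omega> * W b' x' \<omega> - W a y \<omega> * W a' x' \<omega> - W b x \<omega> * W b' y' \<omega> + W b x \<omega> * W a' y' \<omega> + W b x \<omega> * W b' x' \<omega> - W b x \<omega> * W a' x' \<omega> + W a x \<omega> * W b' y' \<omega> - W a x \<omega> * W a' y' \<omega> - W a x \<omega> * W b' x' \<omega> + W a x \<omega> * W a' x' \<omega> \<partial>M)"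
      by (intro Bochner_Integration.integral_cong) (simp_all add: algebra_simps)
    also have "\<dots> = (min b b' - min b a' - min a b' + min a a') * (min y y' - min y x' - min x y' + min x x')"
      using v by (simp add: cov int) (simp add: algebra_simps)
    finally show ?thesis .
  qed
  also have "\<dots> = max 0 (min b b' - max a a') * max 0 (min y y' - max x x')"
    using v by (simp only: min_increment)
  finally have L: "(\<integral>\<omega>. rect_integral e \<omega> * rect_integral e' \<omega> \<partial>M) = q * q' * (max 0 (min b b' - max a a') * max 0 (min y y' - max x x'))"
    unfolding e e' rect_integral.simps by (simp add: mult.assoc mult.left_commute[of _ q'] )
  let ?R = "{max a a'<..min b b'} \<times> {max x x'<..min y y'}"
  have R: "rect_fun e z * rect_fun e' z = q * q' * indicator ?R z" for z
    unfolding e e' by (cases z) (auto simp: indicator_def)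
  have "emeasure lborel ?R = emeasure (lborel \<Otimes>\<^sub>M lborel) ?R" by (simp only: lborel_prod)
  also have "\<dots> = emeasure lborel {max a a'<..min b b'} * emeasure lborel {max x x'<..min y y'}"
    by (subst lborel.emeasure_pair_measure_Times) auto
  also have "\<dots> = ennreal (max 0 (min b b' - max a a')) * ennreal (max 0 (min y y' - max x x'))"
  proof -
    have "emeasure lborel {c<..d} = ennreal (max 0 (d - c))" for c d :: real
      by (cases "c \<le> d") (auto simp: max_def)
    thus ?thesis by (simp only:)
  qed
  also have "\<dots> = ennreal (max 0 (min b b' - max a a') * max 0 (min y y' - max x x'))" by (simp add: ennreal_mult)
  finally have eR: "emeasure lborel ?R = ennreal (max 0 (min b b' - max a a') * max 0 (min y y' - max x x'))" .
  have mR: "?R \<in> sets lborel" by (auto intro!: borel_Times)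
  have iR: "integrable lborel (\<lambda>z. indicator ?R z :: real)" using mR eR by (intro integrable_real_indicator) auto
  show "integrable lborel (\<lambda>z. rect_fun e z * rect_fun e' z)" unfolding R using iR by simp
  have "(\<integral>z. indicator ?R z \<partial>lborel) = max 0 (min b b' - max a a') * max 0 (min y y' - max x x')"
    using mR eR by (simp add: measure_def)
  thus "(\<integral>\<omega>. rect_integral e \<omega> * rect_integral e' \<omega> \<partial>M) = (\<integral>z. rect_fun e z * rect_fun e' z \<partial>lborel)"
    unfolding R L by simp
qed


text \<open>Used twice in \<open>step_isometry\<close>, on the probability space and on the
  plane.\<close>

lemma sum_list_bilinear:
  assumes "\<And>e e'. e \<in> set L \<Longrightarrow> e' \<in> set L' \<Longrightarrow> integrable N (\<lambda>z. f e z * f e' z :: real)"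
  shows "integrable N (\<lambda>z. (\<Sum>e\<leftarrow>L. f e z) * (\<Sum>e\<leftarrow>L'. f e z))"
    "(\<integral>z. (\<Sum>e\<leftarrow>L. f e z) * (\<Sum>e\<leftarrow>L'. f e z) \<partial>N) = (\<Sum>e\<leftarrow>L. \<Sum>e'\<leftarrow>L'. \<integral>z. f e z * f e' z \<partial>N)"
proof -
  have 1: "integrable N (\<lambda>z. f e z * (\<Sum>e\<leftarrow>L''. f e z)) \<and> (\<integral>z. f e z * (\<Sum>e\<leftarrow>L''. f e z) \<partial>N) = (\<Sum>e'\<leftarrow>L''. \<integral>z. f e z * f e' z \<partial>N)"
    if "e \<in> set L" "set L'' \<subseteq> set L'" for e L''
    using that assms by (induction L'') (auto simp: distrib_left)
  have 2: "integrable N (\<lambda>z. (\<Sum>e\<leftarrow>L''. f e z) * (\<Sum>e\<leftarrow>L'. f e z)) \<and> (\<integral>z. (\<Sum>e\<leftarrow>L''. f e z) * (\<Sum>e\<leftarrow>L'. f e z) \<partial>N) = (\<Sum>e\<leftarrow>L''. \<Sum>e'\<leftarrow>L'. \<integral>z. f e z * f e' z \<partial>N)"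
    if "set L'' \<subseteq> set L" for L''
    using that by (induction L'') (use 1[of _ L'] in \<open>auto simp: distrib_right\<close>)
  show "integrable N (\<lambda>z. (\<Sum>e\<leftarrow>L. f e z) * (\<Sum>e\<leftarrow>L'. f e z))"
    "(\<integral>z. (\<Sum>e\<leftarrow>L. f e z) * (\<Sum>e\<leftarrow>L'. f e z) \<partial>N) = (\<Sum>e\<leftarrow>L. \<Sum>e'\<leftarrow>L'. \<integral>z. f e z * f e' z \<partial>N)"
    using 2[of L] by auto
qed

abbreviation "slab \<equiv> {0..} \<times> {0..1} :: (real \<times> real) set"

lemma step_isometry:
  assumes "valid_step L"
  shows "integrable lborel (\<lambda>z. (indicator slab z * step_fun L z)\<^sup>2)"
    "(\<integral>\<omega>. (step_integral W L \<omega>)\<^sup>2 \<partial>M) = (\<integral>z. (indicator slab z * step_fun L z)\<^sup>2 \<partial>lborel)"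
proof -
  \<comment> \<open>Valid rectangles lie in the slab, so its indicator changes nothing here; it is
    carried along because \<open>has_wiener_integral\<close> compares integrands on the slab
    only.\<close>
  have v: "valid_rect e" if "e \<in> set L" for e using assms that by (simp add: step_eqs)
  have d: "indicator slab z * rect_fun e z = rect_fun e z" if "valid_rect e" for e z
    using that by (cases e; cases z) (auto simp: indicator_def)
  have dS: "indicator slab z * step_fun L z = step_fun L z" for z
    unfolding step_eqs sum_list_const_mult[symmetric] using v d by (intro arg_cong[where f=sum_list] map_cong) auto
  note B1 = sum_list_bilinear[where L = L and L' = L and N = lborel and f = rect_fun, OF rect_cov(2)[OF v v]]
  note B2 = sum_list_bilinear[where L = L and L' = L and N = M and f = rect_integral, OF lincomb_prod[OF rect_lincomb[OF v] rect_lincomb[OF v]]]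
  show "integrable lborel (\<lambda>z. (indicator slab z * step_fun L z)\<^sup>2)"
    unfolding dS unfolding step_eqs power2_eq_square by (rule B1(1))
  have "(\<integral>\<omega>. (step_integral W L \<omega>)\<^sup>2 \<partial>M) = (\<Sum>e\<leftarrow>L. \<Sum>e'\<leftarrow>L. \<integral>z. rect_integral e z * rect_integral e' z \<partial>M)"
    unfolding step_eqs power2_eq_square by (rule B2(2))
  also have "\<dots> = (\<Sum>e\<leftarrow>L. \<Sum>e'\<leftarrow>L. \<integral>z. rect_fun e z * rect_fun e' z \<partial>lborel)"
    using v by (intro arg_cong[where f=sum_list] map_cong refl rect_cov(1)) auto
  also have "\<dots> = (\<integral>z. (indicator slab z * step_fun L z)\<^sup>2 \<partial>lborel)"
    unfolding dS unfolding step_eqs power2_eq_square by (rule B1(2)[symmetric])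
  finally show "(\<integral>\<omega>. (step_integral W L \<omega>)\<^sup>2 \<partial>M) = (\<integral>z. (indicator slab z * step_fun L z)\<^sup>2 \<partial>lborel)" .
qed

lemma step_fun_measurable: "step_fun L \<in> borel_measurable borel"
proof -
  have "rect_fun e \<in> borel_measurable borel" for e
  proof -
    obtain q a b x y where e: "e = (q, a, b, x, y)" by (cases e)
    have "{a<..b} \<times> {x<..y} \<in> sets borel" by (intro borel_Times) auto
    hence "(\<lambda>z. q * indicator ({a<..b} \<times> {x<..y}) z) \<in> borel_measurable borel" by measurable
    moreover have "rect_fun e = (\<lambda>z. q * indicator ({a<..b} \<times> {x<..y}) z)" using e by auto
    ultimately show ?thesis by simp
  qed
  hence "(\<lambda>z. \<Sum>e\<leftarrow>L. rect_fun e z) \<in> borel_measurable borel" by (induction L) auto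
  moreover have "step_fun L = (\<lambda>z. \<Sum>e\<leftarrow>L. rect_fun e z)" by (simp add: fun_eq_iff step_eqs)
  ultimately show ?thesis by simp
qed

end

section \<open>Convergence in mean square\<close>

lemma L2_limit:
  fixes f :: "nat \<Rightarrow> 'a \<Rightarrow> real"
  assumes [measurable]: "\<And>n. f n \<in> borel_measurable N" "g \<in> borel_measurable N"
    and int: "\<And>n. integrable N (\<lambda>z. (f n z)\<^sup>2)"
    and lim: "(\<lambda>n. \<integral>\<^sup>+z. ennreal ((f n z - g z)\<^sup>2) \<partial>N) \<longlonglongrightarrow> 0"
  shows "integrable N (\<lambda>z. (g z)\<^sup>2)" "(\<lambda>n. \<integral>z. (f n z)\<^sup>2 \<partial>N) \<longlonglongrightarrow> (\<integral>z. (g z)\<^sup>2 \<partial>N)"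
    "(\<lambda>n. \<integral>z. (f n z - g z)\<^sup>2 \<partial>N) \<longlonglongrightarrow> 0" "\<forall>\<^sub>F n in sequentially. integrable N (\<lambda>z. (f n z - g z)\<^sup>2)"
proof -
  have "\<forall>\<^sub>F n in sequentially. (\<integral>\<^sup>+z. ennreal ((f n z - g z)\<^sup>2) \<partial>N) < 1"
    using lim by (rule order_tendstoD) simp
  \<comment> \<open>The distances are integrals with values in [0, \<infinity>] and may be infinite
    for finitely many \<open>n\<close>, hence an eventual statement.\<close>
  hence fin: "\<forall>\<^sub>F n in sequentially. integrable N (\<lambda>z. (f n z - g z)\<^sup>2)"
    by eventually_elim (rule integrableI_nonneg, auto intro: less_trans[OF _ ennreal_one_less_top])
  thus "\<forall>\<^sub>F n in sequentially. integrable N (\<lambda>z. (f n z - g z)\<^sup>2)" .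
  then obtain n0 where n0: "integrable N (\<lambda>z. (f n0 z - g z)\<^sup>2)" by (auto simp: eventually_sequentially)
  have sq: "(y::real)\<^sup>2 \<le> 2 * x\<^sup>2 + 2 * (x - y)\<^sup>2" for x y
    using zero_le_power2[of "2 * x - y"] by (simp add: power2_eq_square algebra_simps)
  show gint: "integrable N (\<lambda>z. (g z)\<^sup>2)"
  proof (rule Bochner_Integration.integrable_bound)
    show "integrable N (\<lambda>z. 2 * (f n0 z)\<^sup>2 + 2 * (f n0 z - g z)\<^sup>2)" using int n0 by simp
    show "AE z in N. norm ((g z)\<^sup>2) \<le> norm (2 * (f n0 z)\<^sup>2 + 2 * (f n0 z - g z)\<^sup>2)" using sq by simp
  qed simp
  define d where "d n = (\<integral>z. (f n z - g z)\<^sup>2 \<partial>N)" for n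
  have d0: "0 \<le> d n" for n by (simp add: d_def)
  have "\<forall>\<^sub>F n in sequentially. (\<integral>\<^sup>+z. ennreal ((f n z - g z)\<^sup>2) \<partial>N) = ennreal (d n)"
    using fin unfolding d_def by eventually_elim (rule nn_integral_eq_integral, auto)
  from Lim_transform_eventually[OF lim this] have "(\<lambda>n. ennreal (d n)) \<longlonglongrightarrow> ennreal 0" by simp
  hence d: "d \<longlonglongrightarrow> 0" using d0 by (subst (asm) tendsto_ennreal_iff) auto
  thus "(\<lambda>n. \<integral>z. (f n z - g z)\<^sup>2 \<partial>N) \<longlonglongrightarrow> 0" unfolding d_def[abs_def] .
  define G where "G = (\<integral>z. (g z)\<^sup>2 \<partial>N)"
  have G0: "0 \<le> G" by (simp add: G_def)
  have bnd: "\<bar>(\<integral>z. (f n z)\<^sup>2 \<partial>N) - G\<bar> \<le> \<eta> * G + (1 + 1 / \<eta>) * d n" if n: "integrable N (\<lambda>z. (f n z - g z)\<^sup>2)" and \<eta>: "0 < \<eta>" for n and \<eta> :: real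
  proof -
    \<comment> \<open>Young's inequality with a free \<open>\<eta>\<close>, in place of the triangle
      inequality in L2: first \<open>\<eta>\<close> is chosen small against the norm of
      \<open>g\<close>, then \<open>n\<close> large.\<close>
    have pt: "\<bar>(x::real)\<^sup>2 - y\<^sup>2\<bar> \<le> \<eta> * y\<^sup>2 + (1 + 1 / \<eta>) * (x - y)\<^sup>2" for x y
    proof -
      have "0 \<le> (sqrt \<eta> * \<bar>y\<bar> - (1 / sqrt \<eta>) * \<bar>x - y\<bar>)\<^sup>2" by simp
      also have "\<dots> = \<eta> * y\<^sup>2 + (1 / \<eta>) * (x - y)\<^sup>2 - 2 * (\<bar>y\<bar> * \<bar>x - y\<bar>)"
        using \<eta> by (simp add: power2_diff power_mult_distrib power_divide)
      finally have a: "2 * (\<bar>y\<bar> * \<bar>x - y\<bar>) \<le> \<eta> * y\<^sup>2 + (1 / \<eta>) * (x - y)\<^sup>2" by simp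
      have "x\<^sup>2 - y\<^sup>2 = (x - y)\<^sup>2 + 2 * (y * (x - y))" by (simp add: power2_eq_square algebra_simps)
      hence "\<bar>x\<^sup>2 - y\<^sup>2\<bar> \<le> (x - y)\<^sup>2 + 2 * (\<bar>y\<bar> * \<bar>x - y\<bar>)"
        using abs_triangle_ineq[of "(x - y)\<^sup>2" "2 * (y * (x - y))"] by (simp add: abs_mult)
      also have "\<dots> \<le> \<eta> * y\<^sup>2 + (1 + 1 / \<eta>) * (x - y)\<^sup>2" using a by (simp add: algebra_simps)
      finally show ?thesis .
    qed
    have "\<bar>(\<integral>z. (f n z)\<^sup>2 \<partial>N) - G\<bar> = \<bar>\<integral>z. (f n z)\<^sup>2 - (g z)\<^sup>2 \<partial>N\<bar>" unfolding G_def using int gint by simp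
    also have "\<dots> \<le> (\<integral>z. \<bar>(f n z)\<^sup>2 - (g z)\<^sup>2\<bar> \<partial>N)" by (rule integral_abs_bound)
    also have "\<dots> \<le> (\<integral>z. \<eta> * (g z)\<^sup>2 + (1 + 1 / \<eta>) * (f n z - g z)\<^sup>2 \<partial>N)"
      using int[of n] gint n pt by (intro integral_mono) auto
    also have "\<dots> = \<eta> * G + (1 + 1 / \<eta>) * d n" using gint n by (simp add: G_def d_def)
    finally show ?thesis .
  qed
  show "(\<lambda>n. \<integral>z. (f n z)\<^sup>2 \<partial>N) \<longlonglongrightarrow> (\<integral>z. (g z)\<^sup>2 \<partial>N)"
    unfolding G_def[symmetric]
  proof (rule tendstoI)
    fix e :: real assume e: "0 < e"
    define \<eta> where "\<eta> = e / (2 * (G + 1))"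
    have \<eta>: "0 < \<eta>" using e G0 by (simp add: \<eta>_def)
    have \<eta>G: "\<eta> * G \<le> e / 2" using e G0 by (simp add: \<eta>_def field_simps)
    have "(\<lambda>n. (1 + 1 / \<eta>) * d n) \<longlonglongrightarrow> (1 + 1 / \<eta>) * 0" by (intro tendsto_intros d)
    hence "\<forall>\<^sub>F n in sequentially. (1 + 1 / \<eta>) * d n < e / 2" using e by (intro order_tendstoD(2)[where y=0 and a="e/2"]) auto
    thus "\<forall>\<^sub>F n in sequentially. dist (\<integral>z. (f n z)\<^sup>2 \<partial>N) G < e"
      using fin
    proof eventually_elim
      case (elim n)
      show ?case unfolding dist_real_def using bnd[OF elim(2) \<eta>] elim(1) \<eta>G by linarith
    qed
  qed
qed


lemma L2_converges_add:
  fixes f g :: "nat \<Rightarrow> 'a \<Rightarrow> real"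
  assumes [measurable]: "\<And>n. f n \<in> borel_measurable N" "f' \<in> borel_measurable N" "\<And>n. g n \<in> borel_measurable N" "g' \<in> borel_measurable N"
    and lim: "(\<lambda>n. \<integral>\<^sup>+z. ennreal ((f n z - f' z)\<^sup>2) \<partial>N) \<longlonglongrightarrow> 0" "(\<lambda>n. \<integral>\<^sup>+z. ennreal ((g n z - g' z)\<^sup>2) \<partial>N) \<longlonglongrightarrow> 0"
  shows "(\<lambda>n. \<integral>\<^sup>+z. ennreal (((f n z + g n z) - (f' z + g' z))\<^sup>2) \<partial>N) \<longlonglongrightarrow> 0"
proof (rule tendsto_sandwich[OF _ _ tendsto_const])
  let ?b = "\<lambda>n. 2 * (\<integral>\<^sup>+z. ennreal ((f n z - f' z)\<^sup>2) \<partial>N) + 2 * (\<integral>\<^sup>+z. ennreal ((g n z - g' z)\<^sup>2) \<partial>N)"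
  have sq: "((a + b) - (c + d))\<^sup>2 \<le> 2 * (a - c)\<^sup>2 + 2 * (b - d)\<^sup>2" for a b c d :: real
    using zero_le_power2[of "(a - c) - (b - d)"] by (simp add: power2_eq_square algebra_simps)
  have sqe: "ennreal (((a + b) - (c + d))\<^sup>2) \<le> 2 * ennreal ((a - c)\<^sup>2) + 2 * ennreal ((b - d)\<^sup>2)" for a b c d :: real
    using ennreal_leI[OF sq[of a b c d]] by (simp add: ennreal_plus ennreal_mult)
  have "(\<integral>\<^sup>+z. ennreal (((f n z + g n z) - (f' z + g' z))\<^sup>2) \<partial>N) \<le> (\<integral>\<^sup>+z. 2 * ennreal ((f n z - f' z)\<^sup>2) + 2 * ennreal ((g n z - g' z)\<^sup>2) \<partial>N)" for n
    using sqe by (intro nn_integral_mono) auto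
  thus "\<forall>\<^sub>F n in sequentially. (\<integral>\<^sup>+z. ennreal (((f n z + g n z) - (f' z + g' z))\<^sup>2) \<partial>N) \<le> ?b n"
    by (simp add: nn_integral_add nn_integral_cmult)
  have "?b \<longlonglongrightarrow> 2 * 0 + 2 * 0" by (intro tendsto_add ennreal_tendsto_cmult lim) auto
  thus "?b \<longlonglongrightarrow> 0" by simp
qed simp

lemma L2_converges_scale:
  fixes f :: "nat \<Rightarrow> 'a \<Rightarrow> real"
  assumes [measurable]: "\<And>n. f n \<in> borel_measurable N" "f' \<in> borel_measurable N"
    and lim: "(\<lambda>n. \<integral>\<^sup>+z. ennreal ((f n z - f' z)\<^sup>2) \<partial>N) \<longlonglongrightarrow> 0"
  shows "(\<lambda>n. \<integral>\<^sup>+z. ennreal ((c * f n z - c * f' z)\<^sup>2) \<partial>N) \<longlonglongrightarrow> 0"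
proof -
  have sq: "ennreal ((c * a - c * b)\<^sup>2) = ennreal (c\<^sup>2) * ennreal ((a - b)\<^sup>2)" for a b :: real
    by (simp add: ennreal_mult[symmetric] right_diff_distrib[symmetric] power_mult_distrib)
  have "(\<lambda>n. ennreal (c\<^sup>2) * (\<integral>\<^sup>+z. ennreal ((f n z - f' z)\<^sup>2) \<partial>N)) \<longlonglongrightarrow> ennreal (c\<^sup>2) * 0"
    by (intro ennreal_tendsto_cmult lim) auto
  thus ?thesis unfolding sq by (simp add: nn_integral_cmult)
qed

lemma (in prob_space) char_L2_limit:
  fixes f :: "nat \<Rightarrow> 'a \<Rightarrow> real"
  assumes [measurable]: "\<And>n. f n \<in> borel_measurable M" "g \<in> borel_measurable M"
    and ev: "\<forall>\<^sub>F n in sequentially. integrable M (\<lambda>z. (f n z - g z)\<^sup>2)"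
    and lim: "(\<lambda>n. \<integral>z. (f n z - g z)\<^sup>2 \<partial>M) \<longlonglongrightarrow> 0"
  shows "(\<lambda>n. CLINT z|M. iexp (f n z)) \<longlonglongrightarrow> (CLINT z|M. iexp (g z))"
proof (rule tendstoI)
  fix e :: real assume e: "0 < e"
  have "(\<lambda>n. (\<integral>z. (f n z - g z)\<^sup>2 \<partial>M) / e) \<longlonglongrightarrow> 0 / e" by (intro tendsto_divide lim tendsto_const) (use e in auto)
  hence "\<forall>\<^sub>F n in sequentially. (\<integral>z. (f n z - g z)\<^sup>2 \<partial>M) / e < e / 2" using e by (intro order_tendstoD(2)[where y="0/e"]) auto
  thus "\<forall>\<^sub>F n in sequentially. dist (CLINT z|M. iexp (f n z)) (CLINT z|M. iexp (g z)) < e"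
    using ev
  proof eventually_elim
    case (elim n)
    have i: "integrable M (\<lambda>z. iexp (h z))" if [measurable]: "h \<in> borel_measurable M" for h :: "'a \<Rightarrow> real"
      by (intro integrable_const_bound[of _ 1]) auto
    \<comment> \<open>The map \<open>iexp\<close> is Lipschitz with constant 1; the weighted Young
      inequality turns the first-order distance into the quadratic one, which is known to vanish in
      the limit.\<close>
    have pt: "cmod (iexp x - iexp y) \<le> e / 2 + (x - y)\<^sup>2 / (2 * e)" for x y
    proof -
      have "iexp x - iexp y = iexp y * (iexp (x - y) - 1)" by (simp add: algebra_simps exp_add[symmetric])
      hence "cmod (iexp x - iexp y) = cmod (iexp (x - y) - 1)" by (simp add: norm_mult)
      also have "\<dots> \<le> \<bar>x - y\<bar>" using iexp_approx1[of "x - y" 0] by simp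
      also have "\<dots> \<le> e / 2 + (x - y)\<^sup>2 / (2 * e)"
      proof -
        have "0 \<le> (\<bar>x - y\<bar> - e)\<^sup>2" by simp
        hence "2 * e * \<bar>x - y\<bar> \<le> e\<^sup>2 + (x - y)\<^sup>2" by (simp add: power2_diff algebra_simps)
        thus ?thesis using e by (simp add: field_simps power2_eq_square)
      qed
      finally show ?thesis .
    qed
    have "dist (CLINT z|M. iexp (f n z)) (CLINT z|M. iexp (g z)) = cmod (CLINT z|M. iexp (f n z) - iexp (g z))"
      using i by (simp add: dist_norm)
    also have "\<dots> \<le> (\<integral>z. cmod (iexp (f n z) - iexp (g z)) \<partial>M)" by (rule integral_norm_bound)
    also have "\<dots> \<le> (\<integral>z. e / 2 + (f n z - g z)\<^sup>2 / (2 * e) \<partial>M)"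
      using i elim(2) pt by (intro integral_mono integrable_norm Bochner_Integration.integrable_diff Bochner_Integration.integrable_add) auto
    also have "\<dots> = e / 2 + (\<integral>z. (f n z - g z)\<^sup>2 \<partial>M) / (2 * e)"
      using elim(2) prob_space by simp
    also have "\<dots> < e"
    proof -
      define r where "r = (\<integral>z. (f n z - g z)\<^sup>2 \<partial>M) / e"
      have "(\<integral>z. (f n z - g z)\<^sup>2 \<partial>M) / (2 * e) = r / 2" by (simp add: r_def)
      moreover have "r < e / 2" using elim(1) by (simp only: r_def)
      ultimately show ?thesis using e by linarith
    qed
    finally show ?case .
  qed
qed

section \<open>The Gaussian space of Wiener integrals\<close>

context sheet
begin

definition wiener_space :: "('w \<Rightarrow> real) set" where
  "wiener_space = {X. \<exists>h. has_wiener_integral M W h X}"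

lemma slab_integral_eq:
  "(\<integral>\<^sup>+z\<in>slab. ennreal ((f z - h z)\<^sup>2) \<partial>lborel) = (\<integral>\<^sup>+z. ennreal ((indicator slab z * f z - indicator slab z * h z)\<^sup>2) \<partial>lborel)"
  by (intro nn_integral_cong) (auto simp: indicator_def)

lemma has_wiener_integralI:
  assumes "\<And>n. valid_step (L n)"
    and "(\<lambda>n. \<integral>\<^sup>+z. ennreal ((indicator slab z * step_fun (L n) z - indicator slab z * h z)\<^sup>2) \<partial>lborel) \<longlonglongrightarrow> 0"
    and "(\<lambda>n. \<integral>\<^sup>+\<omega>. ennreal ((step_integral W (L n) \<omega> - X \<omega>)\<^sup>2) \<partial>M) \<longlonglongrightarrow> 0"
    and "(\<lambda>z. indicator slab z * h z) \<in> borel_measurable lborel" "X \<in> borel_measurable M"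
  shows "has_wiener_integral M W h X"
  unfolding has_wiener_integral_def slab_integral_eq using assms by (auto simp: set_borel_measurable_def)

lemma has_wiener_integral_alt:
  assumes "has_wiener_integral M W h X"
  obtains L where "\<And>n. valid_step (L n)"
    "(\<lambda>n. \<integral>\<^sup>+z. ennreal ((indicator slab z * step_fun (L n) z - indicator slab z * h z)\<^sup>2) \<partial>lborel) \<longlonglongrightarrow> 0"
    "(\<lambda>n. \<integral>\<^sup>+\<omega>. ennreal ((step_integral W (L n) \<omega> - X \<omega>)\<^sup>2) \<partial>M) \<longlonglongrightarrow> 0"
  using assms unfolding has_wiener_integral_def slab_integral_eq by blast

lemma wiener_integrand_measurable:
  assumes "has_wiener_integral M W h X"
  shows "\<And>L. (\<lambda>z. indicator slab z * step_fun L z) \<in> borel_measurable lborel"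
    "(\<lambda>z. indicator slab z * h z) \<in> borel_measurable lborel"
proof -
  have [measurable]: "slab \<in> sets borel" "\<And>L. step_fun L \<in> borel_measurable borel"
    by (auto intro!: borel_Times step_fun_measurable)
  show "(\<lambda>z. indicator slab z * step_fun L z) \<in> borel_measurable lborel" for L by measurable
  show "(\<lambda>z. indicator slab z * h z) \<in> borel_measurable lborel"
    using assms by (simp add: has_wiener_integral_def set_borel_measurable_def)
qed

lemma step_integral_measurable: "valid_step L \<Longrightarrow> step_integral W L \<in> borel_measurable M"
  by (intro lincomb_measurable step_lincomb)

text \<open>Isometry and Gaussian characteristic functions hold for step functions and pass to the
  limit in mean square.\<close>

lemma wiener_integral_props:
  assumes "has_wiener_integral M W h X"
  shows "X \<in> borel_measurable M" "integrable M (\<lambda>\<omega>. (X \<omega>)\<^sup>2)" "integrable lborel (\<lambda>z. (indicator slab z * h z)\<^sup>2)"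
    "(\<integral>\<omega>. (X \<omega>)\<^sup>2 \<partial>M) = (\<integral>z. (indicator slab z * h z)\<^sup>2 \<partial>lborel)"
    "(CLINT \<omega>|M. iexp (X \<omega>)) = complex_of_real (exp (- (\<integral>\<omega>. (X \<omega>)\<^sup>2 \<partial>M) / 2))"
proof -
  show X[measurable]: "X \<in> borel_measurable M" using assms by (simp add: has_wiener_integral_def)
  obtain L where L: "\<And>n. valid_step (L n)"
    "(\<lambda>n. \<integral>\<^sup>+z. ennreal ((indicator slab z * step_fun (L n) z - indicator slab z * h z)\<^sup>2) \<partial>lborel) \<longlonglongrightarrow> 0"
    "(\<lambda>n. \<integral>\<^sup>+\<omega>. ennreal ((step_integral W (L n) \<omega> - X \<omega>)\<^sup>2) \<partial>M) \<longlonglongrightarrow> 0"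
    using has_wiener_integral_alt[OF assms] by blast
  note m1 = wiener_integrand_measurable(1)[OF assms] and h = wiener_integrand_measurable(2)[OF assms]
  note m2 = step_integral_measurable[OF L(1)]
  note A = L2_limit[OF m1 h step_isometry(1)[OF L(1)] L(2)]
  note B = L2_limit[OF m2 X lincomb_square[OF step_lincomb[OF L(1)]] L(3)]
  show "integrable M (\<lambda>\<omega>. (X \<omega>)\<^sup>2)" by (rule B(1))
  show "integrable lborel (\<lambda>z. (indicator slab z * h z)\<^sup>2)" by (rule A(1))
  show "(\<integral>\<omega>. (X \<omega>)\<^sup>2 \<partial>M) = (\<integral>z. (indicator slab z * h z)\<^sup>2 \<partial>lborel)"
    using LIMSEQ_unique[OF B(2)] A(2) step_isometry(2)[OF L(1)] by simp
  have "(\<lambda>n. CLINT \<omega>|M. iexp (step_integral W (L n) \<omega>)) \<longlonglongrightarrow> (CLINT \<omega>|M. iexp (X \<omega>))"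
    by (rule char_L2_limit[OF m2 X B(4) B(3)])
  moreover have "(\<lambda>n. CLINT \<omega>|M. iexp (step_integral W (L n) \<omega>)) \<longlonglongrightarrow> complex_of_real (exp (- (\<integral>\<omega>. (X \<omega>)\<^sup>2 \<partial>M) / 2))"
    unfolding lincomb_char[OF step_lincomb[OF L(1)]] by (intro tendsto_intros B(2)) simp
  ultimately show "(CLINT \<omega>|M. iexp (X \<omega>)) = complex_of_real (exp (- (\<integral>\<omega>. (X \<omega>)\<^sup>2 \<partial>M) / 2))"
    by (rule LIMSEQ_unique)
qed

lemma has_wiener_integral_add:
  assumes "has_wiener_integral M W h X" "has_wiener_integral M W g Y"
  shows "has_wiener_integral M W (\<lambda>z. h z + g z) (\<lambda>\<omega>. X \<omega> + Y \<omega>)"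
proof -
  obtain L where L: "\<And>n. valid_step (L n)"
    "(\<lambda>n. \<integral>\<^sup>+z. ennreal ((indicator slab z * step_fun (L n) z - indicator slab z * h z)\<^sup>2) \<partial>lborel) \<longlonglongrightarrow> 0"
    "(\<lambda>n. \<integral>\<^sup>+\<omega>. ennreal ((step_integral W (L n) \<omega> - X \<omega>)\<^sup>2) \<partial>M) \<longlonglongrightarrow> 0"
    using has_wiener_integral_alt[OF assms(1)] by blast
  obtain L' where L': "\<And>n. valid_step (L' n)"
    "(\<lambda>n. \<integral>\<^sup>+z. ennreal ((indicator slab z * step_fun (L' n) z - indicator slab z * g z)\<^sup>2) \<partial>lborel) \<longlonglongrightarrow> 0"
    "(\<lambda>n. \<integral>\<^sup>+\<omega>. ennreal ((step_integral W (L' n) \<omega> - Y \<omega>)\<^sup>2) \<partial>M) \<longlonglongrightarrow> 0"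
    using has_wiener_integral_alt[OF assms(2)] by blast
  note m = wiener_integrand_measurable[OF assms(1)] wiener_integrand_measurable[OF assms(2)]
  have X: "X \<in> borel_measurable M" "Y \<in> borel_measurable M" using assms by (auto simp: has_wiener_integral_def)
  define Q where "Q n = L n @ L' n" for n
  show ?thesis
  proof (rule has_wiener_integralI)
    show "valid_step (Q n)" for n using L(1)[of n] L'(1)[of n] by (auto simp: valid_step_def Q_def)
    have "indicator slab z * step_fun (Q n) z = indicator slab z * step_fun (L n) z + indicator slab z * step_fun (L' n) z" for n z
      by (simp add: Q_def step_fun_def distrib_left)
    thus "(\<lambda>n. \<integral>\<^sup>+z. ennreal ((indicator slab z * step_fun (Q n) z - indicator slab z * (h z + g z))\<^sup>2) \<partial>lborel) \<longlonglongrightarrow> 0"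
      using L2_converges_add[OF m(1)[of "L _"] m(2) m(3)[of "L' _"] m(4) L(2) L'(2)] by (simp add: distrib_left)
    have "step_integral W (Q n) \<omega> = step_integral W (L n) \<omega> + step_integral W (L' n) \<omega>" for n \<omega>
      by (simp add: Q_def step_integral_def)
    thus "(\<lambda>n. \<integral>\<^sup>+\<omega>. ennreal ((step_integral W (Q n) \<omega> - (X \<omega> + Y \<omega>))\<^sup>2) \<partial>M) \<longlonglongrightarrow> 0"
      using L2_converges_add[OF step_integral_measurable[OF L(1)] X(1) step_integral_measurable[OF L'(1)] X(2) L(3) L'(3)] by simp
    show "(\<lambda>z. indicator slab z * (h z + g z)) \<in> borel_measurable lborel"
      using borel_measurable_add[OF m(2) m(4)] by (simp add: distrib_left)
  qed (use X in simp)
qed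

lemma has_wiener_integral_scale:
  assumes "has_wiener_integral M W h X"
  shows "has_wiener_integral M W (\<lambda>z. c * h z) (\<lambda>\<omega>. c * X \<omega>)"
proof -
  obtain L where L: "\<And>n. valid_step (L n)"
    "(\<lambda>n. \<integral>\<^sup>+z. ennreal ((indicator slab z * step_fun (L n) z - indicator slab z * h z)\<^sup>2) \<partial>lborel) \<longlonglongrightarrow> 0"
    "(\<lambda>n. \<integral>\<^sup>+\<omega>. ennreal ((step_integral W (L n) \<omega> - X \<omega>)\<^sup>2) \<partial>M) \<longlonglongrightarrow> 0"
    using has_wiener_integral_alt[OF assms] by blast
  note m = wiener_integrand_measurable[OF assms]
  have X: "X \<in> borel_measurable M" using assms by (auto simp: has_wiener_integral_def)
  define Q where "Q n = map (\<lambda>(q, a, b, x, y). (c * q, a, b, x, y)) (L n)" for n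
  show ?thesis
  proof (rule has_wiener_integralI)
    show "valid_step (Q n)" for n using L(1)[of n] by (auto simp: valid_step_def Q_def)
    have e: "indicator slab z * step_fun (Q n) z = c * (indicator slab z * step_fun (L n) z)" "indicator slab z * (c * h z) = c * (indicator slab z * h z)" for n z
      by (simp_all add: Q_def step_fun_def sum_list_const_mult[symmetric] comp_def case_prod_unfold ac_simps)
    show "(\<lambda>n. \<integral>\<^sup>+z. ennreal ((indicator slab z * step_fun (Q n) z - indicator slab z * (c * h z))\<^sup>2) \<partial>lborel) \<longlonglongrightarrow> 0"
      unfolding e by (rule L2_converges_scale[OF m(1) m(2) L(2)])
    have "step_integral W (Q n) \<omega> = c * step_integral W (L n) \<omega>" for n \<omega>
      by (simp add: Q_def step_integral_def sum_list_const_mult[symmetric] comp_def case_prod_unfold mult.assoc)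
    thus "(\<lambda>n. \<integral>\<^sup>+\<omega>. ennreal ((step_integral W (Q n) \<omega> - c * X \<omega>)\<^sup>2) \<partial>M) \<longlonglongrightarrow> 0"
      using L2_converges_scale[OF step_integral_measurable[OF L(1)] X L(3), of c] by simp
    show "(\<lambda>z. indicator slab z * (c * h z)) \<in> borel_measurable lborel"
      using borel_measurable_times[OF borel_measurable_const[of c] m(2)] by (simp add: ac_simps)
  qed (use X in simp)
qed

lemma has_wiener_integral_zero: "has_wiener_integral M W (\<lambda>_. 0) (\<lambda>_. 0)"
  unfolding has_wiener_integral_def
  by (intro conjI exI[of _ "\<lambda>_. []"]) (auto simp: set_borel_measurable_def valid_step_def step_fun_def step_integral_def)

lemma gaussian_space_wiener: "gaussian_space M wiener_space"
proof
  show "(\<lambda>_. 0) \<in> wiener_space" unfolding wiener_space_def using has_wiener_integral_zero by blast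
  show "X \<in> borel_measurable M" "integrable M (\<lambda>\<omega>. (X \<omega>)\<^sup>2)" "(CLINT \<omega>|M. iexp (X \<omega>)) = complex_of_real (exp (- (\<integral>\<omega>. (X \<omega>)\<^sup>2 \<partial>M) / 2))" if "X \<in> wiener_space" for X
    using that wiener_integral_props unfolding wiener_space_def by blast+
  show "(\<lambda>\<omega>. X \<omega> + Y \<omega>) \<in> wiener_space" if "X \<in> wiener_space" "Y \<in> wiener_space" for X Y
    using that has_wiener_integral_add unfolding wiener_space_def by blast
  show "(\<lambda>\<omega>. c * X \<omega>) \<in> wiener_space" if "X \<in> wiener_space" for X c
    using that has_wiener_integral_scale unfolding wiener_space_def by blast
qed

text \<open>Polarisation of the isometry, applied to the two integrands and their sum.\<close>

lemma wiener_covariance: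
  assumes h: "has_wiener_integral M W h X" and g: "has_wiener_integral M W g Y"
  shows "integrable lborel (\<lambda>z. (indicator slab z * h z) * (indicator slab z * g z))"
    "gaussian_space.ip M X Y = (\<integral>z. (indicator slab z * h z) * (indicator slab z * g z) \<partial>lborel)"
proof -
  interpret gaussian_space M wiener_space by (rule gaussian_space_wiener)
  have mem: "X \<in> wiener_space" "Y \<in> wiener_space" using h g by (auto simp: wiener_space_def)
  note hg = has_wiener_integral_add[OF h g]
  define H where "H z = indicator slab z * h z" for z
  define G where "G z = indicator slab z * g z" for z
  have e: "indicator slab z * (h z + g z) = H z + G z" for z by (simp add: H_def G_def distrib_left)
  have iH: "integrable lborel (\<lambda>z. (H z)\<^sup>2)" "integrable lborel (\<lambda>z. (G z)\<^sup>2)" "integrable lborel (\<lambda>z. (H z + G z)\<^sup>2)"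
    unfolding H_def G_def using wiener_integral_props(3)[OF h] wiener_integral_props(3)[OF g] wiener_integral_props(3)[OF hg] by (simp_all add: distrib_left)
  have pol: "H z * G z = ((H z + G z)\<^sup>2 - (H z)\<^sup>2 - (G z)\<^sup>2) / 2" for z by (simp add: power2_sum)
  have "integrable lborel (\<lambda>z. H z * G z)" unfolding pol using iH by simp
  thus "integrable lborel (\<lambda>z. (indicator slab z * h z) * (indicator slab z * g z))" by (simp add: H_def G_def)
  have i2: "ip X X = (\<integral>z. (H z)\<^sup>2 \<partial>lborel)" "ip Y Y = (\<integral>z. (G z)\<^sup>2 \<partial>lborel)"
    "ip (\<lambda>\<omega>. X \<omega> + Y \<omega>) (\<lambda>\<omega>. X \<omega> + Y \<omega>) = (\<integral>z. (H z + G z)\<^sup>2 \<partial>lborel)"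
    unfolding ip_self H_def G_def using wiener_integral_props(4)[OF h] wiener_integral_props(4)[OF g] wiener_integral_props(4)[OF hg] by (simp_all add: distrib_left)
  have "ip (\<lambda>\<omega>. X \<omega> + Y \<omega>) (\<lambda>\<omega>. X \<omega> + Y \<omega>) = ip X X + 2 * ip X Y + ip Y Y"
    using mem by (simp add: ip_add ip_add2 add_mem ip_commute[of Y X])
  hence "ip X Y = (\<integral>z. ((H z + G z)\<^sup>2 - (H z)\<^sup>2 - (G z)\<^sup>2) / 2 \<partial>lborel)" using iH i2 by simp
  also have "\<dots> = (\<integral>z. H z * G z \<partial>lborel)" by (simp only: pol)
  finally show "ip X Y = (\<integral>z. (indicator slab z * h z) * (indicator slab z * g z) \<partial>lborel)" by (simp add: H_def G_def)
qed

end

section \<open>The covariance of the stochastic heat equation\<close>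

text \<open>
  For Dirichlet conditions the function with index \<open>0\<close> vanishes; it is included to have the same index set in both cases.
\<close>

definition eigenfun :: "boundary_condition \<Rightarrow> nat \<Rightarrow> real \<Rightarrow> real" where
  "eigenfun bc n v = (case bc of
      Neumann \<Rightarrow> if n = 0 then 1 else sqrt 2 * cos (real n * pi * v)
    | Dirichlet \<Rightarrow> sqrt 2 * sin (real n * pi * v))"

definition eigenval :: "nat \<Rightarrow> real" where "eigenval n = pi\<^sup>2 * (real n)\<^sup>2"

lemma eigenval_nonneg: "0 \<le> eigenval n" by (simp add: eigenval_def)

lemma eigenval_pos: "0 < n \<Longrightarrow> 0 < eigenval n" by (simp add: eigenval_def)

lemma eigenval_0: "eigenval 0 = 0" by (simp add: eigenval_def)

lemma eigenval_mono: "m \<le> n \<Longrightarrow> eigenval m \<le> eigenval n"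
  by (simp add: eigenval_def power_mono)

lemma eigenval_ge: "(real n)\<^sup>2 \<le> eigenval n"
proof -
  have "1 * (real n)\<^sup>2 \<le> pi\<^sup>2 * (real n)\<^sup>2" using pi_gt3 by (intro mult_right_mono one_le_power) auto
  thus ?thesis by (simp add: eigenval_def)
qed

lemma eigenfun_sq_le: "(eigenfun bc n v)\<^sup>2 \<le> 2"
  by (cases bc) (auto simp: eigenfun_def power_mult_distrib abs_square_le_1)

lemma abs_eigenfun_le: "\<bar>eigenfun bc n v\<bar> \<le> sqrt 2"
  using real_sqrt_le_mono[OF eigenfun_sq_le[of bc n v]] by simp

lemma abs_eigenfun_prod_le: "\<bar>eigenfun bc n x * eigenfun bc m v\<bar> \<le> 2"
proof -
  have "\<bar>eigenfun bc n x\<bar> * \<bar>eigenfun bc m v\<bar> \<le> sqrt 2 * sqrt 2" by (intro mult_mono abs_eigenfun_le) auto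
  thus ?thesis by (simp add: abs_mult)
qed

lemma eigenfun_measurable[measurable]: "eigenfun bc n \<in> borel_measurable borel"
  unfolding eigenfun_def[abs_def] by (cases bc) auto

lemma summable_exp_eigenval: assumes "0 < t" shows "summable (\<lambda>n. exp (- eigenval n * t))"
proof (rule summable_comparison_test')
  show "summable (\<lambda>n. (exp (- t)) ^ n)" using assms by (intro summable_geometric) auto
  fix n :: nat
  have "real n \<le> (real n)\<^sup>2" by (cases n) (auto simp: power2_eq_square)
  hence "real n \<le> eigenval n" using eigenval_ge[of n] by linarith
  hence "real n * t \<le> eigenval n * t" using assms by (intro mult_right_mono) auto
  thus "norm (exp (- eigenval n * t)) \<le> exp (- t) ^ n" by (simp add: exp_of_nat_mult[symmetric] mult.commute)
qed

lemma green_terms_summable: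
  assumes "0 < t" shows "summable (\<lambda>n. exp (- eigenval n * t) * (eigenfun bc n x * eigenfun bc n v))"
proof (rule summable_comparison_test')
  show "summable (\<lambda>n. exp (- eigenval n * t) * 2)" using summable_exp_eigenval[OF assms] by (rule summable_mult2)
  fix n show "norm (exp (- eigenval n * t) * (eigenfun bc n x * eigenfun bc n v)) \<le> exp (- eigenval n * t) * 2"
    using abs_eigenfun_prod_le[of bc n x n v] by (simp add: abs_mult)
qed

text \<open>One series for both boundary conditions: the two factors \<open>sqrt 2\<close> produce
  the 2 in front of the series, and the term with index 0 is the 1 of the Neumann kernel and
  vanishes in the Dirichlet case.\<close>

lemma green_eq_suminf:
  assumes "0 < t" shows "green bc t x v = (\<Sum>n. exp (- eigenval n * t) * (eigenfun bc n x * eigenfun bc n v))"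
proof -
  let ?f = "\<lambda>n. exp (- eigenval n * t) * (eigenfun bc n x * eigenfun bc n v)"
  have "suminf ?f = ?f 0 + (\<Sum>n. ?f (Suc n))"
    using suminf_split_head[OF green_terms_summable[OF assms, of bc x v]] by simp
  also have "(\<Sum>n. ?f (Suc n)) = 2 * (\<Sum>n. ?f (Suc n) / 2)"
    using summable_divide[OF summable_Suc_iff[THEN iffD2, OF green_terms_summable[OF assms, of bc x v]], of 2] by (subst suminf_mult[symmetric]) auto
  finally have S: "suminf ?f = ?f 0 + 2 * (\<Sum>n. ?f (Suc n) / 2)" .
  have N: "?f (Suc n) / 2 = exp (- (pi\<^sup>2 * (real (Suc n))\<^sup>2 * t)) * cos (real (Suc n) * pi * x) * cos (real (Suc n) * pi * v)" if "bc = Neumann" for n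
    using that by (simp add: eigenfun_def eigenval_def)
  have D: "?f (Suc n) / 2 = exp (- (pi\<^sup>2 * (real (Suc n))\<^sup>2 * t)) * sin (real (Suc n) * pi * x) * sin (real (Suc n) * pi * v)" if "bc = Dirichlet" for n
    using that by (simp add: eigenfun_def eigenval_def)
  show ?thesis
  proof (cases bc)
    case Neumann
    show ?thesis unfolding S N[OF Neumann] by (simp add: Neumann eigenfun_def eigenval_def)
  next
    case Dirichlet
    show ?thesis unfolding S D[OF Dirichlet] by (simp add: Dirichlet eigenfun_def eigenval_def)
  qed
qed

lemma integral_cos_pi:
  "(\<integral>v. cos (of_int k * pi * v) * indicator {0..1} v \<partial>lborel) = (if k = 0 then 1 else 0)"
proof (cases "k = 0")
  case False
  have "(\<integral>v. cos (of_int k * pi * v) * indicator {0..1} v \<partial>lborel) = sin (of_int k * pi * 1) / (of_int k * pi) - sin (of_int k * pi * 0) / (of_int k * pi)"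
    using False by (intro integral_FTC_Icc_real) (auto intro!: derivative_eq_intros continuous_intros)
  also have "sin (of_int k * pi * 1) = 0" using sin_integer_2pi[of "of_int k / 2"] by (simp add: sin_zero_iff_int2)
  finally show ?thesis using False by simp
qed simp

lemma eigenfun_orthogonal:
  "(\<integral>v. eigenfun bc m v * eigenfun bc n v * indicator {0..1} v \<partial>lborel)
    = (if m = n then (if n = 0 \<and> bc = Dirichlet then 0 else 1) else 0)"
proof -
  define I where "I k = (\<integral>v. cos (of_int k * pi * v) * indicator {0..1} v \<partial>lborel)" for k :: int
  have int: "integrable lborel (\<lambda>v. cos (of_int k * pi * v) * indicator {0..1} v)" for k :: int
    by (rule Bochner_Integration.integrable_bound[OF integrable_real_indicator[of "{0..1::real}"]]) (auto simp: indicator_def)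
  \<comment> \<open>Frequencies of the product-to-sum formulas; \<open>s\<close> vanishes only for
    \<open>m = n = 0\<close>, which is the exceptional Dirichlet case.\<close>
  define d where "d = int m - int n" define s where "s = int m + int n"
  have c: "cos (real m * pi * v) * cos (real n * pi * v) = (cos (of_int d * pi * v) + cos (of_int s * pi * v)) / 2"
    "sin (real m * pi * v) * sin (real n * pi * v) = (cos (of_int d * pi * v) - cos (of_int s * pi * v)) / 2" for v
    by (simp_all add: cos_times_cos sin_times_sin d_def s_def algebra_simps)
  have s2: "sqrt 2 * (sqrt 2 * x) = 2 * x" for x :: real by (simp add: mult.assoc[symmetric])
  have Ik: "I k = (if k = 0 then 1 else 0)" for k unfolding I_def by (rule integral_cos_pi)
  show ?thesis
  proof (cases bc)
    case Dirichlet
    have "(\<integral>v. eigenfun bc m v * eigenfun bc n v * indicator {0..1} v \<partial>lborel) = (\<integral>v. cos (of_int d * pi * v) * indicator {0..1} v - cos (of_int s * pi * v) * indicator {0..1} v \<partial>lborel)"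
      unfolding Dirichlet eigenfun_def using c(2) by (intro Bochner_Integration.integral_cong) (auto simp: algebra_simps indicator_def s2)
    also have "\<dots> = I d - I s" unfolding I_def using int by (intro Bochner_Integration.integral_diff)
    finally show ?thesis unfolding Ik d_def s_def Dirichlet by auto
  next
    case Neumann
    show ?thesis
    proof (cases "m = 0 \<or> n = 0")
      case True
      define k where "k = (if m = 0 then n else m)"
      define c where "c = (if k = 0 then 1 else sqrt 2)"
      have "(\<integral>v. eigenfun bc m v * eigenfun bc n v * indicator {0..1} v \<partial>lborel) = (\<integral>v. c * (cos (of_int (int k) * pi * v) * indicator {0..1} v) \<partial>lborel)"
        unfolding Neumann eigenfun_def using True by (intro Bochner_Integration.integral_cong) (auto simp: k_def c_def)
      also have "\<dots> = c * I (int k)" by (simp add: I_def)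
      finally show ?thesis using True unfolding Ik Neumann by (auto simp: k_def c_def)
    next
      case False
      have "(\<integral>v. eigenfun bc m v * eigenfun bc n v * indicator {0..1} v \<partial>lborel) = (\<integral>v. cos (of_int d * pi * v) * indicator {0..1} v + cos (of_int s * pi * v) * indicator {0..1} v \<partial>lborel)"
        unfolding Neumann eigenfun_def using c(1) False by (intro Bochner_Integration.integral_cong) (auto simp: algebra_simps indicator_def s2)
      also have "\<dots> = I d + I s" unfolding I_def using int by (intro Bochner_Integration.integral_add)
      finally show ?thesis using False unfolding Ik d_def s_def Neumann by auto
    qed
  qed
qed

text \<open>Stated for a bounded \<open>g\<close> because it is applied both to eigenfunctions and
  to the kernel itself.\<close>

lemma integral_eigenfun_series:
  fixes c :: "nat \<Rightarrow> real"
  assumes c: "summable (\<lambda>n. \<bar>c n\<bar>)" and g[measurable]: "g \<in> borel_measurable borel" and B: "\<And>v. \<bar>g v\<bar> \<le> B"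
  shows "(\<integral>v. (\<Sum>n. c n * eigenfun bc n v) * g v * indicator {0..1} v \<partial>lborel)
    = (\<Sum>n. c n * (\<integral>v. eigenfun bc n v * g v * indicator {0..1} v \<partial>lborel))"
proof -
  have B0: "0 \<le> B" using B[of 0] by linarith
  define f where "f n v = c n * eigenfun bc n v * g v * indicator {0..1} v" for n v
  have fb: "\<bar>f n v\<bar> \<le> (\<bar>c n\<bar> * sqrt 2 * B) * indicator {0..1} v" for n v
    unfolding f_def abs_mult using B[of v] abs_eigenfun_le[of bc n v] B0
    by (intro mult_mono) (auto simp: indicator_def)
  have ib: "integrable lborel (\<lambda>v. (\<bar>c n\<bar> * sqrt 2 * B) * indicator {0..1::real} v)" for n by (intro integrable_mult_right integrable_real_indicator) auto
  have fm[measurable]: "f n \<in> borel_measurable borel" for n unfolding f_def by measurable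
  have int: "integrable lborel (f n)" for n
    by (rule Bochner_Integration.integrable_bound[OF ib[of n]]) (use fb[of n] in \<open>auto intro!: always_eventually order_trans[OF _ abs_ge_self]\<close>)
  have sm: "summable (\<lambda>n. \<bar>c n\<bar> * sqrt 2 * B)" using c by (intro summable_mult2)
  have "(\<integral>v. (\<Sum>n. f n v) \<partial>lborel) = (\<Sum>n. \<integral>v. f n v \<partial>lborel)"
  proof (rule integral_suminf[OF int])
    have "summable (\<lambda>n. norm (f n v))" for v
    proof (rule summable_comparison_test'[OF sm])
      fix n show "norm (norm (f n v)) \<le> \<bar>c n\<bar> * sqrt 2 * B" using order_trans[OF fb[of n v]] B0 by (auto simp: indicator_def)
    qed
    thus "AE v in lborel. summable (\<lambda>n. norm (f n v))" by simp
    show "summable (\<lambda>n. \<integral>v. norm (f n v) \<partial>lborel)"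
    proof (rule summable_comparison_test'[OF sm])
      fix n
      have "(\<integral>v. norm (f n v) \<partial>lborel) \<le> (\<integral>v. (\<bar>c n\<bar> * sqrt 2 * B) * indicator {0..1::real} v \<partial>lborel)"
        
        by (rule integral_mono_AE[OF integrable_norm[OF int] ib]) (use fb[of n] in auto)
      thus "norm (\<integral>v. norm (f n v) \<partial>lborel) \<le> \<bar>c n\<bar> * sqrt 2 * B" by simp
    qed
  qed
  moreover have "(\<Sum>n. f n v) = (\<Sum>n. c n * eigenfun bc n v) * g v * indicator {0..1} v" for v
  proof -
    have "summable (\<lambda>n. c n * eigenfun bc n v)"
    proof (rule summable_comparison_test')
      show "summable (\<lambda>n. \<bar>c n\<bar> * sqrt 2)" using c by (rule summable_mult2)
      fix n show "norm (c n * eigenfun bc n v) \<le> \<bar>c n\<bar> * sqrt 2" using abs_eigenfun_le[of bc n v] by (simp add: abs_mult mult_left_mono)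
    qed
    from suminf_mult2[OF this, of "g v * indicator {0..1} v"] show ?thesis by (simp add: f_def mult.assoc)
  qed
  moreover have "(\<integral>v. f n v \<partial>lborel) = c n * (\<integral>v. eigenfun bc n v * g v * indicator {0..1} v \<partial>lborel)" for n
    unfolding f_def by (simp add: mult.assoc)
  ultimately show ?thesis by simp
qed

lemma green_measurable_bounded:
  assumes "0 < t"
  shows "(\<lambda>v. green bc t y v) \<in> borel_measurable borel" "\<exists>B. \<forall>v. \<bar>green bc t y v\<bar> \<le> B"
proof -
  show "(\<lambda>v. green bc t y v) \<in> borel_measurable borel"
    unfolding green_eq_suminf[OF assms] by measurable
  have "\<bar>green bc t y v\<bar> \<le> (\<Sum>n. exp (- eigenval n * t) * 2)" for v
  proof -
    have "norm (green bc t y v) \<le> (\<Sum>n. exp (- eigenval n * t) * 2)"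
      unfolding green_eq_suminf[OF assms]
    proof (rule norm_suminf_le)
      show "summable (\<lambda>n. exp (- eigenval n * t) * 2)" using summable_exp_eigenval[OF assms] by (rule summable_mult2)
      fix n show "norm (exp (- eigenval n * t) * (eigenfun bc n y * eigenfun bc n v)) \<le> exp (- eigenval n * t) * 2"
        using abs_eigenfun_prod_le[of bc n y n v] by (simp add: abs_mult)
    qed
    thus ?thesis by simp
  qed
  thus "\<exists>B. \<forall>v. \<bar>green bc t y v\<bar> \<le> B" by blast
qed

lemma summable_green_coeff:
  assumes "0 < t" shows "summable (\<lambda>n. \<bar>exp (- eigenval n * t) * eigenfun bc n y\<bar>)"
proof (rule summable_comparison_test')
  show "summable (\<lambda>n. exp (- eigenval n * t) * sqrt 2)" using summable_exp_eigenval[OF assms] by (rule summable_mult2)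
  fix n show "norm \<bar>exp (- eigenval n * t) * eigenfun bc n y\<bar> \<le> exp (- eigenval n * t) * sqrt 2"
    using abs_eigenfun_le[of bc n y] by (simp add: abs_mult)
qed

text \<open>The Chapman-Kolmogorov identity on the diagonal, from the orthogonality of the
  eigenfunctions.\<close>

lemma integral_green_green:
  assumes a: "0 < a" and b: "0 < b"
  shows "(\<integral>v. green bc a y v * green bc b y v * indicator {0..1} v \<partial>lborel) = (\<Sum>n. exp (- eigenval n * (a + b)) * (eigenfun bc n y)\<^sup>2)"
proof -
  obtain B where B: "\<And>v. \<bar>green bc b y v\<bar> \<le> B" using green_measurable_bounded(2)[OF b] by blast
  have e: "green bc t y v = (\<Sum>n. exp (- eigenval n * t) * eigenfun bc n y * eigenfun bc n v)" if "0 < t" for t v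
    using green_eq_suminf[OF that] by (simp add: mult.assoc)
  have in1: "(\<integral>v. eigenfun bc m v * green bc b y v * indicator {0..1} v \<partial>lborel) = exp (- eigenval m * b) * eigenfun bc m y" for m
  proof -
    have "(\<integral>v. eigenfun bc m v * green bc b y v * indicator {0..1} v \<partial>lborel)
      = (\<integral>v. (\<Sum>n. exp (- eigenval n * b) * eigenfun bc n y * eigenfun bc n v) * eigenfun bc m v * indicator {0..1} v \<partial>lborel)"
      unfolding e[OF b] by (simp only: mult.commute)
    also have "\<dots> = (\<Sum>n. exp (- eigenval n * b) * eigenfun bc n y * (\<integral>v. eigenfun bc n v * eigenfun bc m v * indicator {0..1} v \<partial>lborel))"
      using summable_green_coeff[OF b] abs_eigenfun_le by (intro integral_eigenfun_series[where B = "sqrt 2"]) auto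
    \<comment> \<open>In the Dirichlet case the function with index 0 has norm 0 instead of 1, but
      its coefficient vanishes too.\<close>
    also have "\<dots> = (\<Sum>n. if n = m then exp (- eigenval m * b) * eigenfun bc m y else 0)"
      unfolding eigenfun_orthogonal by (intro suminf_cong) (auto simp: eigenfun_def)
    also have "\<dots> = exp (- eigenval m * b) * eigenfun bc m y"
      by (subst suminf_finite[of "{m}"]) auto
    finally show ?thesis .
  qed
  have "(\<integral>v. green bc a y v * green bc b y v * indicator {0..1} v \<partial>lborel)
    = (\<Sum>n. exp (- eigenval n * a) * eigenfun bc n y * (\<integral>v. eigenfun bc n v * green bc b y v * indicator {0..1} v \<partial>lborel))"
    unfolding e[OF a] using summable_green_coeff[OF a] B green_measurable_bounded(1)[OF b]
    by (intro integral_eigenfun_series[where B = B]) auto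
  also have "\<dots> = (\<Sum>n. exp (- eigenval n * (a + b)) * (eigenfun bc n y)\<^sup>2)"
    unfolding in1 by (intro suminf_cong) (simp add: power2_eq_square distrib_left exp_diff exp_minus exp_add field_simps)
  finally show ?thesis .
qed


text \<open>For \<open>s \<le> t\<close> this is the integral of \<open>exp (- eigenval n * (t + s - 2 * r))\<close> over \<open>r \<in> [0, s]\<close>.\<close>

definition mode_cov :: "nat \<Rightarrow> real \<Rightarrow> real \<Rightarrow> real" where
  "mode_cov n t s = (if n = 0 then s else exp (- eigenval n * (t - s)) * (1 - exp (- 2 * eigenval n * s)) / (2 * eigenval n))"

definition heat_cov :: "boundary_condition \<Rightarrow> real \<Rightarrow> real \<Rightarrow> real \<Rightarrow> real" where
  "heat_cov bc y t s = (\<Sum>n. (eigenfun bc n y)\<^sup>2 * mode_cov n t s)"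

lemma mode_cov_bounds:
  assumes "0 \<le> s" "s \<le> t"
  shows "0 \<le> mode_cov n t s" "n > 0 \<Longrightarrow> mode_cov n t s \<le> 1 / (2 * eigenval n)"
proof -
  have m: "0 \<le> eigenval n" by (rule eigenval_nonneg)
  have e: "exp (- eigenval n * (t - s)) \<le> 1" "0 \<le> 1 - exp (- 2 * eigenval n * s)" "1 - exp (- 2 * eigenval n * s) \<le> 1" using m assms by auto
  show "0 \<le> mode_cov n t s" unfolding mode_cov_def using m e assms by auto
  assume n: "n > 0"
  have "exp (- eigenval n * (t - s)) * (1 - exp (- 2 * eigenval n * s)) \<le> 1 * 1" using e by (intro mult_mono) auto
  thus "mode_cov n t s \<le> 1 / (2 * eigenval n)" unfolding mode_cov_def using n eigenval_pos[OF n] by (auto intro!: divide_right_mono)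
qed

lemma summable_inverse_eigenval: "summable (\<lambda>n. 1 / eigenval n)"
proof -
  have "summable (\<lambda>n. (1 / pi\<^sup>2) * inverse ((real n)\<^sup>2))" by (intro summable_mult inverse_power_summable) auto
  thus ?thesis by (simp add: eigenval_def field_simps)
qed

lemma heat_cov_summable:
  assumes "0 \<le> s" "s \<le> t"
  shows "summable (\<lambda>n. (eigenfun bc n y)\<^sup>2 * mode_cov n t s)"
proof -
  have "summable (\<lambda>n. 2 * (1 / (2 * eigenval (Suc n))))"
    using summable_inverse_eigenval summable_Suc_iff[of "\<lambda>n. 1 / eigenval n"] by simp
  hence "summable (\<lambda>n. (eigenfun bc (Suc n) y)\<^sup>2 * mode_cov (Suc n) t s)"
  proof (rule summable_comparison_test')
    fix n
    have "(eigenfun bc (Suc n) y)\<^sup>2 * mode_cov (Suc n) t s \<le> 2 * (1 / (2 * eigenval (Suc n)))"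
      using mode_cov_bounds[OF assms, of "Suc n"] eigenfun_sq_le by (intro mult_mono) auto
    thus "norm ((eigenfun bc (Suc n) y)\<^sup>2 * mode_cov (Suc n) t s) \<le> 2 * (1 / (2 * eigenval (Suc n)))"
      using mode_cov_bounds(1)[OF assms, of "Suc n"] by simp
  qed
  thus ?thesis using summable_Suc_iff[of "\<lambda>n. (eigenfun bc n y)\<^sup>2 * mode_cov n t s"] by simp
qed

lemma integral_mode:
  assumes "0 \<le> s" "s \<le> t"
  shows "integrable lborel (\<lambda>r. exp (- eigenval n * (t + s - 2 * r)) * indicator {0..s} r)"
    "(\<integral>r. exp (- eigenval n * (t + s - 2 * r)) * indicator {0..s} r \<partial>lborel) = mode_cov n t s"
proof -
  show "integrable lborel (\<lambda>r. exp (- eigenval n * (t + s - 2 * r)) * indicator {0..s} r)"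
  proof (rule Bochner_Integration.integrable_bound[OF integrable_real_indicator[of "{0..s}"]])
    have "exp (- eigenval n * (t + s - 2 * r)) * indicator {0..s} r \<le> indicator {0..s} r" for r
      using assms eigenval_nonneg[of n] by (auto simp: indicator_def)
    thus "AE r in lborel. norm (exp (- eigenval n * (t + s - 2 * r)) * indicator {0..s} r) \<le> norm (indicator {0..s} r :: real)" by simp
  qed (use assms in auto)
  show "(\<integral>r. exp (- eigenval n * (t + s - 2 * r)) * indicator {0..s} r \<partial>lborel) = mode_cov n t s"
  proof (cases "n = 0")
    case True
    have "(\<integral>r. exp (- eigenval n * (t + s - 2 * r)) * indicator {0..s} r \<partial>lborel) = (\<integral>r. indicator {0..s} r \<partial>lborel)"
      using True by (simp add: eigenval_0)
    thus ?thesis using assms True by (simp add: mode_cov_def)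
  next
    case False
    hence m: "eigenval n > 0" by (simp add: eigenval_pos)
    have "(\<integral>r. exp (- eigenval n * (t + s - 2 * r)) * indicator {0..s} r \<partial>lborel)
      = exp (- eigenval n * (t + s - 2 * s)) / (2 * eigenval n) - exp (- eigenval n * (t + s - 2 * 0)) / (2 * eigenval n)"
      using m assms by (intro integral_FTC_Icc_real) (auto intro!: derivative_eq_intros continuous_intros)
    also have "\<dots> = mode_cov n t s"
    proof -
      have "exp (- eigenval n * (t - s)) * (1 - exp (- 2 * eigenval n * s)) = exp (- eigenval n * (t + s - 2 * s)) - exp (- eigenval n * (t + s - 2 * 0))"
        by (simp add: right_diff_distrib exp_add[symmetric] algebra_simps)
      thus ?thesis using False by (simp add: mode_cov_def diff_divide_distrib)
    qed
    finally show ?thesis .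
  qed
qed

text \<open>By Fubini: the integral over space is the diagonal of the kernel at time
  \<open>t + s - 2 * r\<close>, and integrating its series over \<open>r\<close> term by term gives
  \<open>mode_cov\<close>.\<close>

lemma integral_green_kernel:
  assumes st: "0 \<le> s" "s \<le> t"
    and int: "integrable lborel (\<lambda>z. (indicator ({0..} \<times> {0..1}) z * (\<lambda>(r, v). if r < t then green bc (t - r) y v else 0) z)
         * (indicator ({0..} \<times> {0..1}) z * (\<lambda>(r, v). if r < s then green bc (s - r) y v else 0) z))"
  shows "(\<integral>z. (indicator ({0..} \<times> {0..1}) z * (\<lambda>(r, v). if r < t then green bc (t - r) y v else 0) z)
         * (indicator ({0..} \<times> {0..1}) z * (\<lambda>(r, v). if r < s then green bc (s - r) y v else 0) z) \<partial>lborel) = heat_cov bc y t s"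
proof -
  define f where "f z = (indicator ({0..} \<times> {0..1}) z * (\<lambda>(r, v). if r < t then green bc (t - r) y v else 0) z)
         * (indicator ({0..} \<times> {0..1}) z * (\<lambda>(r, v). if r < s then green bc (s - r) y v else 0) z)" for z :: "real \<times> real"
  have intf: "integrable (lborel \<Otimes>\<^sub>M lborel) f"
    unfolding lborel_prod f_def[abs_def] by (rule int)
  have "(\<integral>z. f z \<partial>lborel) = (\<integral>z. f z \<partial>(lborel \<Otimes>\<^sub>M lborel))" by (simp only: lborel_prod)
  also have "\<dots> = (\<integral>r. (\<integral>v. f (r, v) \<partial>lborel) \<partial>lborel)"
    by (rule lborel_pair.integral_fst'[symmetric, OF intf])
  also have "\<dots> = (\<integral>r. (\<Sum>n. (eigenfun bc n y)\<^sup>2 * (exp (- eigenval n * (t + s - 2 * r)) * indicator {0..s} r)) \<partial>lborel)"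
  proof (rule integral_cong_AE)
    \<comment> \<open>At \<open>r = s\<close> the left side is already cut off while the indicator
      on the right is still 1, hence the exclusion of this null set.\<close>
    have inner: "(\<integral>v. f (r, v) \<partial>lborel) = (\<Sum>n. (eigenfun bc n y)\<^sup>2 * (exp (- eigenval n * (t + s - 2 * r)) * indicator {0..s} r))" if "r \<noteq> s" for r
    proof (cases "0 \<le> r \<and> r < s")
      case True
      have "(\<integral>v. f (r, v) \<partial>lborel) = (\<integral>v. green bc (t - r) y v * green bc (s - r) y v * indicator {0..1} v \<partial>lborel)"
        unfolding f_def using True st by (intro Bochner_Integration.integral_cong) (auto simp: indicator_def)
      also have "\<dots> = (\<Sum>n. exp (- eigenval n * ((t - r) + (s - r))) * (eigenfun bc n y)\<^sup>2)" using True st by (intro integral_green_green) auto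
      also have "\<dots> = (\<Sum>n. (eigenfun bc n y)\<^sup>2 * (exp (- eigenval n * (t + s - 2 * r)) * indicator {0..s} r))"
        using True by (intro suminf_cong) (simp add: algebra_simps)
      finally show ?thesis .
    next
      case False
      hence z: "r \<notin> {0..s}" using that by auto
      have "f (r, v) = 0" for v unfolding f_def using False by (auto simp: indicator_def)
      thus ?thesis using z by simp
    qed
    have "AE r in lborel. r \<noteq> s" by (rule AE_lborel_singleton)
    thus "AE r in lborel. (\<integral>v. f (r, v) \<partial>lborel) = (\<Sum>n. (eigenfun bc n y)\<^sup>2 * (exp (- eigenval n * (t + s - 2 * r)) * indicator {0..s} r))"
      by eventually_elim (rule inner)
    show "(\<lambda>r. \<integral>v. f (r, v) \<partial>lborel) \<in> borel_measurable lborel" using lborel_pair.integrable_fst'[OF intf] by (rule borel_measurable_integrable)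
  qed measurable
  also have "\<dots> = (\<Sum>n. \<integral>r. (eigenfun bc n y)\<^sup>2 * (exp (- eigenval n * (t + s - 2 * r)) * indicator {0..s} r) \<partial>lborel)"
  proof (rule integral_suminf)
    show i: "integrable lborel (\<lambda>r. (eigenfun bc n y)\<^sup>2 * (exp (- eigenval n * (t + s - 2 * r)) * indicator {0..s} r))" for n
      using integral_mode(1)[OF st] by (intro integrable_mult_right)
    have nn: "norm ((eigenfun bc n y)\<^sup>2 * (exp (- eigenval n * (t + s - 2 * r)) * indicator {0..s} r)) = (eigenfun bc n y)\<^sup>2 * (exp (- eigenval n * (t + s - 2 * r)) * indicator {0..s} r)" for n r
      by simp
    show "summable (\<lambda>n. \<integral>r. norm ((eigenfun bc n y)\<^sup>2 * (exp (- eigenval n * (t + s - 2 * r)) * indicator {0..s} r)) \<partial>lborel)"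
      unfolding nn using heat_cov_summable[OF st, of bc y] integral_mode(2)[OF st] by simp
    have "AE r in lborel. r \<noteq> s" by (rule AE_lborel_singleton)
    thus "AE r in lborel. summable (\<lambda>n. norm ((eigenfun bc n y)\<^sup>2 * (exp (- eigenval n * (t + s - 2 * r)) * indicator {0..s} r)))"
    proof eventually_elim
      case (elim r)
      show ?case
      proof (cases "r \<in> {0..s}")
        case True
        hence p: "0 < t + s - 2 * r" using elim st by auto
        have "summable (\<lambda>n. 2 * exp (- eigenval n * (t + s - 2 * r)))" using summable_exp_eigenval[OF p] by (rule summable_mult)
        thus ?thesis unfolding nn
        proof (rule summable_comparison_test')
          fix n
          show "norm ((eigenfun bc n y)\<^sup>2 * (exp (- eigenval n * (t + s - 2 * r)) * indicator {0..s} r)) \<le> 2 * exp (- eigenval n * (t + s - 2 * r))"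
            unfolding nn using True eigenfun_sq_le[of bc n y] by (auto intro!: mult_right_mono)
        qed
      qed simp
    qed
  qed
  also have "\<dots> = heat_cov bc y t s" unfolding heat_cov_def using integral_mode(2)[OF st] by simp
  finally show ?thesis by (simp only: f_def)
qed

section \<open>From boxes to densities\<close>

context gaussian_space
begin

text \<open>The density on \<open>[x, x + h]\<close> is bounded through
  \<open>(x + r)\<^sup>2 \<ge> x\<^sup>2 - 2 * \<bar>x\<bar> * h\<close> for
  \<open>0 \<le> r \<le> h\<close>. The error term disappears as \<open>h\<close> tends to
  0.\<close>

lemma prob_interval_le:
  assumes X: "X \<in> H" and v: "0 < vmin" "vmin \<le> ip X X" "ip X X \<le> vmax" and h: "0 < h"
  shows "prob {\<omega> \<in> space M. X \<omega> \<in> {x..x + h}} \<le> h * (1 / sqrt (2 * pi * vmin)) * exp (- (x\<^sup>2 - 2 * \<bar>x\<bar> * h) / (2 * vmax))"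
proof -
  interpret S: prob_space std_normal by (rule prob_space_std_normal)
  define V where "V = ip X X"
  define \<sigma> where "\<sigma> = sqrt V"
  have V: "0 < V" "vmin \<le> V" "V \<le> vmax" using v by (auto simp: V_def)
  have \<sigma>: "0 < \<sigma>" "\<sigma>\<^sup>2 = V" using V by (auto simp: \<sigma>_def)
  \<comment> \<open>Truncation at 0 makes the exponent monotone in the variance, so that
    \<open>V\<close> can be replaced by \<open>vmax\<close>.\<close>
  define e where "e = max 0 (x\<^sup>2 - 2 * \<bar>x\<bar> * h)"
  define B where "B = (1 / sqrt (2 * pi)) * exp (- (e / (2 * V)))"
  have "{\<omega> \<in> space M. X \<omega> \<in> {x..x + h}} = {\<omega> \<in> space M. (1 / \<sigma>) * X \<omega> \<in> {x / \<sigma>..(x + h) / \<sigma>}}"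
    using \<sigma> by (auto simp: field_simps)
  hence "prob {\<omega> \<in> space M. X \<omega> \<in> {x..x + h}} = measure std_normal {x / \<sigma>..(x + h) / \<sigma>}"
    using normalize_mem[OF X] V prob_std_normal[of "\<lambda>\<omega>. (1 / \<sigma>) * X \<omega>" "{x / \<sigma>..(x + h) / \<sigma>}"] by (simp add: \<sigma>_def V_def)
  moreover have "emeasure std_normal {x / \<sigma>..(x + h) / \<sigma>} \<le> ennreal (B * (h / \<sigma>))"
  proof -
    have "emeasure std_normal {x / \<sigma>..(x + h) / \<sigma>} = (\<integral>\<^sup>+t. ennreal (std_normal_density t) * indicator {x / \<sigma>..(x + h) / \<sigma>} t \<partial>lborel)"
      by (subst emeasure_density) auto
    also have "\<dots> \<le> (\<integral>\<^sup>+t. ennreal B * indicator {x / \<sigma>..(x + h) / \<sigma>} t \<partial>lborel)"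
    proof (intro nn_integral_mono)
      fix t
      show "ennreal (std_normal_density t) * indicator {x / \<sigma>..(x + h) / \<sigma>} t \<le> ennreal B * indicator {x / \<sigma>..(x + h) / \<sigma>} t"
      proof (cases "t \<in> {x / \<sigma>..(x + h) / \<sigma>}")
        case True
        define r where "r = \<sigma> * t - x"
        have r: "0 \<le> r" "r \<le> h" using True \<sigma> by (auto simp: r_def field_simps)
        have "- (x * r) \<le> \<bar>x\<bar> * r" using r by (metis abs_ge_minus_self abs_mult abs_of_nonneg)
        also have "\<dots> \<le> \<bar>x\<bar> * h" using r by (intro mult_left_mono) auto
        finally have "x\<^sup>2 - 2 * \<bar>x\<bar> * h \<le> x\<^sup>2 + 2 * x * r + r\<^sup>2" using zero_le_power2[of r] by linarith
        also have "\<dots> = V * t\<^sup>2" unfolding \<sigma>(2)[symmetric] r_def by (simp add: power2_eq_square algebra_simps)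
        finally have "e \<le> V * t\<^sup>2" using V by (simp add: e_def)
        hence "e / (2 * V) \<le> V * t\<^sup>2 / (2 * V)" using V by (intro divide_right_mono) auto
        also have "\<dots> = t\<^sup>2 / 2" using V by simp
        finally have "std_normal_density t \<le> B" unfolding std_normal_density_def B_def by (intro mult_left_mono) auto
        thus ?thesis using True by (simp add: ennreal_leI)
      qed simp
    qed
    also have "\<dots> = ennreal B * ennreal ((x + h) / \<sigma> - x / \<sigma>)" using h \<sigma> by (simp add: nn_integral_cmult divide_right_mono)
    also have "(x + h) / \<sigma> - x / \<sigma> = h / \<sigma>" by (simp add: add_divide_distrib)
    also have "ennreal B * ennreal (h / \<sigma>) = ennreal (B * (h / \<sigma>))" using h \<sigma> by (intro ennreal_mult[symmetric]) (auto simp: B_def)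
    finally show ?thesis .
  qed
  ultimately have "prob {\<omega> \<in> space M. X \<omega> \<in> {x..x + h}} \<le> B * (h / \<sigma>)"
    using h \<sigma> by (simp add: S.emeasure_eq_measure ennreal_le_iff B_def)
  also have "\<dots> = h * (1 / sqrt (2 * pi * V)) * exp (- (e / (2 * V)))"
    by (simp add: B_def \<sigma>_def real_sqrt_mult)
  also have "\<dots> \<le> h * (1 / sqrt (2 * pi * vmin)) * exp (- (x\<^sup>2 - 2 * \<bar>x\<bar> * h) / (2 * vmax))"
  proof (intro mult_mono)
    show "1 / sqrt (2 * pi * V) \<le> 1 / sqrt (2 * pi * vmin)" using V v by (intro divide_left_mono real_sqrt_le_mono) auto
    have "(x\<^sup>2 - 2 * \<bar>x\<bar> * h) / (2 * vmax) \<le> e / (2 * vmax)" using V by (intro divide_right_mono) (auto simp: e_def)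
    also have "\<dots> \<le> e / (2 * V)" using V by (intro divide_left_mono) (auto simp: e_def)
    finally show "exp (- (e / (2 * V))) \<le> exp (- (x\<^sup>2 - 2 * \<bar>x\<bar> * h) / (2 * vmax))"
      unfolding minus_divide_left[symmetric] exp_le_cancel_iff neg_le_iff_le .
  qed (use h v V in auto)
  finally show ?thesis .
qed

lemma prob_interval_pos:
  assumes X: "X \<in> H" and v: "0 < ip X X" and h: "0 < h"
  shows "0 < prob {\<omega> \<in> space M. X \<omega> \<in> {x..x + h}}"
proof -
  interpret S: prob_space std_normal by (rule prob_space_std_normal)
  define \<sigma> where "\<sigma> = sqrt (ip X X)"
  have \<sigma>: "0 < \<sigma>" using v by (auto simp: \<sigma>_def)
  have "{\<omega> \<in> space M. X \<omega> \<in> {x..x + h}} = {\<omega> \<in> space M. (1 / \<sigma>) * X \<omega> \<in> {x / \<sigma>..(x + h) / \<sigma>}}"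
    using \<sigma> by (auto simp: field_simps)
  hence e: "prob {\<omega> \<in> space M. X \<omega> \<in> {x..x + h}} = measure std_normal {x / \<sigma>..(x + h) / \<sigma>}"
    using normalize_mem[OF X v] prob_std_normal[of "\<lambda>\<omega>. (1 / \<sigma>) * X \<omega>" "{x / \<sigma>..(x + h) / \<sigma>}"] by (simp add: \<sigma>_def)
  have np: "\<not> std_normal_density t \<le> 0" for t using normal_density_pos[of 1 0 t] by simp
  have "measure std_normal {x / \<sigma>..(x + h) / \<sigma>} \<noteq> 0"
  proof
    assume "measure std_normal {x / \<sigma>..(x + h) / \<sigma>} = 0"
    hence "emeasure std_normal {x / \<sigma>..(x + h) / \<sigma>} = 0" by (simp add: S.emeasure_eq_measure)
    hence "{x / \<sigma>..(x + h) / \<sigma>} \<in> null_sets std_normal" by auto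
    hence "AE t in lborel. t \<in> {x / \<sigma>..(x + h) / \<sigma>} \<longrightarrow> ennreal (std_normal_density t) = 0" by (subst (asm) null_sets_density_iff) auto
    hence "AE t in lborel. t \<notin> {x / \<sigma>..(x + h) / \<sigma>}"
      by (rule AE_mp) (auto intro!: AE_I2 simp: ennreal_eq_0_iff np)
    hence "{x / \<sigma>..(x + h) / \<sigma>} \<in> null_sets lborel" by (subst AE_iff_null_sets) auto
    hence "emeasure lborel {x / \<sigma>..(x + h) / \<sigma>} = 0" by auto
    hence "h / \<sigma> \<le> 0" using h \<sigma> by (simp add: divide_right_mono ennreal_eq_0_iff add_divide_distrib)
    moreover have "0 < h / \<sigma>" using h \<sigma> by simp
    ultimately show False by linarith
  qed
  thus ?thesis unfolding e using measure_nonneg[of std_normal] by (simp add: less_le)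
qed

end


section \<open>Choice of constants and the probability of a small box\<close>

lemma chaining_constants:
  fixes K :: real
  assumes "0 < K"
  obtains A :: real and m0 :: nat where "0 \<le> A"
    "exp 16 * exp (- ((1 - q8)\<^sup>2 / (8 * K * q8 ^ (4 * m0)))) \<le> 1 / 4"
    "exp 16 * exp (- (A\<^sup>2 * (1 - q8)\<^sup>2 / (2 * K))) \<le> 1 / 4"
proof -
  \<comment> \<open>Here 18 is 16 + 2, and \<open>exp (- 2) \<le> 1 / 4\<close>. Both conditions
    hold once their exponents reach 18: a large \<open>m0\<close> shortens the initial block of
    \<open>strip_prob_lower\<close>, a large \<open>A\<close> raises the threshold on the whole
    grid.\<close>
  have small: "exp 16 * exp (- x) \<le> 1 / 4" if "18 \<le> x" for x :: real
  proof -
    have "exp 16 * exp (- x) \<le> exp (- 2)" using that by (simp add: exp_add[symmetric])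
    also have "\<dots> \<le> 1 / 4" using four_le_exp_2 by (simp add: exp_minus field_simps)
    finally show ?thesis .
  qed
  define c where "c = (1 - q8)\<^sup>2"
  have c: "0 < c" using q8 by (simp add: c_def)
  have "q8 ^ 4 < 1" using q8 by (intro power_less_one_iff[THEN iffD2]) auto
  then obtain m0 where m0: "(q8 ^ 4) ^ m0 < c / (8 * K * 18)"
    using real_arch_pow_inv[of "c / (8 * K * 18)" "q8 ^ 4"] c assms by auto
  have "(q8 ^ 4) ^ m0 * (8 * K * 18) \<le> c" using m0 assms by (simp add: field_simps)
  hence "q8 ^ (4 * m0) * (8 * K * 18) \<le> c" by (simp only: power_mult)
  hence "18 * (8 * K * q8 ^ (4 * m0)) \<le> c" by (simp add: ac_simps)
  hence 1: "18 \<le> c / (8 * K * q8 ^ (4 * m0))" using assms q8 by (simp add: pos_le_divide_eq)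
  have 2: "18 \<le> (sqrt (36 * K / c))\<^sup>2 * c / (2 * K)" using assms c by simp
  show thesis
    by (rule that[of "sqrt (36 * K / c)" m0]) (use small[OF 1] small[OF 2] assms c in \<open>auto simp: c_def\<close>)
qed

text \<open>\<open>C\<close> and \<open>g\<close> are chosen before the probability space, the path
  and \<open>\<delta>\<close>, which makes the final constant uniform. The work lies in estimating
  the logarithm \<open>\<Lambda>\<close> that \<open>prob_box_le\<close> produces.\<close>

theorem box_bound:
  fixes vmin vmax K k1 \<kappa>0 :: real
  assumes pos: "0 < vmin" "vmin \<le> vmax" "0 < K" "0 < k1" "0 < \<kappa>0"
  shows "\<exists>C>0. \<exists>g>0. \<forall>(M :: 'w measure) H U s \<delta> x h z2 k. gaussian_path M H U s \<delta> vmin vmax K k1 \<kappa>0 \<longrightarrow> 0 < h \<longrightarrow> 0 < k \<longrightarrow> \<delta> powr (1 / 4) \<le> z2 \<longrightarrow>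
      measure M {\<omega> \<in> space M. U s \<omega> \<in> {x..x + h} \<and> z2 < (SUP t\<in>{s..s + \<delta>}. U t \<omega> - U s \<omega>) \<and> (SUP t\<in>{s..s + \<delta>}. U t \<omega> - U s \<omega>) \<le> z2 + k}
      \<le> h * k * (C / \<delta> powr (1 / 4)) * exp (- (x\<^sup>2 - 2 * \<bar>x\<bar> * h) / (2 * vmax)) * exp ((\<bar>x\<bar> + h)\<^sup>2 / (4 * vmax)) * exp (- (g * z2\<^sup>2 / sqrt \<delta>))"
proof -
  obtain A :: real and m0 :: nat where A: "0 \<le> A"
    and small1: "exp 16 * exp (- ((1 - q8)\<^sup>2 / (8 * K * q8 ^ (4 * m0)))) \<le> 1 / 4"
    and small2: "exp 16 * exp (- (A\<^sup>2 * (1 - q8)\<^sup>2 / (2 * K))) \<le> 1 / 4"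
    using chaining_constants[OF pos(3)] .
  have vmax: "0 < vmax" using pos by linarith
  \<comment> \<open>Satisfies with equality the condition of \<open>L_lower\<close> that links
    \<open>R\<close> and \<open>A\<close>.\<close>
  define R where "R = A * sqrt K / ((\<kappa>0 / vmax) * k1 * q8 ^ (4 * m0))"
  have R: "0 \<le> R" "A \<le> R * (\<kappa>0 / vmax) * k1 * q8 ^ (4 * m0) / sqrt K"
    using A pos vmax q8 by (auto simp: R_def)
  define C1 where "C1 = 2 * K / \<kappa>0\<^sup>2 + 2 * R\<^sup>2 + 1 + ln (sqrt (2 * pi) * 2)"
  have "1 \<le> sqrt (2 * pi)" using pi_gt3 by (intro real_sqrt_ge_one) linarith
  hence "1 \<le> sqrt (2 * pi) * 2" by linarith
  hence C1: "0 \<le> C1" using pos by (auto simp: C1_def intro!: add_nonneg_nonneg)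
  \<comment> \<open>Two factors \<open>exp (\<epsilon> * z\<^sup>2)\<close> are spent below;
    together they use half of the normal exponent \<open>z\<^sup>2 / (2 * vmax)\<close>.\<close>
  define \<epsilon> where "\<epsilon> = 1 / (8 * vmax)"
  have \<epsilon>: "0 < \<epsilon>" using vmax by (simp add: \<epsilon>_def)
  \<comment> \<open>\<open>g1\<close> is the exponent that \<open>L_moderate\<close> gives at
    \<open>w = z2 / 2\<close>; \<open>g2\<close> is such that failure of its smallness condition
    means \<open>z > g2 * z2 / \<beta>\<close>.\<close>
  define g1 where "g1 = (1 - q8)\<^sup>2 / (32 * K)"
  define g2 where "g2 = 1 / (4 * sqrt (K / vmin))"
  define g where "g = min g1 (\<epsilon> * g2\<^sup>2)"
  have g1: "0 < g1" and g2: "0 < g2" using q8 pos by (auto simp: g1_def g2_def)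
  have g: "0 < g" using g1 g2 \<epsilon> by (simp add: g_def)
  define C3 where "C3 = 2 * exp 16 * (C1 + 1) * (1 + 1 / \<epsilon>)"
  have C3: "0 < C3" using C1 \<epsilon> by (simp add: C3_def add_nonneg_pos add_pos_pos)
  define C where "C = (1 / sqrt (2 * pi * vmin)) * 2 * C3"
  have C: "0 < C" using C3 pos by (simp add: C_def)
  show ?thesis
  proof (rule exI[of _ C], rule conjI[OF C], rule exI[of _ g], rule conjI[OF g], intro allI impI)
    fix M :: "'w measure" and H :: "('w \<Rightarrow> real) set" and U and s \<delta> x h z2 k :: real
    assume path: "gaussian_path M H U s \<delta> vmin vmax K k1 \<kappa>0" and h: "0 < h" and k: "0 < k" and z2: "\<delta> powr (1 / 4) \<le> z2"
    interpret gaussian_path M H U s \<delta> vmin vmax K k1 \<kappa>0 by (rule path)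
    have z2\<beta>: "\<beta> \<le> z2" using z2 by (simp add: \<beta>_def)
    have z2p: "0 < z2" using z2\<beta> \<beta> by linarith
    define z where "z = \<bar>x\<bar> + h"
    have ab: "\<bar>x\<bar> \<le> z" "\<bar>x + h\<bar> \<le> z" "0 \<le> z" using h by (auto simp: z_def)
    have Us: "U s \<in> H" using U \<delta> by simp
    define \<pi> where "\<pi> = prob {\<omega> \<in> space M. U s \<omega> \<in> {x..x + h}}"
    have \<pi>: "0 < \<pi>" unfolding \<pi>_def using Us var pos(1) h by (intro prob_interval_pos) auto
    define l where "l = L x (x + h) (z2 / 2)"
    have l\<pi>: "l \<le> \<pi>" unfolding l_def \<pi>_def by (rule L_le)
    have low: "\<pi> * (exp (- (z * sqrt K / \<kappa>0 + R)\<^sup>2 - 1) / sqrt (2 * pi) * (1 / 2)) \<le> l"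
      unfolding \<pi>_def l_def using z2\<beta> by (intro L_lower[OF ab(1,2) _ R(1) A small1 small2 R(2)]) auto
    have "0 < \<pi> * (exp (- (z * sqrt K / \<kappa>0 + R)\<^sup>2 - 1) / sqrt (2 * pi) * (1 / 2))" using \<pi> by simp
    hence lp: "0 < l" using low by linarith
    define \<Lambda> where "\<Lambda> = ln (\<pi> / l)"
    \<comment> \<open>The crude bound from \<open>L_lower\<close>: the logarithm leaves only
      quadratic growth in \<open>z\<close>.\<close>
    have \<Lambda>1: "\<Lambda> \<le> C1 * (1 + z\<^sup>2)"
    proof -
      define B where "B = (z * sqrt K / \<kappa>0 + R)\<^sup>2 + 1"
      have "\<pi> / l \<le> exp B * (sqrt (2 * pi) * 2)"
        using low lp \<pi> by (simp add: B_def field_simps exp_diff exp_minus exp_add)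
      hence "\<Lambda> \<le> ln (exp B * (sqrt (2 * pi) * 2))" unfolding \<Lambda>_def using lp \<pi> by (intro ln_mono) auto
      also have "\<dots> = B + ln (sqrt (2 * pi) * 2)" by (simp add: ln_mult)
      also have "B \<le> 2 * (z * sqrt K / \<kappa>0)\<^sup>2 + 2 * R\<^sup>2 + 1"
        using zero_le_power2[of "z * sqrt K / \<kappa>0 - R"] unfolding B_def by (simp add: power2_sum power2_diff)
      also have "(z * sqrt K / \<kappa>0)\<^sup>2 = (K / \<kappa>0\<^sup>2) * z\<^sup>2" using pos by (simp add: power_mult_distrib power_divide)
      finally have "\<Lambda> \<le> (2 * K / \<kappa>0\<^sup>2) * z\<^sup>2 + (2 * R\<^sup>2 + 1 + ln (sqrt (2 * pi) * 2))" by simp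
      also have "\<dots> \<le> C1 * z\<^sup>2 + C1 * 1"
        using pos \<open>1 \<le> sqrt (2 * pi) * 2\<close> by (intro add_mono mult_right_mono) (auto simp: C1_def)
      finally show ?thesis by (simp add: algebra_simps)
    qed
    define G where "G = exp (- (g * z2\<^sup>2 / \<beta>\<^sup>2))"
    have G: "0 < G" by (simp add: G_def)
    have E: "1 \<le> exp (\<epsilon> * z\<^sup>2)" using \<epsilon> by simp
    have e16: "1 \<le> exp (16::real)" by simp
    have \<Lambda>2: "\<Lambda> \<le> 2 * exp 16 * (C1 + 1) * (1 + z\<^sup>2) * exp (\<epsilon> * z\<^sup>2) * G"
    proof (cases "sqrt (K / vmin) * \<beta> * z \<le> z2 / 2 / 2")
      case True
      define q where "q = exp 16 * exp (- (g1 * z2\<^sup>2 / \<beta>\<^sup>2))"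
      have "(z2 / 2 / 2)\<^sup>2 * (1 - q8)\<^sup>2 / (2 * (K * \<beta>\<^sup>2)) = g1 * z2\<^sup>2 / \<beta>\<^sup>2"
        using pos \<beta> by (simp add: g1_def power_divide field_simps)
      hence lq: "\<pi> * (1 - q) \<le> l"
        using L_moderate[OF ab(1,2) _ True] z2p unfolding \<pi>_def l_def q_def by simp
      have "g * z2\<^sup>2 / \<beta>\<^sup>2 \<le> g1 * z2\<^sup>2 / \<beta>\<^sup>2" by (intro divide_right_mono mult_right_mono) (auto simp: g_def)
      hence qG: "q \<le> exp 16 * G" unfolding q_def G_def by simp
      have q0: "0 < q" by (simp add: q_def)
      \<comment> \<open>For \<open>q \<le> 1 / 2\<close> the logarithm is at most
        \<open>2 * q\<close>; otherwise \<open>2 * q > 1\<close> and the crude bound suffices. The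
        right side is a common form for both.\<close>
      have "\<Lambda> \<le> 2 * q * ((C1 + 1) * (1 + z\<^sup>2))"
      proof (cases "q \<le> 1 / 2")
        case q: True
        have "\<pi> / l \<le> 1 / (1 - q)" using lq lp \<pi> q by (simp add: field_simps)
        hence "\<Lambda> \<le> ln (1 / (1 - q))" unfolding \<Lambda>_def using lp \<pi> q by (intro ln_mono) auto
        also have "\<dots> \<le> 1 / (1 - q) - 1" using q by (intro ln_le_minus_one) auto
        also have "\<dots> = q / (1 - q)" using q by (simp add: field_simps)
        also have "\<dots> \<le> q / (1 / 2)" using q q0 by (intro divide_left_mono) auto
        also have "\<dots> = 2 * q * (1 * 1)" by simp
        also have "\<dots> \<le> 2 * q * ((C1 + 1) * (1 + z\<^sup>2))" using q0 C1 by (intro mult_left_mono mult_mono) auto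
        finally show ?thesis .
      next
        case q: False
        note \<Lambda>1
        also have "C1 * (1 + z\<^sup>2) \<le> 1 * ((C1 + 1) * (1 + z\<^sup>2))" by (simp add: mult_right_mono)
        also have "\<dots> \<le> 2 * q * ((C1 + 1) * (1 + z\<^sup>2))" using q C1 by (intro mult_right_mono) auto
        finally show ?thesis .
      qed
      also have "\<dots> \<le> 2 * (exp 16 * G) * ((C1 + 1) * (1 + z\<^sup>2))" using qG C1 by (intro mult_right_mono) auto
      also have "\<dots> = 2 * (exp 16 * G) * ((C1 + 1) * (1 + z\<^sup>2)) * 1" by simp
      also have "\<dots> \<le> 2 * (exp 16 * G) * ((C1 + 1) * (1 + z\<^sup>2)) * exp (\<epsilon> * z\<^sup>2)" using E G C1 by (intro mult_left_mono) auto
      finally show ?thesis by (simp only: ac_simps)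
    next
      \<comment> \<open>Here \<open>z\<close> is so large that
        \<open>exp (\<epsilon> * z\<^sup>2)\<close> compensates \<open>G\<close>, so the crude bound
        suffices.\<close>
      case False
      have s: "0 < sqrt (K / vmin)" using pos by simp
      have "g2 * z2 / \<beta> \<le> z" using False s \<beta> by (simp add: g2_def field_simps)
      hence "(g2 * z2 / \<beta>)\<^sup>2 \<le> z\<^sup>2" using g2 z2p \<beta> by (intro power_mono) auto
      hence "\<epsilon> * (g2 * z2 / \<beta>)\<^sup>2 \<le> \<epsilon> * z\<^sup>2" using \<epsilon> by (intro mult_left_mono) auto
      moreover have "g * z2\<^sup>2 / \<beta>\<^sup>2 \<le> (\<epsilon> * g2\<^sup>2) * z2\<^sup>2 / \<beta>\<^sup>2" by (intro divide_right_mono mult_right_mono) (auto simp: g_def)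
      ultimately have "0 \<le> \<epsilon> * z\<^sup>2 - g * z2\<^sup>2 / \<beta>\<^sup>2" by (simp add: power_divide power_mult_distrib mult.assoc)
      hence EG: "1 \<le> exp (\<epsilon> * z\<^sup>2) * G" unfolding G_def exp_add[symmetric] by simp
      note \<Lambda>1
      also have "C1 * (1 + z\<^sup>2) \<le> (2 * exp 16 * (C1 + 1)) * (1 + z\<^sup>2)"
      proof (intro mult_right_mono)
        have "1 * (C1 + 1) \<le> (2 * exp 16) * (C1 + 1)" using e16 C1 by (intro mult_right_mono) linarith+
        thus "C1 \<le> 2 * exp 16 * (C1 + 1)" by simp
      qed simp
      also have "\<dots> = (2 * exp 16 * (C1 + 1)) * (1 + z\<^sup>2) * 1" by simp
      also have "\<dots> \<le> (2 * exp 16 * (C1 + 1)) * (1 + z\<^sup>2) * (exp (\<epsilon> * z\<^sup>2) * G)" using EG C1 by (intro mult_left_mono) auto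
      finally show ?thesis by (simp only: ac_simps)
    qed
    \<comment> \<open>The polynomial factor is absorbed into the second exponential.\<close>
    have "1 + z\<^sup>2 \<le> (1 + 1 / \<epsilon>) * exp (\<epsilon> * z\<^sup>2)"
    proof -
      have "z\<^sup>2 = (1 / \<epsilon>) * (\<epsilon> * z\<^sup>2)" using \<epsilon> by simp
      also have "\<dots> \<le> (1 / \<epsilon>) * exp (\<epsilon> * z\<^sup>2)"
      proof (rule mult_left_mono)
        show "\<epsilon> * z\<^sup>2 \<le> exp (\<epsilon> * z\<^sup>2)" using exp_ge_add_one_self[of "\<epsilon> * z\<^sup>2"] by linarith
      qed (use \<epsilon> in simp)
      finally have "1 + z\<^sup>2 \<le> exp (\<epsilon> * z\<^sup>2) + (1 / \<epsilon>) * exp (\<epsilon> * z\<^sup>2)" using E by linarith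
      thus ?thesis by (simp only: distrib_right mult_1_left)
    qed
    hence "2 * exp 16 * (C1 + 1) * (1 + z\<^sup>2) * (exp (\<epsilon> * z\<^sup>2) * G) \<le> 2 * exp 16 * (C1 + 1) * ((1 + 1 / \<epsilon>) * exp (\<epsilon> * z\<^sup>2)) * (exp (\<epsilon> * z\<^sup>2) * G)"
      using C1 G by (intro mult_right_mono mult_left_mono) auto
    also have "\<dots> = C3 * (exp (\<epsilon> * z\<^sup>2) * exp (\<epsilon> * z\<^sup>2)) * G" by (simp only: C3_def ac_simps)
    also have "exp (\<epsilon> * z\<^sup>2) * exp (\<epsilon> * z\<^sup>2) = exp (z\<^sup>2 / (4 * vmax))"
      unfolding exp_add[symmetric] by (simp add: \<epsilon>_def field_simps)
    finally have \<Lambda>3: "\<Lambda> \<le> C3 * exp (z\<^sup>2 / (4 * vmax)) * G" using \<Lambda>2 by (simp only: mult.assoc) 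
    have \<Lambda>0: "0 \<le> \<Lambda>" unfolding \<Lambda>_def using l\<pi> lp by simp
    have "prob {\<omega> \<in> space M. U s \<omega> \<in> {x..x + h} \<and> z2 < sup_incr \<omega> \<and> sup_incr \<omega> \<le> z2 + k} \<le> \<pi> * (2 * k / z2) * \<Lambda>"
      unfolding \<pi>_def \<Lambda>_def l_def using z2p k lp unfolding l_def by (rule prob_box_le)
    also have "\<dots> \<le> (h * (1 / sqrt (2 * pi * vmin)) * exp (- (x\<^sup>2 - 2 * \<bar>x\<bar> * h) / (2 * vmax))) * (2 * k / \<beta>) * (C3 * exp (z\<^sup>2 / (4 * vmax)) * G)"
    proof (intro mult_mono \<Lambda>3 \<Lambda>0)
      show "\<pi> \<le> h * (1 / sqrt (2 * pi * vmin)) * exp (- (x\<^sup>2 - 2 * \<bar>x\<bar> * h) / (2 * vmax))"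
        unfolding \<pi>_def using Us pos(1) var h by (rule prob_interval_le)
      show "2 * k / z2 \<le> 2 * k / \<beta>" using z2\<beta> \<beta> k z2p by (intro divide_left_mono) auto
    qed (use h k pos \<beta> z2p in auto)
    also have "\<dots> = h * k * (C / \<beta>) * exp (- (x\<^sup>2 - 2 * \<bar>x\<bar> * h) / (2 * vmax)) * exp (z\<^sup>2 / (4 * vmax)) * G"
      by (simp add: C_def)
    finally show "prob {\<omega> \<in> space M. U s \<omega> \<in> {x..x + h} \<and> z2 < (SUP t\<in>{s..s + \<delta>}. U t \<omega> - U s \<omega>) \<and> (SUP t\<in>{s..s + \<delta>}. U t \<omega> - U s \<omega>) \<le> z2 + k}
      \<le> h * k * (C / \<delta> powr (1 / 4)) * exp (- (x\<^sup>2 - 2 * \<bar>x\<bar> * h) / (2 * vmax)) * exp ((\<bar>x\<bar> + h)\<^sup>2 / (4 * vmax)) * exp (- (g * z2\<^sup>2 / sqrt \<delta>))"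
      unfolding G_def z_def sup_incr_def \<beta>(3) unfolding \<beta>_def .
  qed
qed


text \<open>If \<open>p (z1, z2)\<close> exceeded the limit \<open>B\<close>, continuity would give
  \<open>p > m > B\<close> on all small boxes with corner \<open>(z1, z2)\<close>, hence
  \<open>m \<le> \<Psi> h\<close> for small \<open>h\<close>. The box is open at \<open>z2\<close>
  to match differences of distribution functions, and it lies in the domain of \<open>p\<close>
  because \<open>z2 > 0\<close>.\<close>

lemma density_le_of_box_bound:
  fixes p :: "real \<times> real \<Rightarrow> real"
  assumes "prob_space M" and sd: "smooth_density_on M (\<lambda>\<omega>. (X \<omega>, Y \<omega>)) (UNIV \<times> {0<..}) p"
    and z2: "0 < z2" and \<Psi>: "(\<Psi> \<longlongrightarrow> B) (at_right 0)"
    and box: "\<And>h. 0 < h \<Longrightarrow> measure M {\<omega> \<in> space M. X \<omega> \<in> {z1..z1 + h} \<and> z2 < Y \<omega> \<and> Y \<omega> \<le> z2 + h} \<le> h * h * \<Psi> h"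
  shows "p (z1, z2) \<le> B"
proof (rule ccontr)
  assume "\<not> p (z1, z2) \<le> B"
  interpret prob_space M by fact
  define m where "m = (p (z1, z2) + B) / 2"
  have m: "B < m" "m < p (z1, z2)" using \<open>\<not> p (z1, z2) \<le> B\<close> by (auto simp: m_def)
  have XY: "(\<lambda>\<omega>. (X \<omega>, Y \<omega>)) \<in> borel_measurable M" using sd by (simp add: smooth_density_on_def)
  have "C_k_on 0 (UNIV \<times> {0<..}) p" using sd unfolding smooth_density_on_def by blast
  hence cont: "continuous_on (UNIV \<times> {0<..}) p" by simp
  have op: "open (UNIV \<times> {0<..} :: (real \<times> real) set)" by (intro open_Times) auto
  have "isCont p (z1, z2)" using cont op z2 by (simp add: continuous_on_eq_continuous_at)
  hence "\<forall>\<^sub>F z in at (z1, z2). m < p z" using m(2) unfolding isCont_def by (rule order_tendstoD)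
  then obtain d where d: "0 < d" "\<And>z. z \<noteq> (z1, z2) \<Longrightarrow> dist z (z1, z2) < d \<Longrightarrow> m < p z"
    unfolding eventually_at by auto
  have near: "m < p (x, y)" if "x \<in> {z1..z1 + h}" "y \<in> {z2<..z2 + h}" "h < d / 2" for x y h
  proof (rule d(2))
    show "(x, y) \<noteq> (z1, z2)" using that by auto
    have "dist (x, y) (z1, z2) \<le> \<bar>x - z1\<bar> + \<bar>y - z2\<bar>"
      unfolding dist_Pair_Pair dist_real_def by (rule sqrt_sum_squares_le_sum) auto
    also have "\<dots> < d" using that by auto
    finally show "dist (x, y) (z1, z2) < d" .
  qed
  \<comment> \<open>For negative \<open>m\<close> the comparison of masses in \<open>ennreal\<close>
    would lose information; there \<open>\<Psi> h \<ge> 0\<close> is enough.\<close>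
  have le: "m \<le> \<Psi> h" if h: "0 < h" "h < d / 2" for h
  proof (cases "0 \<le> m")
    case True
    define A where "A = {z1..z1 + h} \<times> {z2<..z2 + h}"
    have A: "A \<in> sets borel" "A \<subseteq> UNIV \<times> {0<..}" using z2 by (auto simp: A_def intro!: borel_Times)
    have "emeasure lborel A = emeasure (lborel \<Otimes>\<^sub>M lborel) A" by (simp only: lborel_prod)
    also have "\<dots> = ennreal h * ennreal h"
      unfolding A_def using h by (subst lborel.emeasure_pair_measure_Times) auto
    finally have eA: "emeasure lborel A = ennreal h * ennreal h" .
    have "ennreal (m * (h * h)) = ennreal m * emeasure lborel A" unfolding eA using True h by (simp add: ennreal_mult)
    also have "\<dots> = (\<integral>\<^sup>+z\<in>A. ennreal m \<partial>lborel)" using A by (subst nn_integral_cmult_indicator) auto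
    also have "\<dots> \<le> (\<integral>\<^sup>+z\<in>A. ennreal (p z) \<partial>lborel)"
    proof (intro nn_integral_mono)
      fix z :: "real \<times> real"
      have "ennreal m \<le> ennreal (p z)" if "z \<in> A"
        using near[of "fst z" h "snd z"] that h(2) by (intro ennreal_leI) (auto simp: A_def less_imp_le)
      thus "ennreal m * indicator A z \<le> ennreal (p z) * indicator A z" by (auto simp: indicator_def)
    qed
    also have "\<dots> = emeasure (distr M borel (\<lambda>\<omega>. (X \<omega>, Y \<omega>))) A"
      using sd A unfolding smooth_density_on_def by simp
    also have "\<dots> = emeasure M ((\<lambda>\<omega>. (X \<omega>, Y \<omega>)) -` A \<inter> space M)" using XY A by (intro emeasure_distr) auto
    also have "(\<lambda>\<omega>. (X \<omega>, Y \<omega>)) -` A \<inter> space M = {\<omega> \<in> space M. X \<omega> \<in> {z1..z1 + h} \<and> z2 < Y \<omega> \<and> Y \<omega> \<le> z2 + h}"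
      by (auto simp: A_def)
    also have "emeasure M \<dots> \<le> ennreal (h * h * \<Psi> h)" using box[OF h(1)] by (simp add: emeasure_eq_measure ennreal_leI)
    finally have le: "ennreal (m * (h * h)) \<le> ennreal (h * h * \<Psi> h)" .
    have "0 \<le> h * h * \<Psi> h" using box[OF h(1)] measure_nonneg order_trans by blast
    hence "m * (h * h) \<le> h * h * \<Psi> h" using le by (simp add: ennreal_le_iff)
    thus ?thesis using h by (simp add: mult.commute)
  next
    case False
    have "0 \<le> (h * h) * \<Psi> h" using box[OF h(1)] measure_nonneg order_trans by blast
    moreover have "0 < h * h" using h by simp
    ultimately have "0 \<le> \<Psi> h" using mult_pos_neg[of "h * h" "\<Psi> h"] by linarith
    thus ?thesis using False by linarith
  qed
  have "m \<le> B"
  proof (rule tendsto_lowerbound[OF \<Psi>])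
    show "\<forall>\<^sub>F h in at_right 0. m \<le> \<Psi> h"
      unfolding eventually_at_right_field using le d(1) by (intro exI[of _ "d / 2"]) auto
  qed simp
  thus False using m by simp
qed

section \<open>Covariance estimates and conclusion\<close>

text \<open>The angles of two consecutive eigenfunctions differ by \<open>pi * y\<close>, and the
  addition theorem for \<open>sin (pi * y)\<close> shows that they cannot both be small at an
  interior \<open>y\<close>. A single one may vanish there, so lower bounds for covariances use
  consecutive pairs.\<close>

lemma eigenfun_pair_ge:
  assumes "0 < n"
  shows "(sin (pi * y))\<^sup>2 \<le> (eigenfun bc n y)\<^sup>2 + (eigenfun bc (Suc n) y)\<^sup>2"
proof -
  define A where "A = real n * pi * y"
  have A: "real (Suc n) * pi * y = A + pi * y" by (simp add: A_def algebra_simps)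
  have "pi * y = (A + pi * y) - A" by simp
  hence s: "sin (pi * y) = sin (A + pi * y) * cos A - cos (A + pi * y) * sin A" by (metis sin_diff)
  have sq: "(p * c - q * d)\<^sup>2 \<le> 2 * (p\<^sup>2 + d\<^sup>2)" if "\<bar>c\<bar> \<le> 1" "\<bar>q\<bar> \<le> 1" for p q c d :: real
  proof -
    have "(p * c - q * d)\<^sup>2 \<le> 2 * (p * c)\<^sup>2 + 2 * (q * d)\<^sup>2"
      using zero_le_power2[of "p * c + q * d"] by (simp add: power2_sum power2_diff)
    also have "(p * c)\<^sup>2 \<le> p\<^sup>2" using that(1) by (simp add: power_mult_distrib mult_left_le abs_square_le_1)
    also have "(q * d)\<^sup>2 \<le> d\<^sup>2" using that(2) by (simp add: power_mult_distrib mult_left_le_one_le abs_square_le_1)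
    finally show ?thesis by simp
  qed
  show ?thesis
  proof (cases bc)
    case Neumann
    have "(sin (pi * y))\<^sup>2 = (cos A * sin (A + pi * y) - sin A * cos (A + pi * y))\<^sup>2" using s by (simp add: mult.commute)
    also have "\<dots> \<le> 2 * ((cos A)\<^sup>2 + (cos (A + pi * y))\<^sup>2)" by (intro sq) auto
    finally show ?thesis using assms A unfolding eigenfun_def Neumann A_def[symmetric] by (simp add: power_mult_distrib)
  next
    case Dirichlet
    have "(sin (pi * y))\<^sup>2 = (sin (A + pi * y) * cos A - cos (A + pi * y) * sin A)\<^sup>2" using s by simp
    also have "\<dots> \<le> 2 * ((sin (A + pi * y))\<^sup>2 + (sin A)\<^sup>2)" by (intro sq) auto
    finally show ?thesis using assms A unfolding eigenfun_def Dirichlet A_def[symmetric] by (simp add: power_mult_distrib)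
  qed
qed

lemma eigenfun_block_ge:
  assumes "0 < p"
  shows "real m * (sin (pi * y))\<^sup>2 \<le> (\<Sum>n\<in>{p..<p + 2 * m}. (eigenfun bc n y)\<^sup>2)"
proof (induction m)
  case (Suc m)
  have "{p..<p + 2 * Suc m} = insert (p + 2 * m) (insert (Suc (p + 2 * m)) {p..<p + 2 * m})" by auto
  hence "(\<Sum>n\<in>{p..<p + 2 * Suc m}. (eigenfun bc n y)\<^sup>2) = (eigenfun bc (p + 2 * m) y)\<^sup>2 + (eigenfun bc (Suc (p + 2 * m)) y)\<^sup>2 + (\<Sum>n\<in>{p..<p + 2 * m}. (eigenfun bc n y)\<^sup>2)"
    by simp
  moreover have "(sin (pi * y))\<^sup>2 \<le> (eigenfun bc (p + 2 * m) y)\<^sup>2 + (eigenfun bc (Suc (p + 2 * m)) y)\<^sup>2"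
    using assms by (intro eigenfun_pair_ge) simp
  ultimately show ?case using Suc by (simp add: algebra_simps)
qed simp

text \<open>Up to an \<open>m\<close> close to \<open>1 / sqrt \<tau>\<close> each term is at most
  \<open>\<tau>\<close>, which contributes at most \<open>2 * sqrt \<tau>\<close>; beyond,
  \<open>1 / (k + 1)\<^sup>2 \<le> 1 / k - 1 / (k + 1)\<close> telescopes to at most
  \<open>1 / m \<le> sqrt \<tau>\<close>.\<close>

lemma sum_min_inverse_square_le:
  fixes \<tau> :: real
  assumes "0 < \<tau>" "\<tau> \<le> 1"
  shows "(\<Sum>k<N. min \<tau> (1 / (real (Suc k))\<^sup>2)) \<le> 3 * sqrt \<tau>"
proof -
  define m where "m = nat \<lceil>1 / sqrt \<tau>\<rceil>"
  have s: "0 < sqrt \<tau>" "sqrt \<tau> \<le> 1" "sqrt \<tau> * sqrt \<tau> = \<tau>" using assms by auto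
  have m1: "1 / sqrt \<tau> \<le> real m" unfolding m_def by linarith
  have m2: "real m \<le> 1 / sqrt \<tau> + 1" unfolding m_def using s by (simp add: ceiling_le_iff)
  have mp: "0 < real m" using m1 s by (smt (verit) divide_pos_pos)
  have part: "(\<Sum>k<N. min \<tau> (1 / (real (Suc k))\<^sup>2)) \<le> (if N \<le> m then real N * \<tau> else real m * \<tau> + 1 / real m - 1 / real N)" for N
  proof (induction N)
    case (Suc N)
    show ?case
    proof (cases "Suc N \<le> m")
      case True
      have "min \<tau> (1 / (real (Suc N))\<^sup>2) \<le> \<tau>" by simp
      thus ?thesis using Suc True by (simp add: algebra_simps)
    next
      case False
      hence N: "m \<le> N" "0 < N" using mp by auto
      have "1 / (real (Suc N))\<^sup>2 \<le> 1 / (real N * real (Suc N))"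
        using N by (intro divide_left_mono) (auto simp: power2_eq_square intro!: mult_right_mono)
      also have "\<dots> = 1 / real N - 1 / real (Suc N)" using N by (simp add: field_simps)
      finally have step: "min \<tau> (1 / (real (Suc N))\<^sup>2) \<le> 1 / real N - 1 / real (Suc N)" by (simp add: min.coboundedI2)
      have "(\<Sum>k<N. min \<tau> (1 / (real (Suc k))\<^sup>2)) \<le> real m * \<tau> + 1 / real m - 1 / real N"
        using Suc N by (cases "N = m") auto
      thus ?thesis using step False by simp
    qed
  qed simp
  have "real m * \<tau> \<le> (1 / sqrt \<tau> + 1) * \<tau>" using m2 assms by (intro mult_right_mono) auto
  also have "\<dots> = sqrt \<tau> + \<tau>"
  proof -
    have "1 / sqrt \<tau> * \<tau> = sqrt \<tau>" using s(1,3) by (metis nonzero_mult_div_cancel_right less_irrefl times_divide_eq_left mult_1)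
    thus ?thesis by (simp only: distrib_right mult_1)
  qed
  finally have "real m * \<tau> \<le> sqrt \<tau> + \<tau>" .
  moreover have "\<tau> \<le> sqrt \<tau>" using s mult_left_mono[of "sqrt \<tau>" 1 "sqrt \<tau>"] by simp
  ultimately have a: "real m * \<tau> \<le> 2 * sqrt \<tau>" by linarith
  have b: "1 / real m \<le> sqrt \<tau>" using m1 s mp by (simp add: field_simps)
  show ?thesis
  proof (cases "N \<le> m")
    case True
    hence "real N * \<tau> \<le> real m * \<tau>" using assms by (intro mult_right_mono) auto
    moreover have "(\<Sum>k<N. min \<tau> (1 / (real (Suc k))\<^sup>2)) \<le> real N * \<tau>" using part[of N] True by simp
    ultimately show ?thesis using a s(1) by linarith
  next
    case False
    hence "(\<Sum>k<N. min \<tau> (1 / (real (Suc k))\<^sup>2)) \<le> real m * \<tau> + 1 / real m - 1 / real N" using part[of N] by simp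
    moreover have "0 \<le> 1 / real N" by simp
    ultimately show ?thesis using a b by linarith
  qed
qed

lemma one_minus_exp_le: "1 - exp (- x) \<le> (x::real)"
  using exp_ge_add_one_self[of "- x"] by simp

context
  fixes bc :: boundary_condition and y :: real
begin

text \<open>A mode \<open>n > 0\<close> contributes at most twice the smaller of
  \<open>\<tau>\<close> and \<open>1 / n\<^sup>2\<close>, and these sum to order
  \<open>sqrt \<tau>\<close>. The constant is 6 from these modes plus 2 from mode 0, where
  \<open>\<tau> \<le> sqrt \<tau>\<close>.\<close>

lemma heat_cov_increment_le:
  assumes "0 \<le> s" "s \<le> t" "t - s \<le> 1"
  shows "heat_cov bc y t t + heat_cov bc y s s - 2 * heat_cov bc y t s \<le> 8 * sqrt (t - s)"
proof (cases "t = s")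
  case False
  define \<tau> where "\<tau> = t - s"
  have \<tau>: "0 < \<tau>" "\<tau> \<le> 1" using assms False by (auto simp: \<tau>_def)
  have "0 \<le> t" using assms by simp
  define D where "D n = mode_cov n t t + mode_cov n s s - 2 * mode_cov n t s" for n
  note sm = heat_cov_summable[of t t bc y, OF \<open>0 \<le> t\<close> order_refl] heat_cov_summable[of s s bc y, OF assms(1) order_refl] heat_cov_summable[of s t bc y, OF assms(1,2)]
  have sD: "summable (\<lambda>n. (eigenfun bc n y)\<^sup>2 * D n)"
    unfolding D_def using summable_diff[OF summable_add[OF sm(1,2)] summable_mult[OF sm(3), of 2]] by (simp add: algebra_simps)
  have "heat_cov bc y t t + heat_cov bc y s s - 2 * heat_cov bc y t s = (\<Sum>n. (eigenfun bc n y)\<^sup>2 * D n)"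
    unfolding D_def heat_cov_def using sm
    by (simp add: suminf_add suminf_mult[symmetric] suminf_diff summable_add summable_mult algebra_simps)
  also have "\<dots> = (eigenfun bc 0 y)\<^sup>2 * D 0 + (\<Sum>n. (eigenfun bc (Suc n) y)\<^sup>2 * D (Suc n))"
    using suminf_split_head[OF sD] by simp
  also have "(\<Sum>n. (eigenfun bc (Suc n) y)\<^sup>2 * D (Suc n)) \<le> 2 * (3 * sqrt \<tau>)"
  proof (rule suminf_le_const)
    show "summable (\<lambda>n. (eigenfun bc (Suc n) y)\<^sup>2 * D (Suc n))" using sD summable_Suc_iff[of "\<lambda>n. (eigenfun bc n y)\<^sup>2 * D n"] by simp
    fix N
    have Db: "D (Suc n) \<le> min \<tau> (1 / (real (Suc n))\<^sup>2)" for n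
    proof -
      define \<mu> where "\<mu> = eigenval (Suc n)"
      have \<mu>: "0 < \<mu>" by (simp add: \<mu>_def eigenval_pos)
      have "D (Suc n) = (2 * (1 - exp (- \<mu> * \<tau>)) - (exp (- \<mu> * s) - exp (- \<mu> * t))\<^sup>2) / (2 * \<mu>)"
      proof -
        have "D (Suc n) = ((1 - exp (- 2 * \<mu> * t)) + (1 - exp (- 2 * \<mu> * s)) - 2 * (exp (- \<mu> * (t - s)) * (1 - exp (- 2 * \<mu> * s)))) / (2 * \<mu>)"
          unfolding D_def mode_cov_def \<mu>_def[symmetric] by (simp add: diff_divide_distrib add_divide_distrib)
        moreover have "exp (- 2 * \<mu> * t) = (exp (- \<mu> * t))\<^sup>2" "exp (- 2 * \<mu> * s) = (exp (- \<mu> * s))\<^sup>2" by (simp_all add: exp_double[symmetric])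
        moreover have "exp (- \<mu> * (t - s)) * (exp (- \<mu> * s))\<^sup>2 = exp (- \<mu> * t) * exp (- \<mu> * s)"
          by (simp add: power2_eq_square exp_add[symmetric] algebra_simps)
        ultimately show ?thesis unfolding \<tau>_def by (simp add: power2_diff algebra_simps)
      qed
      also have "\<dots> \<le> 2 * (1 - exp (- \<mu> * \<tau>)) / (2 * \<mu>)" using \<mu> by (intro divide_right_mono) auto
      also have "\<dots> = (1 - exp (- \<mu> * \<tau>)) / \<mu>" by (rule mult_divide_mult_cancel_left) simp
      finally have D: "D (Suc n) \<le> (1 - exp (- \<mu> * \<tau>)) / \<mu>" .
      have "(1 - exp (- \<mu> * \<tau>)) / \<mu> \<le> \<mu> * \<tau> / \<mu>" using one_minus_exp_le[of "\<mu> * \<tau>"] \<mu> by (intro divide_right_mono) auto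
      hence 1: "D (Suc n) \<le> \<tau>" using D \<mu> by simp
      have "(1 - exp (- \<mu> * \<tau>)) / \<mu> \<le> 1 / \<mu>" using \<mu> by (intro divide_right_mono) auto
      also have "\<dots> \<le> 1 / (real (Suc n))\<^sup>2" using \<mu> eigenval_ge[of "Suc n"] by (intro divide_left_mono) (auto simp: \<mu>_def)
      finally show ?thesis using 1 D by simp
    qed
    have "(\<Sum>n<N. (eigenfun bc (Suc n) y)\<^sup>2 * D (Suc n)) \<le> (\<Sum>n<N. 2 * min \<tau> (1 / (real (Suc n))\<^sup>2))"
    proof (intro sum_mono)
      fix n
      have "(eigenfun bc (Suc n) y)\<^sup>2 * D (Suc n) \<le> (eigenfun bc (Suc n) y)\<^sup>2 * min \<tau> (1 / (real (Suc n))\<^sup>2)" using Db by (intro mult_left_mono) auto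
      also have "\<dots> \<le> 2 * min \<tau> (1 / (real (Suc n))\<^sup>2)" using \<tau> by (intro mult_right_mono eigenfun_sq_le) auto
      finally show "(eigenfun bc (Suc n) y)\<^sup>2 * D (Suc n) \<le> 2 * min \<tau> (1 / (real (Suc n))\<^sup>2)" .
    qed
    also have "\<dots> = 2 * (\<Sum>n<N. min \<tau> (1 / (real (Suc n))\<^sup>2))" by (simp add: sum_distrib_left)
    also have "\<dots> \<le> 2 * (3 * sqrt \<tau>)" using sum_min_inverse_square_le[OF \<tau>] by (intro mult_left_mono) auto
    finally show "(\<Sum>n<N. (eigenfun bc (Suc n) y)\<^sup>2 * D (Suc n)) \<le> 2 * (3 * sqrt \<tau>)" .
  qed
  also have "(eigenfun bc 0 y)\<^sup>2 * D 0 \<le> 2 * sqrt \<tau>"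
  proof -
    have "D 0 = \<tau>" by (simp add: D_def mode_cov_def \<tau>_def)
    also have "\<tau> = sqrt \<tau> * sqrt \<tau>" using \<tau> by simp
    also have "\<dots> \<le> sqrt \<tau> * 1" using \<tau> by (intro mult_left_mono) auto
    finally have "D 0 \<le> sqrt \<tau>" by simp
    hence "(eigenfun bc 0 y)\<^sup>2 * D 0 \<le> (eigenfun bc 0 y)\<^sup>2 * sqrt \<tau>" by (intro mult_left_mono) auto
    also have "\<dots> \<le> 2 * sqrt \<tau>" using \<tau> by (intro mult_right_mono eigenfun_sq_le) auto
    finally show ?thesis .
  qed
  finally show ?thesis unfolding \<tau>_def by simp
qed simp

lemma heat_cov_upper:
  assumes "0 \<le> s"
  shows "heat_cov bc y s s \<le> 2 * s + (\<Sum>n. 1 / eigenval n)"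
proof -
  note sm = heat_cov_summable[OF assms order_refl, of bc y]
  have "heat_cov bc y s s = (eigenfun bc 0 y)\<^sup>2 * mode_cov 0 s s + (\<Sum>n. (eigenfun bc (Suc n) y)\<^sup>2 * mode_cov (Suc n) s s)"
    unfolding heat_cov_def using suminf_split_head[OF sm] by simp
  also have "(eigenfun bc 0 y)\<^sup>2 * mode_cov 0 s s \<le> 2 * s" using eigenfun_sq_le[of bc 0 y] assms by (auto simp: mode_cov_def intro!: mult_right_mono)
  also have "(\<Sum>n. (eigenfun bc (Suc n) y)\<^sup>2 * mode_cov (Suc n) s s) \<le> (\<Sum>n. 1 / eigenval (Suc n))"
  proof (rule suminf_le)
    fix n
    have "(eigenfun bc (Suc n) y)\<^sup>2 * mode_cov (Suc n) s s \<le> 2 * (1 / (2 * eigenval (Suc n)))"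
      using mode_cov_bounds[OF assms order_refl, of "Suc n"] by (intro mult_mono eigenfun_sq_le) auto
    thus "(eigenfun bc (Suc n) y)\<^sup>2 * mode_cov (Suc n) s s \<le> 1 / eigenval (Suc n)" by simp
    show "summable (\<lambda>n. (eigenfun bc (Suc n) y)\<^sup>2 * mode_cov (Suc n) s s)" using sm summable_Suc_iff[of "\<lambda>n. (eigenfun bc n y)\<^sup>2 * mode_cov n s s"] by simp
    show "summable (\<lambda>n. 1 / eigenval (Suc n))" using summable_inverse_eigenval summable_Suc_iff[of "\<lambda>n. 1 / eigenval n"] by simp
  qed
  also have "(\<Sum>n. 1 / eigenval (Suc n)) = (\<Sum>n. 1 / eigenval n)"
    using suminf_split_head[OF summable_inverse_eigenval] by (simp add: eigenval_0)
  finally show ?thesis by simp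
qed

text \<open>Keeping modes 1 and 2 guards against one of them vanishing at \<open>y\<close>. The
  constant is the worst one for times at least \<open>c1\<close> and time differences at most
  1.\<close>

lemma heat_cov_lower:
  assumes s: "0 < c1" "c1 \<le> s" "s \<le> t" "t - s \<le> 1" and \<sigma>: "\<sigma> \<le> (sin (pi * y))\<^sup>2"
  shows "\<sigma> * (exp (- eigenval 2) * (1 - exp (- 2 * eigenval 1 * c1)) / (2 * eigenval 2)) \<le> heat_cov bc y t s"
proof -
  have s0: "0 \<le> s" using s by simp
  define m0 where "m0 = exp (- eigenval 2) * (1 - exp (- 2 * eigenval 1 * c1)) / (2 * eigenval 2)"
  have e12: "0 < eigenval 1" "0 < eigenval 2" by (simp_all add: eigenval_pos)
  have m0: "0 \<le> m0" using s e12 by (simp add: m0_def)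
  have mc: "m0 \<le> mode_cov n t s" if n: "n \<in> {1, 2}" for n
  proof -
    have \<mu>: "eigenval 1 \<le> eigenval n" "eigenval n \<le> eigenval 2" "0 < eigenval n" using n by (auto intro: eigenval_mono simp: eigenval_pos)
    have "eigenval n * (t - s) \<le> eigenval 2 * 1" using \<mu> s by (intro mult_mono) auto
    hence 1: "exp (- eigenval 2) \<le> exp (- eigenval n * (t - s))" by simp
    have "eigenval 1 * c1 \<le> eigenval n * s" using \<mu> s e12 by (intro mult_mono) auto
    hence 2: "1 - exp (- 2 * eigenval 1 * c1) \<le> 1 - exp (- 2 * eigenval n * s)" by simp
    have "m0 \<le> exp (- eigenval n * (t - s)) * (1 - exp (- 2 * eigenval n * s)) / (2 * eigenval n)"
      unfolding m0_def using 1 2 \<mu> s0 s e12 by (intro frac_le mult_mono) auto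
    thus ?thesis using n by (auto simp: mode_cov_def)
  qed
  have "\<sigma> * m0 \<le> ((eigenfun bc 1 y)\<^sup>2 + (eigenfun bc 2 y)\<^sup>2) * m0"
    using eigenfun_pair_ge[of 1 y bc] \<sigma> m0 by (intro mult_right_mono) (auto simp: numeral_2_eq_2)
  also have "\<dots> = (\<Sum>n\<in>{1, 2}. (eigenfun bc n y)\<^sup>2 * m0)" by (simp add: distrib_right)
  also have "\<dots> \<le> (\<Sum>n\<in>{1, 2}. (eigenfun bc n y)\<^sup>2 * mode_cov n t s)"
    using mc by (intro sum_mono mult_left_mono) auto
  also have "\<dots> \<le> heat_cov bc y t s"
    unfolding heat_cov_def using mode_cov_bounds(1)[OF s0 s(3)] by (intro sum_le_suminf heat_cov_summable s0 s(3)) auto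
  finally show ?thesis unfolding m0_def .
qed

text \<open>Up to factors free of \<open>q\<close>, the covariance of mode \<open>n > 0\<close>
  between times \<open>q \<le> r\<close> is \<open>sinh (\<mu> * q)\<close>, which increases with
  \<open>q\<close>. This yields \<open>end_corr\<close>.\<close>

lemma heat_cov_mono:
  assumes "0 \<le> s" "s \<le> t" "t \<le> r"
  shows "heat_cov bc y r s \<le> heat_cov bc y r t"
  unfolding heat_cov_def
proof (intro suminf_le heat_cov_summable mult_left_mono)
  fix n
  show "mode_cov n r s \<le> mode_cov n r t"
  proof (cases "n = 0")
    case False
    define \<mu> where "\<mu> = eigenval n"
    have \<mu>: "0 < \<mu>" using False by (simp add: \<mu>_def eigenval_pos)
    have e: "mode_cov n r q = (exp (- (\<mu> * (r - q))) - exp (- (\<mu> * (r + q)))) / (2 * \<mu>)" for q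
    proof -
      have "exp (- \<mu> * (r - q)) * (1 - exp (- 2 * \<mu> * q)) = exp (- (\<mu> * (r - q))) - exp (- (\<mu> * (r + q)))"
        by (simp add: right_diff_distrib exp_add[symmetric] algebra_simps)
      thus ?thesis using False by (simp add: mode_cov_def \<mu>_def[symmetric])
    qed
    have "\<mu> * (r - t) \<le> \<mu> * (r - s)" "\<mu> * (r + s) \<le> \<mu> * (r + t)" using \<mu> assms by (auto intro!: mult_left_mono)
    hence "exp (- (\<mu> * (r - s))) \<le> exp (- (\<mu> * (r - t)))" "exp (- (\<mu> * (r + t))) \<le> exp (- (\<mu> * (r + s)))" by auto
    thus ?thesis unfolding e using \<mu> by (intro divide_right_mono diff_mono) auto
  qed (use assms in \<open>simp add: mode_cov_def\<close>)
qed (use assms in auto)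

text \<open>No mode gains covariance. Modes with \<open>n\<close> of order \<open>m\<close>, about
  \<open>1 / sqrt \<tau>\<close>, have decayed by a fixed factor and lose at least a multiple of
  \<open>1 / m\<^sup>2\<close> each; by \<open>eigenfun_block_ge\<close> a block of
  \<open>2 * m\<close> of them has total weight at least \<open>m * \<sigma>\<close>. The loss is
  thus at least of order \<open>\<sigma> / m\<close>, that is,
  \<open>\<sigma> * sqrt \<tau>\<close>.\<close>

lemma heat_cov_neg_corr:
  assumes s: "0 < c1" "c1 \<le> s" "s \<le> t" "t - s \<le> 1" and \<sigma>: "0 < \<sigma>" "\<sigma> \<le> (sin (pi * y))\<^sup>2"
  shows "heat_cov bc y t s - heat_cov bc y s s \<le> - (\<sigma> * (1 - exp (- 2 * eigenval 1 * c1)) / (128 * pi\<^sup>2) * sqrt (t - s))"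
proof (cases "t = s")
  case False
  define \<tau> where "\<tau> = t - s"
  have \<tau>: "0 < \<tau>" "\<tau> \<le> 1" using s False by (auto simp: \<tau>_def)
  have s0: "0 \<le> s" using s by simp
  define g where "g = 1 - exp (- 2 * eigenval 1 * c1)"
  have g: "0 \<le> g" using s by (simp add: g_def eigenval_nonneg)
  define G where "G n = mode_cov n s s - mode_cov n t s" for n
  note sm = heat_cov_summable[of s s bc y, OF s0 order_refl] heat_cov_summable[of s t bc y, OF s0 s(3)]
  have sG: "summable (\<lambda>n. (eigenfun bc n y)\<^sup>2 * G n)"
    unfolding G_def using summable_diff[OF sm] by (simp add: algebra_simps)
  have e: "heat_cov bc y s s - heat_cov bc y t s = (\<Sum>n. (eigenfun bc n y)\<^sup>2 * G n)"
    unfolding G_def heat_cov_def using suminf_diff[OF sm] by (simp add: algebra_simps)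
  have Ge: "G n = (1 - exp (- eigenval n * \<tau>)) * (1 - exp (- 2 * eigenval n * s)) / (2 * eigenval n)" if "0 < n" for n
    using that by (simp add: G_def mode_cov_def \<tau>_def diff_divide_distrib left_diff_distrib)
  have G0: "0 \<le> G n" for n
  proof (cases "n = 0")
    case True thus ?thesis by (simp add: G_def mode_cov_def)
  next
    case False
    hence "0 < n" by simp
    thus ?thesis unfolding Ge[OF \<open>0 < n\<close>] using \<tau> s0 eigenval_nonneg[of n] by (intro divide_nonneg_nonneg mult_nonneg_nonneg) auto
  qed
  txt \<open>Only the frequencies between \<open>2 m\<close> and \<open>4 m\<close> with \<open>m \<approx> \<tau>\<^bsup>-1/2\<^esup>\<close> are kept.\<close>
  define m where "m = nat \<lceil>1 / sqrt \<tau>\<rceil>"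
  have sq: "0 < sqrt \<tau>" "sqrt \<tau> \<le> 1" "(sqrt \<tau>)\<^sup>2 = \<tau>" using \<tau> by auto
  have m1: "1 / sqrt \<tau> \<le> real m" unfolding m_def by linarith
  define r where "r = 1 / sqrt \<tau>"
  have "real m \<le> r + 1" unfolding m_def r_def using sq by (simp add: ceiling_le_iff)
  moreover have "1 \<le> r" using sq by (simp add: r_def)
  moreover have "2 / sqrt \<tau> = 2 * r" by (simp add: r_def)
  ultimately have m2: "real m \<le> 2 / sqrt \<tau>" by linarith
  have "0 < 1 / sqrt \<tau>" using sq by simp
  hence mr: "0 < real m" using m1 by linarith
  hence mp: "0 < m" by simp
  have Gm: "1 / 2 * g / (32 * pi\<^sup>2 * (real m)\<^sup>2) \<le> G n" if n: "n \<in> {2 * m..<2 * m + 2 * m}" for n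
  proof -
    have n0: "0 < n" using n mp by simp
    have nr: "2 * real m \<le> real n" "real n \<le> 4 * real m" using n by auto
    have "1 / sqrt \<tau> \<le> real n" using m1 nr mr by linarith
    hence "(1 / sqrt \<tau>)\<^sup>2 \<le> (real n)\<^sup>2" using sq by (intro power_mono) auto
    hence "1 / \<tau> \<le> (real n)\<^sup>2" using sq by (simp add: power_divide)
    also have "\<dots> \<le> eigenval n" by (rule eigenval_ge)
    finally have "1 \<le> eigenval n * \<tau>" using \<tau> by (simp add: field_simps)
    hence "exp (- eigenval n * \<tau>) \<le> exp (- 1)" by simp
    also have "\<dots> \<le> 1 / 2" using exp_ge_add_one_self[of 1] by (simp add: exp_minus field_simps)
    finally have 1: "1 / 2 \<le> 1 - exp (- eigenval n * \<tau>)" by simp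
    have "eigenval 1 * c1 \<le> eigenval n * s" using s n0 eigenval_nonneg[of 1] by (intro mult_mono eigenval_mono) (auto simp: eigenval_nonneg)
    hence 2: "g \<le> 1 - exp (- 2 * eigenval n * s)" by (simp add: g_def)
    have "(real n)\<^sup>2 \<le> (4 * real m)\<^sup>2" using nr by (intro power_mono) auto
    hence "pi\<^sup>2 * (real n)\<^sup>2 \<le> pi\<^sup>2 * (4 * real m)\<^sup>2" by (intro mult_left_mono) auto
    hence 3: "2 * eigenval n \<le> 32 * pi\<^sup>2 * (real m)\<^sup>2" by (simp add: eigenval_def power_mult_distrib)
    have A: "1 / 2 * g \<le> (1 - exp (- eigenval n * \<tau>)) * (1 - exp (- 2 * eigenval n * s))" using 1 2 g by (intro mult_mono) linarith+
    moreover have "0 \<le> 1 / 2 * g" using g by simp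
    ultimately show ?thesis unfolding Ge[OF n0] using 3 eigenval_pos[OF n0] by (intro frac_le) linarith+
  qed
  \<comment> \<open>The 64 is \<open>2 * 2 * 4\<^sup>2\<close>, from
    \<open>exp (- 1) \<le> 1 / 2\<close>, the denominator of \<open>mode_cov\<close> and
    \<open>n \<le> 4 * m\<close>; \<open>m \<le> 2 / sqrt \<tau>\<close> doubles it to 128.\<close>
  have "\<sigma> * g / (128 * pi\<^sup>2) * sqrt \<tau> \<le> \<sigma> * g / (64 * pi\<^sup>2 * real m)"
  proof -
    have "sqrt \<tau> * real m \<le> 2" using m2 sq by (simp add: field_simps)
    hence "(\<sigma> * g) * (sqrt \<tau> * real m) \<le> (\<sigma> * g) * 2" using \<sigma> g by (intro mult_left_mono) auto
    thus ?thesis using mr by (simp add: field_simps)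
  qed
  also have "\<dots> = (real m * \<sigma>) * (1 / 2 * g / (32 * pi\<^sup>2 * (real m)\<^sup>2))" using mr by (simp add: power2_eq_square field_simps)
  also have "\<dots> \<le> (\<Sum>n\<in>{2 * m..<2 * m + 2 * m}. (eigenfun bc n y)\<^sup>2) * (1 / 2 * g / (32 * pi\<^sup>2 * (real m)\<^sup>2))"
  proof (intro mult_right_mono)
    have "real m * \<sigma> \<le> real m * (sin (pi * y))\<^sup>2" using \<sigma> by (intro mult_left_mono) auto
    also have "\<dots> \<le> (\<Sum>n\<in>{2 * m..<2 * m + 2 * m}. (eigenfun bc n y)\<^sup>2)" using mp by (intro eigenfun_block_ge) simp
    finally show "real m * \<sigma> \<le> (\<Sum>n\<in>{2 * m..<2 * m + 2 * m}. (eigenfun bc n y)\<^sup>2)" .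
  qed (use g in simp)
  also have "\<dots> \<le> (\<Sum>n\<in>{2 * m..<2 * m + 2 * m}. (eigenfun bc n y)\<^sup>2 * G n)"
    unfolding sum_distrib_right using Gm by (intro sum_mono mult_left_mono) auto
  also have "\<dots> \<le> (\<Sum>n. (eigenfun bc n y)\<^sup>2 * G n)" using G0 by (intro sum_le_suminf sG) auto
  finally show ?thesis unfolding e[symmetric] g_def \<tau>_def by simp
qed simp

end

section \<open>The heat equation as a Gaussian path and the final estimate\<close>

lemma mild_solution_covariance:
  assumes "prob_space M" "brownian_sheet M W" "continuous_mild_solution M W bc u" "0 \<le> s" "s \<le> t" "y \<in> {0..1}"
  shows "u t y \<in> sheet.wiener_space M W" "gaussian_space.ip M (u t y) (u s y) = heat_cov bc y t s"
proof -
  interpret prob_space M by fact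
  interpret sheet M W by unfold_locales fact
  have h: "has_wiener_integral M W (\<lambda>(r, v). if r < q then green bc (q - r) y v else 0) (u q y)" if "0 \<le> q" for q
    using assms that unfolding continuous_mild_solution_def by blast
  have t: "0 \<le> t" using assms by simp
  show "u t y \<in> wiener_space" using h[OF t] by (auto simp: wiener_space_def)
  note w = wiener_covariance[OF h[OF t] h[OF assms(4)]]
  show "gaussian_space.ip M (u t y) (u s y) = heat_cov bc y t s"
    unfolding w(2) using assms(4,5) w(1) by (rule integral_green_kernel)
qed

text \<open>For \<open>\<bar>z\<bar> > 1\<close> the Gaussian beats the power: \<open>\<bar>z\<bar>
  powr (1/4) \<le> z\<^sup>2 \<le> v * exp (z\<^sup>2 / v)\<close>. For
  \<open>\<bar>z\<bar> \<le> 1\<close> the decay factor is 1.\<close>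

lemma decay_factor_ge:
  assumes "0 < v"
  shows "exp (- z\<^sup>2 / v) \<le> (1 + v) * decay_factor z"
proof (cases "\<bar>z\<bar> \<le> 1")
  case True
  have d1: "decay_factor z = 1"
  proof (cases "z = 0")
    case False
    have "1 powr (-1/4) \<le> \<bar>z\<bar> powr (-1/4)" using False True by (intro powr_mono2') auto
    thus ?thesis using False by (simp add: decay_factor_def)
  qed (simp add: decay_factor_def)
  have "exp (- z\<^sup>2 / v) \<le> 1" using assms by simp
  thus ?thesis unfolding d1 mult_1_right using assms by linarith
next
  case False
  hence z: "1 < \<bar>z\<bar>" by simp
  have "\<bar>z\<bar> powr (-1/4) \<le> 1 powr (-1/4)" using z by (intro powr_mono2') auto
  hence d: "decay_factor z = \<bar>z\<bar> powr (-1/4)" using z by (auto simp: decay_factor_def)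
  have "\<bar>z\<bar> powr (1/4) \<le> \<bar>z\<bar> powr 2" using z by (intro powr_mono) auto
  also have "\<dots> = z\<^sup>2" using z by (simp add: powr_numeral)
  also have "z\<^sup>2 = v * (z\<^sup>2 / v)" using assms by simp
  also have "\<dots> \<le> v * exp (z\<^sup>2 / v)"
  proof (intro mult_left_mono)
    show "z\<^sup>2 / v \<le> exp (z\<^sup>2 / v)" using exp_ge_add_one_self[of "z\<^sup>2 / v"] by linarith
  qed (use assms in simp)
  also have "\<dots> \<le> (1 + v) * exp (z\<^sup>2 / v)" by (intro mult_right_mono) auto
  finally have "\<bar>z\<bar> powr (1/4) * exp (- (z\<^sup>2 / v)) \<le> 1 + v" by (simp add: exp_minus field_simps)
  hence "\<bar>z\<bar> powr (1/4) * exp (- (z\<^sup>2 / v)) * \<bar>z\<bar> powr (-1/4) \<le> (1 + v) * \<bar>z\<bar> powr (-1/4)" by (intro mult_right_mono) auto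
  moreover have "\<bar>z\<bar> powr (1/4) * \<bar>z\<bar> powr (-1/4) = 1" using z by (simp add: powr_add[symmetric])
  ultimately show ?thesis unfolding d by (simp add: ac_simps)
qed

lemma decay_factor_bounds: "0 \<le> decay_factor z" "decay_factor z \<le> 1"
  by (auto simp: decay_factor_def)


theorem theorem1p2:
  fixes bc :: boundary_condition
    and T c1 C1 c2 C2 :: real
    and I J :: "real set"
  assumes "0 < T"
    and "nontrivial_compact_interval I" "nontrivial_compact_interval J"
    and "I \<subseteq> {0<..T}" "J \<subseteq> {0<..<1}"
    and "0 < c1" "c1 < Inf I" "Sup I < C1" "C1 < T + 1"
    and "0 < c2" "c2 < Inf J" "Sup J < C2" "C2 < 1"
  shows "\<exists>c>0. \<forall>(M :: 'w measure) W u.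
    prob_space M \<longrightarrow> brownian_sheet M W \<longrightarrow> continuous_mild_solution M W bc u \<longrightarrow>
    (\<forall>s0\<in>I. \<forall>y0\<in>J. \<forall>\<delta>1\<in>{0<..<1}.
      s0 + \<delta>1 \<in> I \<longrightarrow> \<delta>1 powr (1/2) < min (Inf J - c2) ((C2 - Sup J) / 2) \<longrightarrow>
      (\<forall>p. smooth_density_on M (\<lambda>\<omega>. (F1 u s0 y0 \<omega>, F2 u s0 y0 \<delta>1 \<omega>)) (UNIV \<times> {0<..}) p \<longrightarrow>
        (\<forall>z1 z2. \<delta>1 powr (1/4) \<le> z2 \<longrightarrow>
          p (z1, z2) \<le> c / \<delta>1 powr (1/4) * exp (- (z2\<^sup>2 / (c * \<delta>1 powr (1/2))))
                        * decay_factor z1 * exp (- (z1\<^sup>2 / c)) \<and>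
          c / \<delta>1 powr (1/4) * exp (- (z2\<^sup>2 / (c * \<delta>1 powr (1/2))))
              * decay_factor z1 * exp (- (z1\<^sup>2 / c))
            \<le> c / \<delta>1 powr (1/4) * exp (- (z2\<^sup>2 / (c * \<delta>1 powr (1/2)))))))"
proof -
  obtain i1 i2 where I: "i1 < i2" "I = {i1..i2}" using assms(2) by (auto simp: nontrivial_compact_interval_def)
  obtain j1 j2 where J: "j1 < j2" "J = {j1..j2}" using assms(3) by (auto simp: nontrivial_compact_interval_def)
  have c1: "c1 \<le> s" "s \<le> T" if "s \<in> I" for s using that assms(4,7) I by auto
  \<comment> \<open>The lower bounds by eigenfunctions degenerate at the boundary; the minimum of
    \<open>(sin (pi * y))\<^sup>2\<close> over the compact \<open>J\<close> inside
    \<open>]0, 1[\<close> makes them uniform in \<open>y0\<close>.\<close>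
  have "\<exists>x\<in>J. \<forall>y\<in>J. (sin (pi * x))\<^sup>2 \<le> (sin (pi * y))\<^sup>2"
    using J by (intro continuous_attains_inf) (auto intro!: continuous_intros)
  then obtain x0 where x0: "x0 \<in> J" "\<And>y. y \<in> J \<Longrightarrow> (sin (pi * x0))\<^sup>2 \<le> (sin (pi * y))\<^sup>2" by blast
  define \<sigma> where "\<sigma> = (sin (pi * x0))\<^sup>2"
  have "0 < x0" "x0 < 1" using x0(1) assms(5) by auto
  hence "0 < sin (pi * x0)" by (intro sin_gt_zero) auto
  hence \<sigma>: "0 < \<sigma>" by (simp add: \<sigma>_def)
  \<comment> \<open>One constant bounds from below both the variance at \<open>s0\<close> and the
    covariance between \<open>s0\<close> and \<open>s0 + \<delta>\<close>, as
    \<open>heat_cov_lower\<close> covers all time differences up to 1.\<close>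
  define \<kappa>0 where "\<kappa>0 = \<sigma> * (exp (- eigenval 2) * (1 - exp (- 2 * eigenval 1 * c1)) / (2 * eigenval 2))"
  define vmax where "vmax = 2 * T + (\<Sum>n. 1 / eigenval n)"
  define k1 where "k1 = \<sigma> * (1 - exp (- 2 * eigenval 1 * c1)) / (128 * pi\<^sup>2)"
  have ep: "0 < eigenval 1" "0 < eigenval 2" by (simp_all add: eigenval_pos)
  have \<kappa>0: "0 < \<kappa>0" using \<sigma> ep assms(6) by (simp add: \<kappa>0_def)
  have k1: "0 < k1" using \<sigma> ep assms(6) by (simp add: k1_def)
  have vv: "\<kappa>0 \<le> vmax"
  proof -
    have i: "i1 \<in> I" using I by auto
    have "\<kappa>0 \<le> heat_cov bc x0 i1 i1" unfolding \<kappa>0_def using c1[OF i] assms(6) by (intro heat_cov_lower) (auto simp: \<sigma>_def)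
    also have "\<dots> \<le> 2 * i1 + (\<Sum>n. 1 / eigenval n)" using c1[OF i] assms(6) by (intro heat_cov_upper) auto
    also have "\<dots> \<le> vmax" using c1[OF i] by (simp add: vmax_def)
    finally show ?thesis .
  qed
  have vmax: "0 < vmax" using \<kappa>0 vv by linarith
  have K8: "0 < (8::real)" by simp
  obtain C g where C: "0 < C" and g: "0 < g" and box: "\<forall>(M :: 'w measure) H U s \<delta> x h z2 k. gaussian_path M H U s \<delta> \<kappa>0 vmax 8 k1 \<kappa>0 \<longrightarrow> 0 < h \<longrightarrow> 0 < k \<longrightarrow> \<delta> powr (1 / 4) \<le> z2 \<longrightarrow>
      measure M {\<omega> \<in> space M. U s \<omega> \<in> {x..x + h} \<and> z2 < (SUP t\<in>{s..s + \<delta>}. U t \<omega> - U s \<omega>) \<and> (SUP t\<in>{s..s + \<delta>}. U t \<omega> - U s \<omega>) \<le> z2 + k}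
      \<le> h * k * (C / \<delta> powr (1 / 4)) * exp (- (x\<^sup>2 - 2 * \<bar>x\<bar> * h) / (2 * vmax)) * exp ((\<bar>x\<bar> + h)\<^sup>2 / (4 * vmax)) * exp (- (g * z2\<^sup>2 / sqrt \<delta>))"
    using box_bound[OF \<kappa>0 vv K8 k1 \<kappa>0] by blast
  \<comment> \<open>The three bounds serve the prefactor, the exponent in \<open>z2\<close> and the
    exponent in \<open>z1\<close>.\<close>
  define c where "c = max (C * (1 + 8 * vmax)) (max (1 / g) (8 * vmax))"
  have c: "C * (1 + 8 * vmax) \<le> c" "1 / g \<le> c" "8 * vmax \<le> c" by (auto simp: c_def)
  have cp: "0 < c" using c(3) vmax by linarith
  show ?thesis
  proof (intro exI[of _ c] conjI cp allI impI ballI)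
    fix M :: "'w measure" and W u s0 y0 \<delta> p z1 z2
    assume M: "prob_space M" "brownian_sheet M W" "continuous_mild_solution M W bc u"
      and s0: "s0 \<in> I" and y0: "y0 \<in> J" and \<delta>: "\<delta> \<in> {0<..<1}" and s1: "s0 + \<delta> \<in> I"
      and sd: "smooth_density_on M (\<lambda>\<omega>. (F1 u s0 y0 \<omega>, F2 u s0 y0 \<delta> \<omega>)) (UNIV \<times> {0<..}) p"
      and z2: "\<delta> powr (1/4) \<le> z2"
    interpret prob_space M by (rule M)
    interpret sheet M W by unfold_locales (rule M)
    interpret gaussian_space M wiener_space by (rule gaussian_space_wiener)
    have \<delta>p: "0 < \<delta>" "\<delta> \<le> 1" using \<delta> by auto
    define \<beta> where "\<beta> = \<delta> powr (1/4)"
    have \<beta>: "0 < \<beta>" using \<delta>p by (simp add: \<beta>_def)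
    have y01: "y0 \<in> {0..1}" using y0 assms(5) by auto
    have s0p: "0 \<le> s0" "c1 \<le> s0" "s0 + \<delta> \<le> T" using c1[OF s0] c1[OF s1] assms(6) by auto
    define U where "U t = u t y0" for t
    have mem: "U t \<in> wiener_space" if "0 \<le> t" for t
      using mild_solution_covariance(1)[OF M that order_refl y01] by (simp add: U_def)
    have cov: "ip (U t) (U s) = heat_cov bc y0 t s" if "0 \<le> s" "s \<le> t" for s t
      using mild_solution_covariance(2)[OF M that y01] by (simp add: U_def)
    have \<sigma>y: "\<sigma> \<le> (sin (pi * y0))\<^sup>2" unfolding \<sigma>_def by (rule x0(2)[OF y0])
    have path: "gaussian_path M wiener_space U s0 \<delta> \<kappa>0 vmax 8 k1 \<kappa>0"
    proof
      show "0 < \<delta>" "\<delta> \<le> 1" "0 < \<kappa>0" "0 < (8::real)" "0 < k1" by (fact \<delta>p \<kappa>0 k1 | simp)+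
      show "U t \<in> wiener_space" if "s0 \<le> t" "t \<le> s0 + \<delta>" for t using that s0p by (intro mem) auto
      show "continuous_on {s0..s0 + \<delta>} (\<lambda>t. U t \<omega>)" if "\<omega> \<in> space M" for \<omega>
      proof -
        have "continuous_on ({0..} \<times> {0..1}) (\<lambda>(t, x). u t x \<omega>)" using M(3) that by (simp add: continuous_mild_solution_def)
        moreover have "continuous_on {s0..s0 + \<delta>} (\<lambda>t. (t, y0))" by (intro continuous_intros)
        ultimately have "continuous_on {s0..s0 + \<delta>} (\<lambda>t. (\<lambda>(t, x). u t x \<omega>) (t, y0))"
          by (rule continuous_on_compose2) (use s0p y01 in auto)
        thus ?thesis by (simp add: U_def)
      qed
      show "\<kappa>0 \<le> ip (U s0) (U s0)"
        unfolding cov[OF s0p(1) order_refl] \<kappa>0_def using s0p assms(6) \<sigma>y by (intro heat_cov_lower) auto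
      show "ip (U s0) (U s0) \<le> vmax"
        unfolding cov[OF s0p(1) order_refl] vmax_def using heat_cov_upper[OF s0p(1), of bc y0] s0p \<delta>p by linarith
      show "incr_var (U t) (U r) \<le> 8 * sqrt (t - r)" if "s0 \<le> r" "r \<le> t" "t \<le> s0 + \<delta>" for r t
      proof -
        have rt: "0 \<le> r" "0 \<le> t" using that s0p by auto
        have "incr_var (U t) (U r) = ip (U t) (U t) + ip (U r) (U r) - 2 * ip (U t) (U r)"
          using mem rt by (simp add: ip_diff ip_diff2 diff_mem ip_commute[of "U r" "U t"])
        also have "\<dots> = heat_cov bc y0 t t + heat_cov bc y0 r r - 2 * heat_cov bc y0 t r" using cov rt that by simp
        also have "\<dots> \<le> 8 * sqrt (t - r)" using rt that \<delta>p by (intro heat_cov_increment_le) auto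
        finally show ?thesis .
      qed
      show "ip (U t) (U s0) - ip (U s0) (U s0) \<le> - (k1 * sqrt (t - s0))" if "s0 \<le> t" "t \<le> s0 + \<delta>" for t
        unfolding cov[OF s0p(1) that(1)] cov[OF s0p(1) order_refl] k1_def
        using s0p that \<delta>p assms(6) \<sigma> \<sigma>y by (intro heat_cov_neg_corr) auto
      show "ip (U s0) (U (s0 + \<delta>)) \<le> ip (U t) (U (s0 + \<delta>))" if "s0 \<le> t" "t \<le> s0 + \<delta>" for t
      proof -
        have "heat_cov bc y0 (s0 + \<delta>) s0 \<le> heat_cov bc y0 (s0 + \<delta>) t" using s0p that by (intro heat_cov_mono) auto
        thus ?thesis using cov[of s0 "s0 + \<delta>"] cov[of t "s0 + \<delta>"] s0p that \<delta>p by (simp add: ip_commute[of _ "U (s0 + \<delta>)"])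
      qed
      have "s0 \<le> s0 + \<delta>" using \<delta>p by simp
      show "\<kappa>0 \<le> ip (U (s0 + \<delta>)) (U s0)"
        unfolding cov[OF s0p(1) \<open>s0 \<le> s0 + \<delta>\<close>] \<kappa>0_def using s0p \<delta>p assms(6) \<sigma>y by (intro heat_cov_lower) auto
    qed
    \<comment> \<open>The box bound divided by the area of the box; it is continuous in
      \<open>h\<close> down to 0.\<close>
    define \<Psi> where "\<Psi> h = (C / \<beta>) * exp (- (z1\<^sup>2 - 2 * \<bar>z1\<bar> * h) / (2 * vmax)) * exp ((\<bar>z1\<bar> + h)\<^sup>2 / (4 * vmax)) * exp (- (g * z2\<^sup>2 / sqrt \<delta>))" for h
    have "p (z1, z2) \<le> \<Psi> 0"
    proof (rule density_le_of_box_bound[OF M(1) sd])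
      show "0 < z2" using z2 \<beta> unfolding \<beta>_def by linarith
      have "continuous_on UNIV \<Psi>" unfolding \<Psi>_def using vmax \<beta> by (intro continuous_intros) auto
      hence "(\<Psi> \<longlongrightarrow> \<Psi> 0) (at 0)" by (simp add: continuous_on_def)
      thus "(\<Psi> \<longlongrightarrow> \<Psi> 0) (at_right 0)" by (rule filterlim_at_split[THEN iffD1, THEN conjunct2])
      show "prob {\<omega> \<in> space M. F1 u s0 y0 \<omega> \<in> {z1..z1 + h} \<and> z2 < F2 u s0 y0 \<delta> \<omega> \<and> F2 u s0 y0 \<delta> \<omega> \<le> z2 + h} \<le> h * h * \<Psi> h" if "0 < h" for h
        using box[rule_format, OF path that that z2, of z1] unfolding F1_def F2_def U_def \<Psi>_def \<beta>_def by (simp only: mult.assoc)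
    qed
    \<comment> \<open>The half of the normal exponent that \<open>box_bound\<close> leaves is split
      evenly: one part becomes the decay factor, the other the last exponential.\<close>
    also have "\<Psi> 0 = (C / \<beta>) * (exp (- z1\<^sup>2 / (8 * vmax)) * exp (- z1\<^sup>2 / (8 * vmax))) * exp (- (g * z2\<^sup>2 / sqrt \<delta>))"
    proof -
      have "exp (- (z1\<^sup>2 - 2 * \<bar>z1\<bar> * 0) / (2 * vmax)) * exp ((\<bar>z1\<bar> + 0)\<^sup>2 / (4 * vmax)) = exp (- z1\<^sup>2 / (8 * vmax)) * exp (- z1\<^sup>2 / (8 * vmax))"
        unfolding exp_add[symmetric] using vmax by (simp add: field_simps)
      thus ?thesis unfolding \<Psi>_def by (simp only: mult.assoc)
    qed
    also have "\<dots> \<le> (C / \<beta>) * (((1 + 8 * vmax) * decay_factor z1) * exp (- (z1\<^sup>2 / c))) * exp (- (z2\<^sup>2 / (c * sqrt \<delta>)))"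
    proof (intro mult_mono decay_factor_ge)
      have "z1\<^sup>2 / c \<le> z1\<^sup>2 / (8 * vmax)" using c(3) vmax cp by (intro divide_left_mono) auto
      thus "exp (- z1\<^sup>2 / (8 * vmax)) \<le> exp (- (z1\<^sup>2 / c))" by simp
      have "1 / c \<le> g" using c(2) g cp by (simp add: field_simps)
      hence "(1 / c) * (z2\<^sup>2 / sqrt \<delta>) \<le> g * (z2\<^sup>2 / sqrt \<delta>)" using \<delta>p by (intro mult_right_mono) auto
      thus "exp (- (g * z2\<^sup>2 / sqrt \<delta>)) \<le> exp (- (z2\<^sup>2 / (c * sqrt \<delta>)))" by simp
    qed (use C \<beta> vmax decay_factor_bounds[of z1] in auto)
    also have "\<dots> = (C * (1 + 8 * vmax)) * ((1 / \<beta>) * exp (- (z2\<^sup>2 / (c * sqrt \<delta>))) * decay_factor z1 * exp (- (z1\<^sup>2 / c)))"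
      by (simp add: ac_simps)
    also have "\<dots> \<le> c * ((1 / \<beta>) * exp (- (z2\<^sup>2 / (c * sqrt \<delta>))) * decay_factor z1 * exp (- (z1\<^sup>2 / c)))"
      using c(1) \<beta> decay_factor_bounds[of z1] by (intro mult_right_mono mult_nonneg_nonneg) auto
    finally show "p (z1, z2) \<le> c / \<delta> powr (1/4) * exp (- (z2\<^sup>2 / (c * \<delta> powr (1/2)))) * decay_factor z1 * exp (- (z1\<^sup>2 / c))"
      using \<delta>p by (simp add: \<beta>_def powr_half_sqrt)
    have "c / \<delta> powr (1/4) * exp (- (z2\<^sup>2 / (c * \<delta> powr (1/2)))) * (decay_factor z1 * exp (- (z1\<^sup>2 / c))) \<le> c / \<delta> powr (1/4) * exp (- (z2\<^sup>2 / (c * \<delta> powr (1/2)))) * (1 * 1)"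
      using cp decay_factor_bounds[of z1] by (intro mult_left_mono mult_mono) auto
    thus "c / \<delta> powr (1/4) * exp (- (z2\<^sup>2 / (c * \<delta> powr (1/2)))) * decay_factor z1 * exp (- (z1\<^sup>2 / c)) \<le> c / \<delta> powr (1/4) * exp (- (z2\<^sup>2 / (c * \<delta> powr (1/2))))"
      by (simp add: mult.assoc)
  qed
qed

end
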